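(* Let $d,m\ge1$ be integers, let $\mathbf N=(N_1,\dots,N_d)$ be a tuple of positive integers, and let $p_{\mathbf x},p_{\mathbf y}$ be the laws of two zero-mean Gaussian stationary periodic random fields $\mathbf x=\{\mathbf x_{\mathbf t},\ \mathbf t\in\mathbb Z^d\}$ and $\mathbf y=\{\mathbf y_{\mathbf t},\ \mathbf t\in\mathbb Z^d\}$ with values in $\mathbb R^m$ and period $\mathbf N$, whose power spectral densities satisfy $\Phi_{\mathbf x}(\boldsymbol\zeta_{\boldsymbol\ell})>0$ and $\Phi_{\mathbf y}(\boldsymbol\zeta_{\boldsymbol\ell})>0$ (positive definite) for every $\boldsymbol\ell\in\mathbb Z^d_{\mathbf N}$. Let $\mathbf h=\{H_{\mathbf t},\ \mathbf t\in\mathbb Z^d\}$, $H_{\mathbf t}\in\mathbb R^{m\times m}$, be $\mathbf N$-periodic, let $H(\boldsymbol\zeta_{\boldsymbol\ell})=\sum_{\mathbf t\in\mathbb Z^d_{\mathbf N}}H_{\mathbf t}\boldsymbol\zeta_{\boldsymbol\ell}^{-\mathbf t}$, and let $\Omega(\boldsymbol\zeta_{\boldsymbol\ell})=H(\boldsymbol\zeta_{\boldsymbol\ell})^*H(\boldsymbol\zeta_{\boldsymbol\ell})$ for $\boldsymbol\ell\in\mathbb Z^d_{\mathbf N}$. Let $$d_\Omega(p_{\mathbf x},p_{\mathbf y})^2:=\inf_{p_{\mathbf x,\mathbf y}}\ \mathbb E\big[\|(\mathbf h\ast(\mathbf x-\mathbf y))_{\mathbf t}\|^2\big],$$ where the infimum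 is over all jointly Gaussian, jointly stationary, zero-mean laws $p_{\mathbf x,\mathbf y}$ of the pair of $\mathbf N$-periodic fields $(\mathbf x,\mathbf y)$ whose marginals are $p_{\mathbf x}$ and $p_{\mathbf y}$. Then $$d_\Omega(p_{\mathbf x},p_{\mathbf y})^2=\frac{1}{|\mathbf N|}\operatorname{tr}\sum_{\boldsymbol\ell\in\mathbb Z^d_{\mathbf N}}\Big(\Omega(\boldsymbol\zeta_{\boldsymbol\ell})\Phi_{\mathbf x}(\boldsymbol\zeta_{\boldsymbol\ell})+\Omega(\boldsymbol\zeta_{\boldsymbol\ell})\Phi_{\mathbf y}(\boldsymbol\zeta_{\boldsymbol\ell})-2\big(\Phi_{\mathbf y}(\boldsymbol\zeta_{\boldsymbol\ell})^{1/2}\,\Omega(\boldsymbol\zeta_{\boldsymbol\ell})\,\Phi_{\mathbf x}(\boldsymbol\zeta_{\boldsymbol\ell})\,\Omega(\boldsymbol\zeta_{\boldsymbol\ell})\,\Phi_{\mathbf y}(\boldsymbol\zeta_{\boldsymbol\ell})^{1/2}\big)^{1/2}\Big),$$ that is, $d_\Omega(p_{\mathbf x},p_{\mathbf y})$ is the weighted Hellinger distance between $\Phi_{\mathbf x}$ and $\Phi_{\mathbf y}$ with weight function $\Omega$.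
   Context: Notation: $\mathbb Z^d_{\mathbf N}=\{\mathbf t=(t_1,\dots,t_d)\in\mathbb Z^d:\ 0\le t_l\le N_l-1,\ l=1,\dots,d\}$; $|\mathbf N|=\prod_{l=1}^dN_l$; $j$ is the imaginary unit; $\|\cdot\|$ is the Euclidean norm; $A^*$ is the conjugate transpose; $A^{1/2}$ is the Hermitian positive semidefinite square root of a positive semidefinite Hermitian matrix $A$. The symbol $\ast$ is circular discrete convolution: $(\mathbf h\ast\mathbf z)_{\mathbf t}=\sum_{\mathbf s\in\mathbb Z^d_{\mathbf N}}H_{\mathbf t-\mathbf s}\mathbf z_{\mathbf s}$. The sequence $\mathbf h$ is $\mathbf N$-periodic if $H_{(t_1,\dots,t_l+N_l,\dots,t_d)}=H_{(t_1,\dots,t_d)}$ for every $\mathbf t$ and every $l=1,\dots,d$. A random field $\mathbf z=\{\mathbf z_{\mathbf t}\}_{\mathbf t\in\mathbb Z^d}$ is periodic with period $\mathbf N$ if $\mathbf z_{(t_1,\dots,t_l+N_l,\dots,t_d)}=\mathbf z_{(t_1,\dots,t_d)}$ almost surely for every $\mathbf t\in\mathbb Z^d$ and every $l=1,\dots,d$. A zero-mean stationary $\mathbf N$-periodic field with values in $\mathbb R^n$ has covariance field $R_{\mathbf t}=\mathbb E[\mathbf z_{\mathbf t+\mathbf s}\mathbf z_{\mathbf s}^T]$ (independent of $\mathbf s$, and $\mathbf N$-periodic in $\mathbf t$). For $\boldsymbol\ell=(\ell_1,\dots,\ell_d)\in\mathbb Z^d_{\mathbf N}$ set $\boldsymbol\zeta_{\boldsymbol\ell}=(\zeta_{\ell_1},\dots,\zeta_{\ell_d})$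 with $\zeta_{\ell_i}=e^{j\frac{2\pi}{N_i}\ell_i}$, and $\boldsymbol\zeta_{\boldsymbol\ell}^{-\mathbf t}=\prod_{i=1}^d\zeta_{\ell_i}^{-t_i}$. The power spectral density is the Hermitian positive semidefinite matrix function $\Phi(\boldsymbol\zeta_{\boldsymbol\ell})=\sum_{\mathbf t\in\mathbb Z^d_{\mathbf N}}R_{\mathbf t}\boldsymbol\zeta_{\boldsymbol\ell}^{-\mathbf t}$, $\boldsymbol\ell\in\mathbb Z^d_{\mathbf N}$. Since the fields are zero-mean Gaussian, a law is determined by its covariance field. The joint law $p_{\mathbf x,\mathbf y}$ is the law of the $\mathbb R^{2m}$-valued zero-mean stationary $\mathbf N$-periodic Gaussian field $[\mathbf x_{\mathbf t}^T\ \mathbf y_{\mathbf t}^T]^T$, and the marginal constraints say that the law of its $\mathbf x$-component is $p_{\mathbf x}$ and that of its $\mathbf y$-component is $p_{\mathbf y}$. By stationarity the cost does not depend on $\mathbf t$. *)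

theory Defs
  imports "HOL-Probability.Probability"
begin

section \<open>The index box and periodic sequences\<close>

definition box_N :: "nat ^ 'd \<Rightarrow> (int ^ 'd) set" where
  "box_N N = {t. \<forall>l. 0 \<le> t $ l \<and> t $ l \<le> int (N $ l) - 1}"

definition periodic_seq :: "nat ^ 'd \<Rightarrow> (int ^ 'd \<Rightarrow> 'b) \<Rightarrow> bool" where
  "periodic_seq N h \<longleftrightarrow> (\<forall>t l. h (t + axis l (int (N $ l))) = h t)"

definition circ_conv ::
  "nat ^ 'd \<Rightarrow> (int ^ 'd \<Rightarrow> real ^ 'm ^ 'm) \<Rightarrow> (int ^ 'd \<Rightarrow> real ^ 'm) \<Rightarrow> int ^ 'd \<Rightarrow> real ^ 'm" where
  "circ_conv N h z t = (\<Sum>s\<in>box_N N. h (t - s) *v z s)"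

section \<open>Complex matrices\<close>

definition adjoint_mat :: "complex ^ 'n ^ 'm \<Rightarrow> complex ^ 'm ^ 'n" where
  "adjoint_mat A = (\<chi> i j. cnj (A $ j $ i))"

definition quad_form :: "complex ^ 'm ^ 'm \<Rightarrow> complex ^ 'm \<Rightarrow> complex" where
  "quad_form A v = (\<Sum>i\<in>UNIV. cnj (v $ i) * (A *v v) $ i)"

text \<open>The form of a Hermitian matrix is real, so its real part is the form itself.\<close>

definition psd_mat :: "complex ^ 'm ^ 'm \<Rightarrow> bool" where
  "psd_mat A \<longleftrightarrow> adjoint_mat A = A \<and> (\<forall>v. 0 \<le> Re (quad_form A v))"

definition pd_mat :: "complex ^ 'm ^ 'm \<Rightarrow> bool" where
  "pd_mat A \<longleftrightarrow> adjoint_mat A = A \<and> (\<forall>v. v \<noteq> 0 \<longrightarrow> 0 < Re (quad_form A v))"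

text \<open>Meaningful for positive semidefinite arguments, where the root exists and is unique.\<close>

definition sqrt_mat :: "complex ^ 'm ^ 'm \<Rightarrow> complex ^ 'm ^ 'm" where
  "sqrt_mat A = (THE B. psd_mat B \<and> B ** B = A)"

section \<open>Transforms on the discrete torus\<close>

definition zeta :: "nat ^ 'd \<Rightarrow> int ^ 'd \<Rightarrow> complex ^ 'd" where
  "zeta N l = (\<chi> i. exp (\<i> * of_real (2 * pi / real (N $ i) * real_of_int (l $ i))))"

definition mpow :: "complex ^ 'd \<Rightarrow> int ^ 'd \<Rightarrow> complex" where
  "mpow w t = (\<Prod>i\<in>UNIV. (w $ i) powi (t $ i))"

definition transform ::
  "nat ^ 'd \<Rightarrow> (int ^ 'd \<Rightarrow> real ^ 'm ^ 'm) \<Rightarrow> complex ^ 'd \<Rightarrow> complex ^ 'm ^ 'm" where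
  "transform N A w = (\<chi> i j. \<Sum>t\<in>box_N N. complex_of_real (A t $ i $ j) * mpow w (- t))"

section \<open>Laws of random fields\<close>

text \<open>The law of an \<open>\<real>\<^sup>n\<close>-valued random field on \<open>\<int>\<^sup>d\<close> is a probability measure on the path
  space with the product sigma-algebra.\<close>

abbreviation path_space :: "(int ^ 'd \<Rightarrow> real ^ 'n) measure" where
  "path_space \<equiv> PiM UNIV (\<lambda>_. borel)"

definition field_law :: "(int ^ 'd \<Rightarrow> real ^ 'n) measure \<Rightarrow> bool" where
  "field_law P \<longleftrightarrow> prob_space P \<and> sets P = sets path_space"

text \<open>All finite linear combinations of the coordinates are normal. Point masses count as normal;
  they cannot be avoided, since a periodic field is always degenerate.\<close>

definition normal_rv :: "'a measure \<Rightarrow> ('a \<Rightarrow> real) \<Rightarrow> bool" where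
  "normal_rv M X \<longleftrightarrow> (\<exists>\<mu>. (X \<in> borel_measurable M \<and> (AE \<omega> in M. X \<omega> = \<mu>)) \<or>
     (\<exists>\<sigma>>0. distributed M lborel X (\<lambda>x. ennreal (normal_density \<mu> \<sigma> x))))"

definition gaussian_law :: "(int ^ 'd \<Rightarrow> real ^ 'n) measure \<Rightarrow> bool" where
  "gaussian_law P \<longleftrightarrow> (\<forall>T c. finite T \<longrightarrow> normal_rv P (\<lambda>z. \<Sum>t\<in>T. c t \<bullet> z t))"

definition zero_mean_law :: "(int ^ 'd \<Rightarrow> real ^ 'n) measure \<Rightarrow> bool" where
  "zero_mean_law P \<longleftrightarrow> (\<forall>t. integrable P (\<lambda>z. z t) \<and> (\<integral>z. z t \<partial>P) = 0)"

definition stationary_law :: "(int ^ 'd \<Rightarrow> real ^ 'n) measure \<Rightarrow> bool" where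
  "stationary_law P \<longleftrightarrow> (\<forall>s. distr P path_space (\<lambda>z t. z (t + s)) = P)"

definition periodic_law :: "nat ^ 'd \<Rightarrow> (int ^ 'd \<Rightarrow> real ^ 'n) measure \<Rightarrow> bool" where
  "periodic_law N P \<longleftrightarrow> (\<forall>t l. AE z in P. z (t + axis l (int (N $ l))) = z t)"

definition gaussian_periodic_law :: "nat ^ 'd \<Rightarrow> (int ^ 'd \<Rightarrow> real ^ 'n) measure \<Rightarrow> bool" where
  "gaussian_periodic_law N P \<longleftrightarrow> field_law P \<and> gaussian_law P \<and> zero_mean_law P \<and>
     stationary_law P \<and> periodic_law N P"

definition cov_at ::
  "(int ^ 'd \<Rightarrow> real ^ 'n) measure \<Rightarrow> int ^ 'd \<Rightarrow> int ^ 'd \<Rightarrow> real ^ 'n ^ 'n" where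
  "cov_at P s t = (\<chi> i j. \<integral>z. z (t + s) $ i * z s $ j \<partial>P)"

lemma measurable_coord: "(\<lambda>z :: int ^ 'd \<Rightarrow> real ^ 'n. z t $ i) \<in> borel_measurable path_space"
proof -
  have "(\<lambda>v :: real ^ 'n. v $ i) \<in> borel_measurable borel"
    by (intro borel_measurable_continuous_onI continuous_intros)
  moreover have "(\<lambda>z :: int ^ 'd \<Rightarrow> real ^ 'n. z t) \<in> measurable path_space borel"
    by (rule measurable_component_singleton) simp
  ultimately show ?thesis
    by (rule measurable_compose[rotated])
qed

lemma cov_at_shift:
  fixes P :: "(int ^ 'd \<Rightarrow> real ^ 'n) measure"
  assumes "field_law P" "stationary_law P"
  shows "cov_at P s t = cov_at P 0 t"
proof -
  have [measurable_cong]: "sets P = sets path_space"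
    using assms(1) by (simp add: field_law_def)
  have "(\<lambda>z :: int ^ 'd \<Rightarrow> real ^ 'n. \<lambda>t. z (t + s)) \<in> measurable path_space path_space"
  proof (rule measurable_PiM_single')
    show "(\<lambda>z :: int ^ 'd \<Rightarrow> real ^ 'n. z (t + s)) \<in> measurable path_space borel" for t
      by (rule measurable_component_singleton) simp
  qed simp
  then have sh: "(\<lambda>z t. z (t + s)) \<in> measurable P path_space"
    by (simp cong: measurable_cong_sets)
  have "(\<integral>z. z t $ i * z 0 $ j \<partial>P) = (\<integral>z. z (t + s) $ i * z s $ j \<partial>P)" for i j
  proof -
    have "(\<integral>z. z t $ i * z 0 $ j \<partial>P) = (\<integral>z. z t $ i * z 0 $ j \<partial>distr P path_space (\<lambda>z t. z (t + s)))"
      using assms(2) by (simp add: stationary_law_def)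
    also have "\<dots> = (\<integral>z. z (t + s) $ i * z s $ j \<partial>P)"
      by (subst integral_distr[OF sh]) (auto intro!: borel_measurable_times measurable_coord)
    finally show ?thesis .
  qed
  then show ?thesis by (simp add: cov_at_def)
qed

text \<open>By the lemma above the base point is immaterial for stationary laws.\<close>

definition cov_field :: "(int ^ 'd \<Rightarrow> real ^ 'n) measure \<Rightarrow> int ^ 'd \<Rightarrow> real ^ 'n ^ 'n" where
  "cov_field P = cov_at P 0"

definition psd_density ::
  "nat ^ 'd \<Rightarrow> (int ^ 'd \<Rightarrow> real ^ 'm) measure \<Rightarrow> complex ^ 'd \<Rightarrow> complex ^ 'm ^ 'm" where
  "psd_density N P = transform N (cov_field P)"

section \<open>The transport distance and the weighted Hellinger distance\<close>

text \<open>A pair of \<open>\<real>\<^sup>m\<close>-valued fields is one \<open>\<real>\<^sup>2\<^sup>m\<close>-valued field, with coordinates indexed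
  by the sum type.\<close>

definition x_part :: "(int ^ 'd \<Rightarrow> real ^ ('m + 'm)) \<Rightarrow> int ^ 'd \<Rightarrow> real ^ 'm" where
  "x_part z t = (\<chi> i. z t $ Inl i)"

definition y_part :: "(int ^ 'd \<Rightarrow> real ^ ('m + 'm)) \<Rightarrow> int ^ 'd \<Rightarrow> real ^ 'm" where
  "y_part z t = (\<chi> i. z t $ Inr i)"

lemma borel_measurable_vec:
  fixes f :: "'a \<Rightarrow> real ^ 'n"
  assumes "\<And>i. (\<lambda>x. f x $ i) \<in> borel_measurable M"
  shows "f \<in> borel_measurable M"
  unfolding borel_measurable_euclidean_space[of f]
  using assms by (auto simp: Basis_vec_def inner_axis)

lemma measurable_parts:
  "x_part \<in> measurable path_space path_space" "y_part \<in> measurable path_space path_space"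
proof -
  show "x_part \<in> measurable path_space path_space"
  proof (rule measurable_PiM_single')
    show "(\<lambda>z. x_part z t) \<in> borel_measurable path_space" for t
      by (rule borel_measurable_vec) (simp add: x_part_def measurable_coord)
  qed simp
  show "y_part \<in> measurable path_space path_space"
  proof (rule measurable_PiM_single')
    show "(\<lambda>z. y_part z t) \<in> borel_measurable path_space" for t
      by (rule borel_measurable_vec) (simp add: y_part_def measurable_coord)
  qed simp
qed

definition couplings ::
  "nat ^ 'd \<Rightarrow> (int ^ 'd \<Rightarrow> real ^ 'm) measure \<Rightarrow> (int ^ 'd \<Rightarrow> real ^ 'm) measure
    \<Rightarrow> (int ^ 'd \<Rightarrow> real ^ ('m + 'm)) measure set" where
  "couplings N px py = {P. gaussian_periodic_law N P \<and>
     distr P path_space x_part = px \<and> distr P path_space y_part = py}"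

definition cost ::
  "nat ^ 'd \<Rightarrow> (int ^ 'd \<Rightarrow> real ^ 'm ^ 'm) \<Rightarrow> int ^ 'd
    \<Rightarrow> (int ^ 'd \<Rightarrow> real ^ ('m + 'm)) measure \<Rightarrow> real" where
  "cost N h t P = (\<integral>z. (norm (circ_conv N h (\<lambda>s. x_part z s - y_part z s) t))\<^sup>2 \<partial>P)"

text \<open>The site \<open>t\<close> is a parameter only formally: by stationarity the cost does not depend on it.\<close>

definition d_Omega ::
  "nat ^ 'd \<Rightarrow> (int ^ 'd \<Rightarrow> real ^ 'm ^ 'm) \<Rightarrow> int ^ 'd
    \<Rightarrow> (int ^ 'd \<Rightarrow> real ^ 'm) measure \<Rightarrow> (int ^ 'd \<Rightarrow> real ^ 'm) measure \<Rightarrow> real" where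
  "d_Omega N h t px py = sqrt (INF P\<in>couplings N px py. cost N h t P)"

definition weighted_hellinger ::
  "nat ^ 'd \<Rightarrow> (complex ^ 'd \<Rightarrow> complex ^ 'm ^ 'm) \<Rightarrow> (complex ^ 'd \<Rightarrow> complex ^ 'm ^ 'm)
    \<Rightarrow> (complex ^ 'd \<Rightarrow> complex ^ 'm ^ 'm) \<Rightarrow> real" where
  "weighted_hellinger N \<Omega> \<Phi> \<Psi> = sqrt (Re (
     1 / of_nat (\<Prod>i\<in>UNIV. N $ i) *
     trace (\<Sum>l\<in>box_N N. let w = zeta N l; S = sqrt_mat (\<Psi> w) in
       \<Omega> w ** \<Phi> w + \<Omega> w ** \<Psi> w - 2 *\<^sub>R sqrt_mat (S ** \<Omega> w ** \<Phi> w ** \<Omega> w ** S))))"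

end

theory Submission
  imports Defs
begin

text \<open>In the frequency domain the fields decouple: the DFT coefficients of a stationary periodic field
  at frequency \<open>l\<close> have covariance \<open>|N| \<Phi> (\<zeta>\<^sub>l)\<close>, and by Parseval the cost is a sum over
  frequencies of \<open>E [(x - y)\<^sup>* \<Omega> (x - y)]\<close>, so each frequency is a Gaussian transport problem with
  quadratic cost.

  Lower bound: with \<open>S = \<Phi>\<^sub>y\<^sup>1\<^sup>/\<^sup>2\<close>, \<open>T = (S \<Omega> \<Phi>\<^sub>x \<Omega> S)\<^sup>1\<^sup>/\<^sup>2\<close> and an orthonormal eigenbasis \<open>u\<^sub>k\<close> of \<open>T\<close>
  with eigenvalues \<open>\<tau>\<^sub>k\<close>, the inequality of the arithmetic and geometric means gives the pathwise bound
  \<open>2 Re (y\<^sup>* \<Omega> x) \<le> \<Sum>\<^sub>k (|u\<^sub>k\<^sup>* S \<Omega> x|\<^sup>2 / \<tau>\<^sub>k + \<tau>\<^sub>k |u\<^sub>k\<^sup>* S\<^sup>-\<^sup>1 y|\<^sup>2)\<close>, whose expectation depends on the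
  marginals only and equals \<open>2 tr T\<close>.

  Upper bound: if \<open>\<Omega>\<close> is positive definite, the filter \<open>G = S T\<^sup>-\<^sup>1 S \<Omega>\<close> satisfies
  \<open>G \<Phi>\<^sub>x G\<^sup>* = \<Phi>\<^sub>y\<close> and \<open>tr (G\<^sup>* \<Omega> \<Phi>\<^sub>x) = tr T\<close>; it commutes with complex conjugation, hence has a real impulse
  response \<open>g\<close>, and the law of \<open>(x, g * x)\<close> is an optimal coupling. In general \<open>\<Omega>\<close> is replaced by \<open>\<Omega> + \<epsilon> I\<close>
  and \<open>\<epsilon>\<close> tends to zero. That \<open>g * x\<close> has law \<open>p\<^sub>y\<close>, and not merely its covariance, is the
  uniqueness of a Gaussian law with given covariance.\<close>

section \<open>Hermitian matrices\<close>

text \<open>The lower bound is a dual certificate applied path by path, so the cross spectrum of a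
  coupling never has to be computed. The filter of the upper bound is the equality case of that
  certificate: equality in every eigendirection means \<open>T S^-1 y = S Omega x\<close>, that is,
  \<open>y = S T^-1 S Omega x\<close>. If \<open>Omega\<close> is singular then so is
  \<open>T\<close>, and this filter is undefined; hence the perturbation. The limit is taken in the
  values, not in the couplings: the coupling that is optimal for the perturbed weight is charged
  with the original one, the error at each frequency is at most
  \<open>epsilon (tr Phi_x + tr Phi_y)\<close>, and continuity of the matrix square root does the
  rest. The fields are real, so the filter must be real as well; real covariances give conjugate
  spectra at \<open>l\<close> and \<open>-l\<close>, and products, roots and inverses all respect
  this symmetry. Periodic fields are degenerate, so laws are compared through characteristic
  functions of finite linear combinations and not through densities.\<close>

definition cip :: "complex ^ 'n \<Rightarrow> complex ^ 'n \<Rightarrow> complex" where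
  "cip u v = (\<Sum>i\<in>UNIV. cnj (u $ i) * v $ i)"

lemma cip_add_right: "cip u (v + w) = cip u v + cip u w"
  by (simp add: cip_def algebra_simps sum.distrib)

lemma cip_add_left: "cip (u + v) w = cip u w + cip v w"
  by (simp add: cip_def algebra_simps sum.distrib)

lemma cip_diff_right: "cip u (v - w) = cip u v - cip u w"
  by (simp add: cip_def algebra_simps sum_subtractf)

lemma cip_diff_left: "cip (u - v) w = cip u w - cip v w"
  by (simp add: cip_def algebra_simps sum_subtractf)

lemma cip_scale_right: "cip u (c *s v) = c * cip u v"
  by (simp add: cip_def sum_distrib_left mult_ac)

lemma cip_scale_left: "cip (c *s u) v = cnj c * cip u v"
  by (simp add: cip_def sum_distrib_left mult_ac)

lemma cip_sum_right: "cip u (\<Sum>a\<in>S. f a) = (\<Sum>a\<in>S. cip u (f a))"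
  by (induction S rule: infinite_finite_induct) (auto simp: cip_add_right cip_def[of _ 0])

lemma cip_sum_left: "cip (\<Sum>a\<in>S. f a) v = (\<Sum>a\<in>S. cip (f a) v)"
  by (induction S rule: infinite_finite_induct) (auto simp: cip_add_left cip_def[of 0])

lemma cip_zero [simp]: "cip 0 v = 0" "cip v 0 = 0"
  by (auto simp: cip_def)

lemma cnj_cip [simp]: "cnj (cip u v) = cip v u"
  by (simp add: cip_def mult_ac)

lemma Re_cip_commute: "Re (cip u v) = Re (cip v u)"
  by (metis cnj_cip cnj.sel(1))

lemma cip_self: "cip v v = complex_of_real ((norm v)\<^sup>2)"
proof -
  have "(norm v)\<^sup>2 = (\<Sum>i\<in>UNIV. (norm (v $ i))\<^sup>2)"
    by (simp add: norm_vec_def L2_set_def sum_nonneg)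
  then show ?thesis
    by (simp add: cip_def complex_norm_square mult.commute del: of_real_power)
qed

lemma cip_self_eq_0: "cip v v = 0 \<longleftrightarrow> v = 0"
  by (simp add: cip_self)

lemma cip_adjoint: "cip (adjoint_mat A *v u) v = cip u (A *v v)"
proof -
  have "cip (adjoint_mat A *v u) v = (\<Sum>i\<in>UNIV. \<Sum>j\<in>UNIV. A $ j $ i * cnj (u $ j) * v $ i)"
    by (simp add: cip_def matrix_vector_mult_def adjoint_mat_def sum_distrib_right)
  also have "\<dots> = (\<Sum>j\<in>UNIV. \<Sum>i\<in>UNIV. A $ j $ i * cnj (u $ j) * v $ i)"
    by (rule sum.swap)
  also have "\<dots> = cip u (A *v v)"
    by (simp add: cip_def matrix_vector_mult_def sum_distrib_left mult_ac)
  finally show ?thesis .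
qed

lemma quad_form_cip: "quad_form A v = cip v (A *v v)"
  by (simp add: quad_form_def cip_def)

lemma matvec_scale: "(A :: complex ^ 'n ^ 'm) *v (c *s v) = c *s (A *v v)"
  by (simp add: vector_scalar_commute)

lemma matvec_sum: "(A :: complex ^ 'n ^ 'm) *v (\<Sum>a\<in>S. f a) = (\<Sum>a\<in>S. A *v f a)"
  by (induction S rule: infinite_finite_induct) (auto simp: matrix_vector_right_distrib)

lemma continuous_on_cip [continuous_intros]:
  "continuous_on S f \<Longrightarrow> continuous_on S g \<Longrightarrow> continuous_on S (\<lambda>x. cip (f x) (g x))"
  unfolding cip_def by (intro continuous_intros)

lemma hermitian_cip:
  assumes "adjoint_mat A = A"
  shows "cip (A *v u) v = cip u (A *v v)"
  using cip_adjoint[of A u v] assms by simp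

text \<open>An eigenvector is found where the form is maximal on the unit sphere of an invariant subspace.\<close>

lemma hermitian_eigenvector_orthogonal:
  fixes A :: "complex ^ 'n ^ 'n"
  assumes A: "adjoint_mat A = A"
    and eig: "\<And>e. e \<in> E \<Longrightarrow> A *v e = of_real (lam e) *s e"
    and x: "\<And>e. e \<in> E \<Longrightarrow> cip e x = 0" "x \<noteq> 0"
  obtains u r where "cip u u = 1" "A *v u = of_real r *s u" "\<And>e. e \<in> E \<Longrightarrow> cip e u = 0"
proof -
  define V where "V = {v. \<forall>e\<in>E. cip e v = 0}"
  define K where "K = V \<inter> sphere 0 1"
  define f where "f v = Re (quad_form A v)" for v
  have V_eq: "V = (\<Inter>e\<in>E. {v. cip e v = 0})" by (auto simp: V_def)
  have "closed V"
    unfolding V_eq by (intro closed_INT ballI closed_Collect_eq continuous_intros)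
  then have "compact K"
    unfolding K_def by (intro closed_Int_compact) auto
  moreover have "(1 / norm x) *\<^sub>R x \<in> K"
  proof -
    have "(1 / norm x) *\<^sub>R x = of_real (1 / norm x) *s x"
      by (simp add: vec_eq_iff) (simp add: scaleR_conv_of_real)
    then have "cip e ((1 / norm x) *\<^sub>R x) = 0" if "e \<in> E" for e
      using x that by (simp add: cip_scale_right)
    moreover have "norm ((1 / norm x) *\<^sub>R x) = 1"
      using x by simp
    ultimately show ?thesis
      unfolding K_def V_def by simp
  qed
  moreover have "continuous_on K f"
    unfolding f_def quad_form_def matrix_vector_mult_def vec_lambda_beta
    by (intro continuous_intros)
  ultimately obtain u where u: "u \<in> K" "\<And>v. v \<in> K \<Longrightarrow> f v \<le> f u"
    using continuous_attains_sup[of K f] by (metis empty_iff)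
  define r where "r = f u"
  have uu: "cip u u = 1" using u(1) by (simp add: K_def cip_self)
  have Vu: "u \<in> V" using u by (simp add: K_def)
  have bound: "f v \<le> r * Re (cip v v)" if "v \<in> V" for v
  proof (cases "v = 0")
    case True
    then show ?thesis by (simp add: f_def quad_form_cip)
  next
    case False
    define c where "c = 1 / norm v"
    have "of_real c *s v \<in> K"
    proof -
      have "norm (of_real c *s v) = 1"
      proof -
        have "cip (of_real c *s v) (of_real c *s v) = 1"
        proof -
          have "cip (of_real c *s v) (of_real c *s v) = of_real (c\<^sup>2 * (norm v)\<^sup>2)"
            by (simp only: cip_scale_left cip_scale_right cip_self[of v]) (simp add: power2_eq_square)
          then show ?thesis using False by (simp add: c_def power_divide)
        qed
        then have "(norm (of_real c *s v))\<^sup>2 = 1"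
          by (metis cip_self of_real_eq_1_iff)
        then show ?thesis by (simp add: power2_eq_1_iff) (metis norm_ge_zero not_one_le_zero neg_0_le_iff_le)
      qed
      with that show ?thesis by (auto simp: K_def V_def cip_scale_right)
    qed
    from u(2)[OF this] have "c\<^sup>2 * f v \<le> r"
      by (simp add: r_def f_def quad_form_cip matvec_scale cip_scale_left cip_scale_right power2_eq_square mult.assoc)
    moreover have "c\<^sup>2 * (norm v)\<^sup>2 = 1" using False by (simp add: c_def power_divide)
    ultimately have "(norm v)\<^sup>2 * (c\<^sup>2 * f v) \<le> (norm v)\<^sup>2 * r"
      by (intro mult_left_mono) auto
    then have "f v \<le> r * (norm v)\<^sup>2"
      using \<open>c\<^sup>2 * (norm v)\<^sup>2 = 1\<close> by (metis mult.assoc mult.commute mult.left_neutral)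
    then show ?thesis by (simp add: cip_self)
  qed
  \<comment> \<open>The defect of the eigenvalue equation. Since \<open>E\<close> consists of
    eigenvectors, \<open>A\<close> maps \<open>V\<close> to itself, so \<open>w\<close> is an
    admissible direction in which to vary \<open>u\<close>.\<close>
  define w where "w = A *v u - of_real r *s u"
  have "w \<in> V"
  proof -
    have "cip e (A *v u) = 0" if "e \<in> E" for e
      using that Vu hermitian_cip[OF A, of e u] eig[OF that] by (simp add: V_def cip_scale_left)
    then show ?thesis
      using Vu by (auto simp: w_def V_def cip_diff_right cip_scale_right)
  qed
  define C where "C = r * (norm w)\<^sup>2 - f w"
  \<comment> \<open>Maximality of \<open>u\<close> along the line \<open>u + t w\<close>: the
    constants cancel, the linear coefficient is \<open>2 |w|^2\<close> by \<open>e3\<close>, and the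
    quadratic terms are collected in \<open>C\<close>. A small \<open>t\<close> then forces
    \<open>w = 0\<close>.\<close>
  have ineq: "2 * t * (norm w)\<^sup>2 \<le> t\<^sup>2 * C" for t :: real
  proof -
    have "u + of_real t *s w \<in> V"
      using Vu \<open>w \<in> V\<close> by (auto simp: V_def cip_add_right cip_scale_right)
    note b = bound[OF this]
    have e1: "f (u + of_real t *s w) = r + 2 * t * Re (cip w (A *v u)) + t\<^sup>2 * f w"
    proof -
      have "Re (cip u (A *v w)) = Re (cip w (A *v u))"
        using hermitian_cip[OF A, of u w] by (metis Re_cip_commute)
      then show ?thesis
        by (simp add: f_def r_def quad_form_cip matrix_vector_right_distrib matvec_scale cip_add_left
            cip_add_right cip_scale_left cip_scale_right power2_eq_square algebra_simps)
    qed
    have e2: "Re (cip (u + of_real t *s w) (u + of_real t *s w))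
        = 1 + 2 * t * Re (cip w u) + t\<^sup>2 * (norm w)\<^sup>2"
    proof -
      show ?thesis
        using Re_cip_commute[of u w] by (simp add: cip_add_left uu cip_self[of w]
            cip_add_right cip_scale_left cip_scale_right power2_eq_square algebra_simps)
    qed
    have e3: "(norm w)\<^sup>2 = Re (cip w (A *v u)) - r * Re (cip w u)"
    proof -
      have "cip w w = cip w (A *v u) - of_real r * cip w u"
      proof -
        have "cip w w = cip w (A *v u - of_real r *s u)" by (simp only: w_def)
        then show ?thesis by (simp only: cip_diff_right cip_scale_right)
      qed
      then have "Re (cip w w) = Re (cip w (A *v u)) - r * Re (cip w u)" by simp
      then show ?thesis by (simp add: cip_self)
    qed
    have "2 * t * (Re (cip w (A *v u)) - r * Re (cip w u)) \<le> t\<^sup>2 * C"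
      using b unfolding e1 e2 C_def by (simp add: algebra_simps)
    then show ?thesis using e3 by simp
  qed
  have "w = 0"
  proof (rule ccontr)
    assume "w \<noteq> 0"
    define t where "t = 1 / (\<bar>C\<bar> + 1)"
    have t: "t > 0" "t * C \<le> 1" by (auto simp: t_def divide_simps)
    have "t * (2 * (norm w)\<^sup>2) \<le> t * (t * C)" using ineq[of t] by (simp add: power2_eq_square algebra_simps)
    with t(1) have i: "2 * (norm w)\<^sup>2 \<le> t * C" by simp
    \<comment> \<open>The factor \<open>|w|^2\<close> makes \<open>s * C\<close> at most
      \<open>|w|^2\<close>, half of what \<open>ineq\<close> at \<open>s\<close> demands.\<close>
    define s where "s = (norm w)\<^sup>2 * t"
    have "s > 0" using t \<open>w \<noteq> 0\<close> by (simp add: s_def)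
    have "s * (2 * (norm w)\<^sup>2) \<le> s * (s * C)" using ineq[of s] by (simp add: power2_eq_square algebra_simps)
    with \<open>s > 0\<close> have "2 * (norm w)\<^sup>2 \<le> s * C" by simp
    also have "\<dots> = (norm w)\<^sup>2 * (t * C)" by (simp add: s_def)
    also have "\<dots> \<le> (norm w)\<^sup>2 * 1" using t by (intro mult_left_mono) auto
    finally show False using \<open>w \<noteq> 0\<close> by simp
  qed
  then have "A *v u = of_real r *s u" by (simp add: w_def)
  with uu Vu show thesis by (intro that[of u r]) (auto simp: V_def)
qed

section \<open>Orthonormal eigenbases of Hermitian matrices\<close>

definition orthonormal :: "(complex ^ 'n) set \<Rightarrow> bool" where
  "orthonormal E \<longleftrightarrow> finite E \<and> (\<forall>e\<in>E. \<forall>f\<in>E. cip e f = (if e = f then 1 else 0))"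

text \<open>Completeness is encoded as the expansion formula. The basis is a set of vectors, so
  eigenvalues become a function on vectors and not a family over an index type.\<close>

definition orthonormal_basis :: "(complex ^ 'n) set \<Rightarrow> bool" where
  "orthonormal_basis E \<longleftrightarrow> orthonormal E \<and> (\<forall>v. (\<Sum>e\<in>E. cip e v *s e) = v)"

lemma orthonormal_expansion: "orthonormal_basis E \<Longrightarrow> v = (\<Sum>e\<in>E. cip e v *s e)"
  by (simp add: orthonormal_basis_def)

text \<open>With \<open>p\<close> the projection of \<open>v\<close> on the span,
  \<open>cip p v = cip p p\<close>, so the squared norm of \<open>v - p\<close> is the difference of
  the two sides.\<close>

lemma orthonormal_Bessel:
  assumes "orthonormal E"
  shows "(\<Sum>e\<in>E. (norm (cip e v))\<^sup>2) \<le> (norm v)\<^sup>2"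
proof -
  define p where "p = (\<Sum>e\<in>E. cip e v *s e)"
  have fin: "finite E" using assms by (simp add: orthonormal_def)
  have pe: "cip e p = cip e v" if "e \<in> E" for e
  proof -
    have "cip e p = (\<Sum>f\<in>E. if e = f then cip f v else 0)"
      unfolding p_def cip_sum_right
      using assms that by (intro sum.cong) (auto simp: cip_scale_right orthonormal_def)
    then show ?thesis using fin that by simp
  qed
  have pp: "cip p p = (\<Sum>e\<in>E. of_real ((norm (cip e v))\<^sup>2))"
  proof -
    have "cip p p = (\<Sum>e\<in>E. cnj (cip e v) * cip e p)"
      by (subst (1) p_def) (simp add: cip_sum_left cip_scale_left)
    also have "\<dots> = (\<Sum>e\<in>E. of_real ((norm (cip e v))\<^sup>2))"
      by (intro sum.cong refl, subst pe) (auto simp: complex_norm_square mult.commute simp del: cnj_cip of_real_power)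
    finally show ?thesis .
  qed
  have pv: "cip p v = cip p p"
  proof -
    have "cip p v = (\<Sum>e\<in>E. cnj (cip e v) * cip e v)"
      by (subst (1) p_def) (simp add: cip_sum_left cip_scale_left)
    also have "\<dots> = cip p p"
      unfolding pp by (intro sum.cong) (auto simp: complex_norm_square mult.commute simp del: cnj_cip of_real_power)
    finally show ?thesis .
  qed
  have vp: "cip v p = cip p p" using pv by (metis cnj_cip)
  have "0 \<le> Re (cip (v - p) (v - p))" by (simp add: cip_self)
  also have "cip (v - p) (v - p) = cip v v - cip p p"
    by (simp add: cip_diff_left cip_diff_right pv vp)
  finally have "Re (cip p p) \<le> Re (cip v v)" by simp
  then show ?thesis unfolding pp by (simp add: cip_self)
qed

text \<open>Sum \<open>|e_i|^2\<close> over all vectors \<open>e\<close> and coordinates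
  \<open>i\<close>: each vector contributes 1, and each coordinate at most 1 by Bessel at the
  coordinate vector. The bound is what lets a largest orthonormal set exist.\<close>

lemma orthonormal_card_le:
  fixes E :: "(complex ^ 'n) set"
  assumes "orthonormal E"
  shows "card E \<le> CARD('n)"
proof -
  have 1: "(\<Sum>e\<in>E. \<Sum>i\<in>UNIV. (norm (e $ i))\<^sup>2) = card E"
  proof -
    have "(\<Sum>i\<in>UNIV. (norm (e $ i))\<^sup>2) = 1" if "e \<in> E" for e
    proof -
      have "cip e e = 1" using assms that by (simp add: orthonormal_def)
      then have "(norm e)\<^sup>2 = 1" by (metis cip_self of_real_eq_1_iff)
      then show ?thesis by (simp add: norm_vec_def L2_set_def sum_nonneg)
    qed
    then show ?thesis by simp
  qed
  have "real (card E) = (\<Sum>i\<in>UNIV. \<Sum>e\<in>E. (norm (e $ i))\<^sup>2)"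
    using 1 by (subst sum.swap) simp
  also have "\<dots> \<le> (\<Sum>i\<in>(UNIV::'n set). 1)"
  proof (rule sum_mono)
    fix i :: 'n
    have "cip e (axis i 1) = cnj (e $ i)" for e :: "complex ^ 'n"
      by (simp add: cip_def axis_def if_distrib[where f="\<lambda>x. _ * x"] cong: if_cong)
    then show "(\<Sum>e\<in>E. (norm (e $ i))\<^sup>2) \<le> 1"
      using orthonormal_Bessel[OF assms, of "axis i 1"] by simp
  qed
  finally show ?thesis by simp
qed

text \<open>An orthonormal set of eigenvectors of largest size is complete: a nonzero remainder in
  the expansion of some \<open>v\<close> is orthogonal to the set and yields one more
  eigenvector.\<close>

lemma hermitian_eigenbasis:
  fixes A :: "complex ^ 'n ^ 'n"
  assumes A: "adjoint_mat A = A"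
  obtains E lam where "orthonormal_basis E" "\<And>e. e \<in> E \<Longrightarrow> A *v e = of_real (lam e) *s e"
proof -
  define P where "P E \<longleftrightarrow> orthonormal E \<and> (\<forall>e\<in>E. \<exists>r::real. A *v e = of_real r *s e)" for E
  have "\<exists>E. P E \<and> (\<forall>F. P F \<longrightarrow> card F \<le> card E)"
  proof (rule ex_has_greatest_nat)
    show "P {}" by (simp add: P_def orthonormal_def)
    show "\<forall>E. P E \<longrightarrow> card E < Suc CARD('n)" by (auto simp: P_def less_Suc_eq_le orthonormal_card_le)
  qed
  then obtain E where E: "P E" "\<And>F. P F \<Longrightarrow> card F \<le> card E"
    by auto
  have on: "orthonormal E" and fin: "finite E" using E(1) by (auto simp: P_def orthonormal_def)
  from E(1) obtain lam where lam: "\<And>e. e \<in> E \<Longrightarrow> A *v e = of_real (lam e) *s e"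
    unfolding P_def by metis
  have "v = (\<Sum>e\<in>E. cip e v *s e)" for v
  proof (rule ccontr)
    define x where "x = v - (\<Sum>e\<in>E. cip e v *s e)"
    assume "v \<noteq> (\<Sum>e\<in>E. cip e v *s e)"
    then have "x \<noteq> 0" by (simp add: x_def)
    have xe: "cip e x = 0" if "e \<in> E" for e
    proof -
      have "(\<Sum>f\<in>E. cip f v * cip e f) = (\<Sum>f\<in>E. if e = f then cip f v else 0)"
        using on that by (intro sum.cong) (auto simp: orthonormal_def)
      then show ?thesis using fin that by (simp add: x_def cip_diff_right cip_sum_right cip_scale_right)
    qed
    obtain u r where u: "cip u u = 1" "A *v u = of_real r *s u" "\<And>e. e \<in> E \<Longrightarrow> cip e u = 0"
      using hermitian_eigenvector_orthogonal[OF A lam xe \<open>x \<noteq> 0\<close>] by metis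
    have u': "cip u e = 0" if "e \<in> E" for e using u(3)[OF that] by (metis cnj_cip complex_cnj_zero)
    have "u \<notin> E" using u by force
    have "P (insert u E)"
      using E(1) u u' unfolding P_def orthonormal_def by auto
    from E(2)[OF this] show False using \<open>u \<notin> E\<close> fin by simp
  qed
  with on have "orthonormal_basis E" by (simp add: orthonormal_basis_def)
  from this lam show thesis by (rule that)
qed

lemma matrix_eq_on_basis:
  assumes "orthonormal_basis E" "\<And>e. e \<in> E \<Longrightarrow> A *v e = B *v e"
  shows "A = (B :: complex ^ 'n ^ 'm)"
proof -
  have "A *v v = B *v v" for v
  proof -
    have "A *v (\<Sum>e\<in>E. cip e v *s e) = B *v (\<Sum>e\<in>E. cip e v *s e)"
      using assms(2) by (simp add: matvec_sum matvec_scale)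
    then show ?thesis using assms(1) by (simp add: orthonormal_basis_def)
  qed
  then show ?thesis by (simp add: matrix_eq)
qed

text \<open>Expanding the coordinate vectors in \<open>E\<close> says that the projections on the
  members of \<open>E\<close> add up to the identity; this is \<open>d\<close>.\<close>

lemma trace_basis:
  fixes A :: "complex ^ 'n ^ 'n"
  assumes "orthonormal_basis E"
  shows "trace A = (\<Sum>e\<in>E. cip e (A *v e))"
proof -
  have d: "(\<Sum>e\<in>E. e $ j * cnj (e $ i)) = (if j = i then 1 else 0)" for i j
  proof -
    have "cip e (axis i 1) = cnj (e $ i)" for e :: "complex ^ 'n"
      by (simp add: cip_def axis_def if_distrib[where f="\<lambda>x. _ * x"] cong: if_cong)
    then have "(axis i 1 :: complex ^ 'n) $ j = (\<Sum>e\<in>E. e $ j * cnj (e $ i))"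
      by (subst orthonormal_expansion[OF assms, of "axis i 1"]) (simp add: mult_ac)
    then show ?thesis by (simp add: axis_def)
  qed
  have "(\<Sum>e\<in>E. cip e (A *v e)) = (\<Sum>e\<in>E. \<Sum>i\<in>UNIV. \<Sum>j\<in>UNIV. A $ i $ j * (e $ j * cnj (e $ i)))"
    by (simp add: cip_def matrix_vector_mult_def sum_distrib_left mult_ac)
  also have "\<dots> = (\<Sum>i\<in>UNIV. \<Sum>e\<in>E. \<Sum>j\<in>UNIV. A $ i $ j * (e $ j * cnj (e $ i)))"
    by (rule sum.swap)
  also have "\<dots> = (\<Sum>i\<in>UNIV. \<Sum>j\<in>UNIV. \<Sum>e\<in>E. A $ i $ j * (e $ j * cnj (e $ i)))"
    by (intro sum.cong refl sum.swap)
  also have "\<dots> = trace A"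
    by (simp add: sum_distrib_left[symmetric] d trace_def if_distrib[where f="\<lambda>x. _ * x"] cong: if_cong)
  finally show ?thesis by simp
qed

section \<open>Adjoint, trace and positive semidefiniteness\<close>

lemma adjoint_adjoint [simp]: "adjoint_mat (adjoint_mat A) = A"
  by (simp add: adjoint_mat_def vec_eq_iff)

lemma adjoint_mult: "adjoint_mat (A ** B) = adjoint_mat B ** adjoint_mat A"
  by (simp add: adjoint_mat_def matrix_matrix_mult_def vec_eq_iff mult.commute)

lemma adjoint_add: "adjoint_mat (A + B) = adjoint_mat A + adjoint_mat B"
  by (simp add: adjoint_mat_def vec_eq_iff)

lemma adjoint_diff: "adjoint_mat (A - B) = adjoint_mat A - adjoint_mat B"
  by (simp add: adjoint_mat_def vec_eq_iff)

lemma adjoint_scaleR: "adjoint_mat (r *\<^sub>R A) = r *\<^sub>R adjoint_mat A"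
  by (simp add: adjoint_mat_def vec_eq_iff)

lemma adjoint_one [simp]: "adjoint_mat (mat 1) = mat 1"
  by (simp add: adjoint_mat_def mat_def vec_eq_iff)

lemma trace_adjoint: "trace (adjoint_mat A) = cnj (trace A)"
  by (simp add: adjoint_mat_def trace_def)

lemma trace_scaleR: "trace (r *\<^sub>R A) = r *\<^sub>R trace (A :: complex ^ 'n ^ 'n)"
  by (simp add: trace_def scaleR_sum_right)

lemma trace_mult_commute: "trace (A ** B) = trace (B ** (A :: complex ^ 'n ^ 'm))"
  unfolding trace_def matrix_matrix_mult_def
  by (simp add: mult.commute) (rule sum.swap)

text \<open>The norm of a vector of vectors is the Frobenius norm. This turns trace bounds into norm
  bounds and trace identities into equality of matrices.\<close>

lemma norm_matrix_sq: "(norm (A :: complex ^ 'n ^ 'm))\<^sup>2 = Re (trace (adjoint_mat A ** A))"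
proof -
  have "(norm A)\<^sup>2 = (\<Sum>i\<in>UNIV. \<Sum>j\<in>UNIV. (norm (A $ i $ j))\<^sup>2)"
    by (simp add: norm_vec_def L2_set_def sum_nonneg)
  also have "\<dots> = (\<Sum>j\<in>UNIV. \<Sum>i\<in>UNIV. (norm (A $ i $ j))\<^sup>2)"
    by (rule sum.swap)
  also have "\<dots> = Re (trace (adjoint_mat A ** A))"
    by (simp add: trace_def matrix_matrix_mult_def adjoint_mat_def cmod_power2) (simp add: power2_eq_square)
  finally show ?thesis .
qed

lemma cip_adjoint': "cip (A *v u) v = cip u (adjoint_mat A *v v)"
  using cip_adjoint[of "adjoint_mat A" u v] by simp

lemma psd_hermitian: "psd_mat A \<Longrightarrow> adjoint_mat A = A"
  by (simp add: psd_mat_def)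

lemma psd_nonneg: "psd_mat A \<Longrightarrow> 0 \<le> Re (quad_form A v)"
  by (simp add: psd_mat_def)

lemma pd_imp_psd: "pd_mat A \<Longrightarrow> psd_mat A"
  unfolding pd_mat_def psd_mat_def by (metis cip_zero(1) order_refl less_imp_le quad_form_cip zero_complex.sel(1))

lemma quad_form_congruence: "quad_form (C ** A ** adjoint_mat C) v = quad_form A (adjoint_mat C *v v)"
  by (simp add: quad_form_cip matrix_vector_mul_assoc[symmetric] cip_adjoint)

lemma psd_congruence: "psd_mat A \<Longrightarrow> psd_mat (C ** A ** adjoint_mat C)"
  by (simp add: psd_mat_def quad_form_congruence adjoint_mult matrix_mul_assoc)

lemma psd_gram: "psd_mat (adjoint_mat C ** C)"
  by (simp add: psd_mat_def quad_form_cip matrix_vector_mul_assoc[symmetric] adjoint_mult cip_adjoint'[symmetric] cip_self)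

section \<open>The positive semidefinite square root\<close>

lemma psd_sqrt_exists:
  fixes A :: "complex ^ 'n ^ 'n"
  assumes "psd_mat A"
  shows "\<exists>B. psd_mat B \<and> B ** B = A"
proof -
  obtain E lam where E: "orthonormal_basis E" and lam: "\<And>e. e \<in> E \<Longrightarrow> A *v e = of_real (lam e) *s e"
    by (rule hermitian_eigenbasis[OF psd_hermitian[OF assms]]) blast
  have on: "orthonormal E" using E by (simp add: orthonormal_basis_def)
  have lam0: "lam e \<ge> 0" if "e \<in> E" for e
    using psd_nonneg[OF assms, of e] lam[OF that] on that
    by (simp add: quad_form_cip cip_scale_right orthonormal_def)
  \<comment> \<open>The spectral formula with the roots of the eigenvalues; by \<open>lam0\<close>
    these roots square back to \<open>lam e\<close>.\<close>
  define B :: "complex ^ 'n ^ 'n" where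
    "B = (\<chi> i j. \<Sum>e\<in>E. of_real (sqrt (lam e)) * e $ i * cnj (e $ j))"
  have Bv: "B *v v = (\<Sum>e\<in>E. (of_real (sqrt (lam e)) * cip e v) *s e)" for v
  proof -
    have "(B *v v) $ i = (\<Sum>j\<in>UNIV. \<Sum>e\<in>E. of_real (sqrt (lam e)) * e $ i * cnj (e $ j) * v $ j)" for i
      by (simp add: B_def matrix_vector_mult_def sum_distrib_right)
    also have "\<dots> i = (\<Sum>e\<in>E. \<Sum>j\<in>UNIV. of_real (sqrt (lam e)) * e $ i * cnj (e $ j) * v $ j)" for i
      by (rule sum.swap)
    finally show ?thesis
      by (simp add: vec_eq_iff cip_def sum_distrib_left sum_distrib_right mult_ac)
  qed
  have "adjoint_mat B = B"
    by (simp add: adjoint_mat_def B_def vec_eq_iff mult_ac)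
  moreover have "0 \<le> Re (quad_form B v)" for v
  proof -
    have "quad_form B v = (\<Sum>e\<in>E. of_real (sqrt (lam e)) * (cip e v * cnj (cip e v)))"
      by (simp add: quad_form_cip Bv cip_sum_right cip_scale_right mult_ac)
    also have "\<dots> = of_real (\<Sum>e\<in>E. sqrt (lam e) * (norm (cip e v))\<^sup>2)"
      by (simp only: complex_norm_square[symmetric] of_real_mult of_real_sum)
    finally show ?thesis using lam0 by (simp add: sum_nonneg)
  qed
  moreover have "B ** B = A"
  proof (rule matrix_eq_on_basis[OF E])
    fix e assume e: "e \<in> E"
    have "B *v e = (\<Sum>f\<in>E. if e = f then of_real (sqrt (lam e)) *s e else 0)"
      unfolding Bv using on e by (intro sum.cong) (auto simp: orthonormal_def)
    then have "B *v e = of_real (sqrt (lam e)) *s e"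
      using on e by (simp add: orthonormal_def)
    then show "B ** B *v e = A *v e"
      using lam0[OF e] lam[OF e]
      by (simp add: matrix_vector_mul_assoc[symmetric] matvec_scale vector_smult_assoc of_real_mult[symmetric] del: of_real_mult)
  qed
  ultimately show ?thesis by (auto simp: psd_mat_def)
qed

text \<open>On an eigenvector \<open>e\<close> of \<open>B\<close> with eigenvalue
  \<open>lam e\<close>, the vector \<open>w = (C - lam e) e\<close> satisfies
  \<open>(C + lam e) w = 0\<close>. Pairing with \<open>w\<close> gives a sum of two nonnegative
  terms equal to zero, so \<open>w = 0\<close> if \<open>lam e > 0\<close>; for
  \<open>lam e = 0\<close> the equation says \<open>C (C e) = 0\<close>, and \<open>C\<close> is
  Hermitian.\<close>

lemma psd_sqrt_unique:
  fixes B C :: "complex ^ 'n ^ 'n"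
  assumes B: "psd_mat B" and C: "psd_mat C" and eq: "B ** B = C ** C"
  shows "B = C"
proof -
  obtain E lam where E: "orthonormal_basis E" and lam: "\<And>e. e \<in> E \<Longrightarrow> B *v e = of_real (lam e) *s e"
    by (rule hermitian_eigenbasis[OF psd_hermitian[OF B]]) blast
  have on: "orthonormal E" using E by (simp add: orthonormal_basis_def)
  show ?thesis
  proof (rule matrix_eq_on_basis[OF E])
    fix e assume e: "e \<in> E"
    have lam0: "lam e \<ge> 0"
      using psd_nonneg[OF B, of e] lam[OF e] on e
      by (simp add: quad_form_cip cip_scale_right orthonormal_def)
    have CC: "C *v (C *v e) = of_real ((lam e)\<^sup>2) *s e"
    proof -
      have "C *v (C *v e) = B *v (B *v e)" by (simp add: matrix_vector_mul_assoc eq)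
      then show ?thesis by (simp add: lam[OF e] matvec_scale vector_smult_assoc power2_eq_square)
    qed
    define w where "w = C *v e - of_real (lam e) *s e"
    have "C *v w + of_real (lam e) *s w = 0"
      by (simp add: w_def CC matrix_vector_mult_diff_distrib matvec_scale vector_smult_assoc
          vector_sub_rdistrib vec_eq_iff algebra_simps power2_eq_square)
    then have "cip w (C *v w) + of_real (lam e) * cip w w = 0"
      by (metis cip_add_right cip_scale_right cip_zero(2))
    then have sum0: "Re (quad_form C w) + lam e * (norm w)\<^sup>2 = 0"
      by (simp add: quad_form_cip cip_self complex_eq_iff)
    have "w = 0"
    proof (cases "lam e = 0")
      case True
      have "cip (C *v e) (C *v e) = cip e (C *v (C *v e))"
        by (simp add: hermitian_cip[OF psd_hermitian[OF C]])
      also have "\<dots> = 0" by (simp add: CC True cip_scale_right)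
      finally show ?thesis by (simp add: cip_self_eq_0 w_def True)
    next
      case False
      with lam0 psd_nonneg[OF C, of w] sum0 show ?thesis
        by (metis add_nonneg_eq_0_iff mult_eq_0_iff mult_nonneg_nonneg norm_eq_zero zero_eq_power2 zero_le_power2)
    qed
    then show "B *v e = C *v e" by (simp add: w_def lam[OF e])
  qed
qed

lemma
  assumes "psd_mat A"
  shows psd_sqrt_mat: "psd_mat (sqrt_mat A)" and sqrt_mat_square: "sqrt_mat A ** sqrt_mat A = A"
proof -
  have "\<exists>!B. psd_mat B \<and> B ** B = A"
    using psd_sqrt_exists[OF assms] by (auto intro: psd_sqrt_unique)
  from theI'[OF this] show "psd_mat (sqrt_mat A)" "sqrt_mat A ** sqrt_mat A = A"
    by (auto simp: sqrt_mat_def)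
qed

lemma sqrt_mat_unique: "psd_mat B \<Longrightarrow> B ** B = A \<Longrightarrow> sqrt_mat A = B"
  unfolding sqrt_mat_def by (intro the_equality) (auto intro: psd_sqrt_unique)

section \<open>Continuity of the square root\<close>

lemma continuous_on_matrix_mult [continuous_intros]:
  fixes f g :: "'a::topological_space \<Rightarrow> complex ^ 'n ^ 'n"
  assumes "continuous_on S f" "continuous_on S g"
  shows "continuous_on S (\<lambda>x. f x ** g x)"
  unfolding matrix_matrix_mult_def using assms by (intro continuous_intros)

lemma tendsto_matrix_mult [tendsto_intros]:
  fixes f g :: "'a \<Rightarrow> complex ^ 'n ^ 'n"
  assumes "(f \<longlongrightarrow> A) F" "(g \<longlongrightarrow> B) F"
  shows "((\<lambda>x. f x ** g x) \<longlongrightarrow> A ** B) F"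
  unfolding matrix_matrix_mult_def using assms by (intro tendsto_intros)

lemma closed_psd: "closed {A :: complex ^ 'n ^ 'n. psd_mat A}"
proof -
  have "{A :: complex ^ 'n ^ 'n. psd_mat A} =
      {A. adjoint_mat A = A} \<inter> (\<Inter>v. {A. 0 \<le> Re (quad_form A v)})"
    by (auto simp: psd_mat_def)
  moreover have "closed {A :: complex ^ 'n ^ 'n. adjoint_mat A = A}"
    unfolding adjoint_mat_def by (intro closed_Collect_eq continuous_intros)
  moreover have "closed {A. 0 \<le> Re (quad_form A v)}" for v :: "complex ^ 'n"
    unfolding quad_form_def matrix_vector_mult_def vec_lambda_beta
    by (intro closed_Collect_le continuous_intros)
  ultimately show ?thesis by (simp add: closed_Int closed_INT)
qed

text \<open>Squaring is a continuous injection on a compact set of positive semidefinite matrices, so its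
  inverse is continuous.\<close>

lemma tendsto_sqrt_mat:
  fixes A :: "nat \<Rightarrow> complex ^ 'n ^ 'n"
  assumes A: "\<And>k. psd_mat (A k)" and lim: "A \<longlonglongrightarrow> L"
  shows "(\<lambda>k. sqrt_mat (A k)) \<longlonglongrightarrow> sqrt_mat L"
proof -
  have L: "psd_mat L"
    using closed_sequentially[OF closed_psd, of A L] A lim by simp
  have norm_sqrt: "(norm (sqrt_mat M))\<^sup>2 = Re (trace M)" if "psd_mat M" for M :: "complex ^ 'n ^ 'n"
    by (simp add: norm_matrix_sq psd_hermitian[OF psd_sqrt_mat] sqrt_mat_square that)
  have "(\<lambda>k. Re (trace (A k))) \<longlonglongrightarrow> Re (trace L)"
    unfolding trace_def using lim by (intro tendsto_intros)
  then have "Bseq (\<lambda>k. Re (trace (A k)))"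
    by (intro convergent_imp_Bseq) (auto simp: convergent_def)
  then obtain R0 where R0: "\<And>k. \<bar>Re (trace (A k))\<bar> \<le> R0" "R0 > 0"
    by (auto simp: Bseq_def)
  \<comment> \<open>\<open>R\<close> dominates all the traces, which are the squared norms of the
    roots. The summand 1 gives \<open>R \<le> R^2\<close>, so the same \<open>R\<close> bounds the
    norms themselves.\<close>
  define R where "R = R0 + \<bar>Re (trace L)\<bar> + 1"
  define K where "K = {B :: complex ^ 'n ^ 'n. psd_mat B} \<inter> cball 0 R"
  have inK: "sqrt_mat M \<in> K" if "psd_mat M" "Re (trace M) \<le> R" for M
  proof -
    have "(norm (sqrt_mat M))\<^sup>2 \<le> R" using norm_sqrt that by simp
    also have "R \<le> R\<^sup>2"
      using R0 power_increasing[of 1 2 R] by (simp add: R_def)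
    finally have "norm (sqrt_mat M) \<le> R"
      by (rule power2_le_imp_le) (use R0 in \<open>simp add: R_def\<close>)
    with that show ?thesis by (simp add: K_def psd_sqrt_mat)
  qed
  have "compact K" unfolding K_def by (intro closed_Int_compact closed_psd) auto
  moreover have "\<forall>B\<in>K. sqrt_mat (B ** B) = B" by (auto simp: K_def intro: sqrt_mat_unique)
  moreover have "continuous_on K (\<lambda>B. B ** B)"
    by (intro continuous_on_matrix_mult continuous_on_id)
  ultimately have cont: "continuous_on ((\<lambda>B. B ** B) ` K) sqrt_mat"
    using continuous_on_inv by blast
  have img: "M \<in> (\<lambda>B. B ** B) ` K" if "psd_mat M" "Re (trace M) \<le> R" for M
    using inK[OF that] sqrt_mat_square[OF that(1)] by (intro image_eqI[of _ _ "sqrt_mat M"]) auto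
  show ?thesis
  proof (rule continuous_on_tendsto_compose[OF cont lim])
    show "L \<in> (\<lambda>B. B ** B) ` K" using L R0 by (intro img) (auto simp: R_def)
    have "Re (trace (A k)) \<le> R" for k using R0(1)[of k] R0(2) by (simp add: R_def)
    then show "\<forall>\<^sub>F k in sequentially. A k \<in> (\<lambda>B. B ** B) ` K"
      using A by (intro always_eventually allI img) auto
  qed
qed

section \<open>Entrywise conjugation and inverses\<close>

definition cnj_mat :: "complex ^ 'n ^ 'm \<Rightarrow> complex ^ 'n ^ 'm" where
  "cnj_mat A = (\<chi> i j. cnj (A $ i $ j))"

lemma cnj_mat_mult: "cnj_mat (A ** B) = cnj_mat A ** cnj_mat B"
  by (simp add: cnj_mat_def matrix_matrix_mult_def vec_eq_iff)

lemma psd_cnj_mat: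
  assumes "psd_mat A"
  shows "psd_mat (cnj_mat A)"
proof -
  have "adjoint_mat (cnj_mat A) = cnj_mat (adjoint_mat A)"
    by (simp add: adjoint_mat_def cnj_mat_def)
  moreover have "quad_form (cnj_mat A) v = cnj (quad_form A (\<chi> i. cnj (v $ i)))" for v
    by (simp add: quad_form_def cnj_mat_def matrix_vector_mult_def)
  ultimately show ?thesis using assms by (simp add: psd_mat_def)
qed

text \<open>For transforms of real sequences conjugation is reflection of the frequency
  (\<open>transform_conjugate\<close>). The optimal filter is assembled from roots, inverses and
  products, and each of them has to commute with it.\<close>

lemma sqrt_cnj_mat:
  assumes "psd_mat A"
  shows "sqrt_mat (cnj_mat A) = cnj_mat (sqrt_mat A)"
  by (intro sqrt_mat_unique psd_cnj_mat psd_sqrt_mat assms)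
     (simp add: cnj_mat_mult[symmetric] sqrt_mat_square assms)

lemma invertible_of_ker:
  fixes A :: "complex ^ 'n ^ 'n"
  assumes "\<And>v. A *v v = 0 \<Longrightarrow> v = 0"
  shows "invertible A"
  using assms matrix_left_invertible_ker[of A] invertible_left_inverse[of A] by blast

lemma
  fixes A :: "complex ^ 'n ^ 'n"
  assumes "invertible A"
  shows matrix_inv_right': "A ** matrix_inv A = mat 1" and matrix_inv_left': "matrix_inv A ** A = mat 1"
proof -
  have "\<exists>B. A ** B = mat 1 \<and> B ** A = mat 1" using assms by (auto simp: invertible_def)
  from someI_ex[OF this] show "A ** matrix_inv A = mat 1" "matrix_inv A ** A = mat 1"
    by (auto simp: matrix_inv_def)
qed

lemma matrix_inv_eqI:
  fixes A :: "complex ^ 'n ^ 'n"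
  assumes "A ** B = mat 1"
  shows "matrix_inv A = B"
proof -
  have "invertible A" using assms by (auto simp: invertible_right_inverse)
  then show ?thesis
    using assms matrix_inv_left'[of A] by (metis matrix_mul_assoc matrix_mul_lid matrix_mul_rid)
qed

lemma adjoint_matrix_inv:
  assumes "invertible A" "adjoint_mat A = A"
  shows "adjoint_mat (matrix_inv A) = matrix_inv A"
proof (rule matrix_inv_eqI[symmetric])
  have "adjoint_mat (matrix_inv A ** A) = mat 1" using assms by (simp add: matrix_inv_left')
  then show "A ** adjoint_mat (matrix_inv A) = mat 1" using assms by (simp add: adjoint_mult)
qed

lemma cnj_matrix_inv:
  fixes A :: "complex ^ 'n ^ 'n"
  assumes "invertible A"
  shows "matrix_inv (cnj_mat A) = cnj_mat (matrix_inv A)"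
proof (rule matrix_inv_eqI)
  have "cnj_mat (mat 1 :: complex ^ 'n ^ 'n) = mat 1" by (simp add: cnj_mat_def mat_def vec_eq_iff)
  then show "cnj_mat A ** cnj_mat (matrix_inv A) = mat 1"
    using assms by (simp add: cnj_mat_mult[symmetric] matrix_inv_right')
qed

lemma pd_invertible:
  assumes "pd_mat A"
  shows "invertible A"
proof (rule invertible_of_ker, rule ccontr)
  fix v assume "A *v v = 0" "v \<noteq> 0"
  then show False using assms by (auto simp: pd_mat_def quad_form_cip)
qed

lemma invertible_of_square:
  fixes A :: "complex ^ 'n ^ 'n"
  assumes "invertible (A ** A)"
  shows "invertible A"
proof (rule invertible_of_ker)
  fix v assume "A *v v = 0"
  then have "(A ** A) *v v = 0" by (simp add: matrix_vector_mul_assoc[symmetric])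
  then show "v = 0" using assms invertible_left_inverse[of "A ** A"] matrix_left_invertible_ker by blast
qed

section \<open>The transport problem at a single frequency\<close>

lemma cip_basis:
  assumes "orthonormal_basis E"
  shows "cip u v = (\<Sum>e\<in>E. cip u e * cip e v)"
proof -
  have "cip u v = cip u (\<Sum>e\<in>E. cip e v *s e)" using assms by (simp add: orthonormal_basis_def)
  then show ?thesis by (simp add: cip_sum_right cip_scale_right mult.commute)
qed

text \<open>The weight is left free because every eigendirection of the root receives its own
  eigenvalue as weight, the choice for which both terms on the right have the same
  expectation.\<close>

lemma Re_mult_le_weighted:
  assumes "\<tau> > 0"
  shows "2 * Re (a * b) \<le> \<tau> * (norm a)\<^sup>2 + 1 / \<tau> * (norm b)\<^sup>2"
proof -
  define r where "r = sqrt \<tau>"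
  have r: "r > 0" "\<tau> = r\<^sup>2" using assms by (auto simp: r_def)
  have "0 \<le> (r * norm a - norm b / r)\<^sup>2" by simp
  also have "\<dots> = (r * norm a)\<^sup>2 + (norm b / r)\<^sup>2 - 2 * (r * norm a) * (norm b / r)"
    by (rule power2_diff)
  also have "\<dots> = \<tau> * (norm a)\<^sup>2 + 1 / \<tau> * (norm b)\<^sup>2 - 2 * (norm a * norm b)"
    using r by (simp add: power_mult_distrib power_divide)
  finally show ?thesis
    using complex_Re_le_cmod[of "a * b"] by (simp add: norm_mult)
qed

text \<open>For \<open>W = mat 1\<close> the trace of this matrix is the fidelity in the Bures
  distance between \<open>X\<close> and \<open>Y\<close>.\<close>

definition bures_root :: "complex ^ 'n ^ 'n \<Rightarrow> complex ^ 'n ^ 'n \<Rightarrow> complex ^ 'n ^ 'n \<Rightarrow> complex ^ 'n ^ 'n" where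
  "bures_root W X Y = sqrt_mat (sqrt_mat Y ** W ** X ** W ** sqrt_mat Y)"

lemma psd_bures_arg:
  assumes "psd_mat X" "psd_mat Y" "adjoint_mat W = W"
  shows "psd_mat (sqrt_mat Y ** W ** X ** W ** sqrt_mat Y)"
  using psd_congruence[OF assms(1), of "sqrt_mat Y ** W"] assms
  by (simp add: adjoint_mult psd_hermitian[OF psd_sqrt_mat] matrix_mul_assoc)

lemma invertible_sqrt_mat:
  assumes "pd_mat A"
  shows "invertible (sqrt_mat A)"
  by (rule invertible_of_square) (simp add: sqrt_mat_square pd_imp_psd pd_invertible assms)

text \<open>Dual certificate for the transport problem: \<open>A\<close> and \<open>B\<close> do not depend on the coupling.\<close>

lemma transport_dual_certificate:
  fixes W X Y :: "complex ^ 'n ^ 'n"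
  assumes W: "psd_mat W" and X: "pd_mat X" and Y: "pd_mat Y"
  obtains A B where
    "\<And>x y. Re (quad_form W x) + Re (quad_form W y) - Re (quad_form A x) - Re (quad_form B y)
        \<le> Re (quad_form W (x - y))"
    "trace (A ** X) = trace (bures_root W X Y)" "trace (B ** Y) = trace (bures_root W X Y)"
proof -
  define S where "S = sqrt_mat Y"
  define T where "T = bures_root W X Y"
  define P where "P = matrix_inv S"
  note Xp = pd_imp_psd[OF X] and Yp = pd_imp_psd[OF Y]
  have S: "adjoint_mat S = S" "S ** S = Y" "invertible S"
    using Yp Y by (auto simp: S_def psd_hermitian psd_sqrt_mat sqrt_mat_square invertible_sqrt_mat)
  have P: "adjoint_mat P = P" "S ** P = mat 1" "P ** S = mat 1"
    using S by (auto simp: P_def adjoint_matrix_inv matrix_inv_right' matrix_inv_left')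
  have Wh: "adjoint_mat W = W" using W by (rule psd_hermitian)
  have T: "psd_mat T" and TT: "T ** T = S ** W ** X ** W ** S"
    using psd_bures_arg[OF Xp Yp Wh] by (auto simp: T_def S_def bures_root_def psd_sqrt_mat sqrt_mat_square)
  obtain E lam where E: "orthonormal_basis E" and lam: "\<And>e. e \<in> E \<Longrightarrow> T *v e = of_real (lam e) *s e"
    by (rule hermitian_eigenbasis[OF psd_hermitian[OF T]]) blast
  have on: "orthonormal E" using E by (simp add: orthonormal_basis_def)
  have ee: "cip e e = 1" if "e \<in> E" for e using on that by (simp add: orthonormal_def)
  have lam0: "lam e \<ge> 0" if "e \<in> E" for e
    using psd_nonneg[OF T, of e] lam[OF that] ee[OF that] by (simp add: quad_form_cip cip_scale_right)
  have trT: "trace T = (\<Sum>e\<in>E. of_real (lam e))"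
    using trace_basis[OF E, of T] by (simp add: lam cip_scale_right ee)
  \<comment> \<open>Chosen so that \<open>cip (a e) x\<close> is the \<open>e\<close>-coordinate of
    \<open>S W x\<close>. By \<open>Xa\<close> its variance under the covariance \<open>X\<close> is
    the square of \<open>lam e\<close>.\<close>
  define a where "a e = W *v (S *v e)" for e
  have Xa: "quad_form X (a e) = of_real ((lam e)\<^sup>2)" if "e \<in> E" for e
  proof -
    have "quad_form X (a e) = cip e (S *v (W *v (X *v (W *v (S *v e)))))"
      by (simp only: quad_form_cip a_def hermitian_cip[OF Wh] hermitian_cip[OF S(1)])
    also have "\<dots> = cip e ((S ** W ** X ** W ** S) *v e)"
      by (simp add: matrix_vector_mul_assoc matrix_mul_assoc)
    also have "\<dots> = cip e (T *v (T *v e))" by (simp add: TT[symmetric] matrix_vector_mul_assoc)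
    finally show ?thesis
      by (simp add: lam[OF that] matvec_scale cip_scale_right ee[OF that] power2_eq_square)
  qed
  \<comment> \<open>Definiteness of \<open>X\<close> enters here: a linear functional of variance
    zero is zero, so directions with \<open>lam e = 0\<close> contribute nothing on any
    path.\<close>
  have a0: "a e = 0" if "e \<in> E" "lam e = 0" for e
  proof (rule ccontr)
    assume "a e \<noteq> 0"
    then have "0 < Re (quad_form X (a e))" using X by (simp add: pd_mat_def)
    with Xa[OF that(1)] that(2) show False by simp
  qed
  \<comment> \<open>Terms with \<open>lam e = 0\<close> vanish, as \<open>1 / 0 = 0\<close>; \<open>a0\<close> shows that nothing is lost.\<close>
  define A :: "complex ^ 'n ^ 'n" where
    "A = (\<chi> i j. \<Sum>e\<in>E. of_real (1 / lam e) * (a e $ i * cnj (a e $ j)))"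
  \<comment> \<open>In matrix terms \<open>A\<close> is \<open>S W\<close> applied on both sides of
    the pseudoinverse of \<open>T\<close>, and \<open>B\<close> is \<open>T\<close> between two
    copies of the inverse of \<open>S\<close>.\<close>
  define B where "B = P ** T ** P"
  have quad_A: "Re (quad_form A x) = (\<Sum>e\<in>E. 1 / lam e * (norm (cip (a e) x))\<^sup>2)" for x
  proof -
    have "(A *v x) $ i = (\<Sum>j\<in>UNIV. \<Sum>e\<in>E. of_real (1 / lam e) * (a e $ i * cnj (a e $ j)) * x $ j)" for i
      by (simp add: A_def matrix_vector_mult_def sum_distrib_right)
    also have "\<dots> i = (\<Sum>e\<in>E. \<Sum>j\<in>UNIV. of_real (1 / lam e) * (a e $ i * cnj (a e $ j)) * x $ j)" for i
      by (rule sum.swap)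
    finally have "A *v x = (\<Sum>e\<in>E. (of_real (1 / lam e) * cip (a e) x) *s a e)"
      by (simp add: vec_eq_iff cip_def sum_distrib_left sum_distrib_right mult_ac)
    then have "quad_form A x = (\<Sum>e\<in>E. of_real (1 / lam e) * (cip (a e) x * cnj (cip (a e) x)))"
      by (simp add: quad_form_cip cip_sum_right cip_scale_right mult_ac)
    also have "\<dots> = of_real (\<Sum>e\<in>E. 1 / lam e * (norm (cip (a e) x))\<^sup>2)"
      by (simp only: complex_norm_square[symmetric] of_real_mult of_real_sum)
    finally show ?thesis by simp
  qed
  have quad_B: "Re (quad_form B y) = (\<Sum>e\<in>E. lam e * (norm (cip (P *v y) e))\<^sup>2)" for y
  proof -
    have "quad_form B y = cip (P *v y) (T *v (P *v y))"
      using quad_form_congruence[of P T y] P(1) by (simp add: B_def quad_form_cip)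
    also have "\<dots> = (\<Sum>e\<in>E. cip (P *v y) e * cip e (T *v (P *v y)))"
      by (rule cip_basis[OF E])
    also have "\<dots> = (\<Sum>e\<in>E. of_real (lam e) * (cip (P *v y) e * cnj (cip (P *v y) e)))"
      by (intro sum.cong refl)
        (simp add: hermitian_cip[OF psd_hermitian[OF T], symmetric] lam cip_scale_left)
    also have "\<dots> = of_real (\<Sum>e\<in>E. lam e * (norm (cip (P *v y) e))\<^sup>2)"
      by (simp only: complex_norm_square[symmetric] of_real_mult of_real_sum)
    finally show ?thesis by simp
  qed
  show thesis
  proof
    fix x y
    \<comment> \<open>Whitening: \<open>y\<close> is replaced by \<open>P *v y\<close>, and the
      compensating \<open>S\<close> moves to the other side, where it completes
      \<open>S W x\<close>. Both sides are then expanded in the eigenbasis of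
      \<open>T\<close>.\<close>
    have "cip y (W *v x) = cip (S *v (P *v y)) (W *v x)"
      by (simp add: matrix_vector_mul_assoc P)
    also have "\<dots> = cip (P *v y) (S *v (W *v x))" by (rule hermitian_cip[OF S(1)])
    also have "\<dots> = (\<Sum>e\<in>E. cip (P *v y) e * cip e (S *v (W *v x)))" by (rule cip_basis[OF E])
    also have "\<dots> = (\<Sum>e\<in>E. cip (P *v y) e * cip (a e) x)"
      by (simp add: a_def hermitian_cip[OF S(1)] hermitian_cip[OF Wh])
    finally have "2 * Re (cip y (W *v x)) = (\<Sum>e\<in>E. 2 * Re (cip (P *v y) e * cip (a e) x))"
      by (simp add: sum_distrib_left)
    also have "\<dots> \<le> (\<Sum>e\<in>E. lam e * (norm (cip (P *v y) e))\<^sup>2 + 1 / lam e * (norm (cip (a e) x))\<^sup>2)"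
    proof (rule sum_mono)
      fix e assume e: "e \<in> E"
      show "2 * Re (cip (P *v y) e * cip (a e) x)
        \<le> lam e * (norm (cip (P *v y) e))\<^sup>2 + 1 / lam e * (norm (cip (a e) x))\<^sup>2"
      proof (cases "lam e = 0")
        case True
        then show ?thesis using a0[OF e] by simp
      next
        case False
        then show ?thesis using lam0[OF e] by (intro Re_mult_le_weighted) simp
      qed
    qed
    also have "\<dots> = Re (quad_form B y) + Re (quad_form A x)"
      by (simp add: quad_A quad_B sum.distrib)
    finally have *: "2 * Re (cip y (W *v x)) \<le> Re (quad_form B y) + Re (quad_form A x)" .
    have "Re (cip x (W *v y)) = Re (cip y (W *v x))"
      using Re_cip_commute[of y "W *v x"] by (simp add: hermitian_cip[OF Wh])
    then have "Re (quad_form W (x - y)) = Re (quad_form W x) + Re (quad_form W y) - 2 * Re (cip y (W *v x))"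
      by (simp add: quad_form_cip matrix_vector_mult_diff_distrib cip_diff_left cip_diff_right)
    with * show "Re (quad_form W x) + Re (quad_form W y) - Re (quad_form A x) - Re (quad_form B y)
        \<le> Re (quad_form W (x - y))" by simp
  next
    have "trace (A ** X) = (\<Sum>i\<in>UNIV. \<Sum>j\<in>UNIV. \<Sum>e\<in>E. of_real (1 / lam e) * (a e $ i * cnj (a e $ j)) * X $ j $ i)"
      by (simp add: trace_def matrix_matrix_mult_def A_def sum_distrib_right)
    also have "\<dots> = (\<Sum>i\<in>UNIV. \<Sum>e\<in>E. \<Sum>j\<in>UNIV. of_real (1 / lam e) * (a e $ i * cnj (a e $ j)) * X $ j $ i)"
      by (intro sum.cong refl sum.swap)
    also have "\<dots> = (\<Sum>e\<in>E. \<Sum>i\<in>UNIV. \<Sum>j\<in>UNIV. of_real (1 / lam e) * (a e $ i * cnj (a e $ j)) * X $ j $ i)"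
      by (rule sum.swap)
    also have "\<dots> = (\<Sum>e\<in>E. \<Sum>j\<in>UNIV. \<Sum>i\<in>UNIV. of_real (1 / lam e) * (a e $ i * cnj (a e $ j)) * X $ j $ i)"
      by (intro sum.cong refl sum.swap)
    also have "\<dots> = (\<Sum>e\<in>E. of_real (1 / lam e) * quad_form X (a e))"
      by (simp add: quad_form_def matrix_vector_mult_def sum_distrib_left mult_ac)
    also have "\<dots> = (\<Sum>e\<in>E. of_real (lam e))"
      by (intro sum.cong refl) (simp add: Xa power2_eq_square)
    finally show "trace (A ** X) = trace (bures_root W X Y)"
      using trT by (simp add: T_def)
    have "trace (B ** Y) = trace (P ** (T ** (P ** S) ** S))"
      by (simp add: B_def S(2)[symmetric] matrix_mul_assoc)
    also have "\<dots> = trace (T ** (S ** P))"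
      by (simp add: P trace_mult_commute[of P] matrix_mul_assoc[symmetric])
    finally show "trace (B ** Y) = trace (bures_root W X Y)" by (simp add: P T_def)
  qed
qed

text \<open>For \<open>W = mat 1\<close> this is the linear optimal transport map between centred
  Gaussians with covariances \<open>X\<close> and \<open>Y\<close>. In general it solves
  \<open>T (P y) = S (W x)\<close> for \<open>y\<close>, the equality case of the bound in
  \<open>transport_dual_certificate\<close>.\<close>

definition transport_map :: "complex ^ 'n ^ 'n \<Rightarrow> complex ^ 'n ^ 'n \<Rightarrow> complex ^ 'n ^ 'n \<Rightarrow> complex ^ 'n ^ 'n" where
  "transport_map W X Y = sqrt_mat Y ** matrix_inv (bures_root W X Y) ** sqrt_mat Y ** W"

text \<open>In the first two claims the block \<open>S W X W S\<close>, which is the square of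
  \<open>T\<close>, appears (for the trace after a cyclic permutation) and cancels against
  \<open>Q\<close>, the inverse of \<open>T\<close>. The third is what gives the filter a real
  impulse response.\<close>

lemma
  fixes W X Y :: "complex ^ 'n ^ 'n"
  assumes W: "pd_mat W" and X: "pd_mat X" and Y: "pd_mat Y"
  shows transport_map_covariance: "transport_map W X Y ** X ** adjoint_mat (transport_map W X Y) = Y"
    and transport_map_trace: "trace (adjoint_mat (transport_map W X Y) ** W ** X) = trace (bures_root W X Y)"
    and transport_map_cnj: "transport_map (cnj_mat W) (cnj_mat X) (cnj_mat Y) = cnj_mat (transport_map W X Y)"
proof -
  define S where "S = sqrt_mat Y"
  define T where "T = bures_root W X Y"
  define Q where "Q = matrix_inv T"
  note Xp = pd_imp_psd[OF X] and Yp = pd_imp_psd[OF Y] and Wp = pd_imp_psd[OF W]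
  have S: "adjoint_mat S = S" "S ** S = Y" "invertible S"
    using Yp Y by (auto simp: S_def psd_hermitian psd_sqrt_mat sqrt_mat_square invertible_sqrt_mat)
  have Wh: "adjoint_mat W = W" using Wp by (rule psd_hermitian)
  have arg: "psd_mat (S ** W ** X ** W ** S)"
    using psd_bures_arg[OF Xp Yp Wh] by (simp add: S_def)
  have T: "psd_mat T" and TT: "T ** T = S ** W ** X ** W ** S"
    using arg by (auto simp: T_def S_def bures_root_def psd_sqrt_mat sqrt_mat_square)
  \<comment> \<open>Definiteness of \<open>W\<close> is essential: a kernel of \<open>W\<close>
    would give one of this product, hence of \<open>T\<close>.\<close>
  have "invertible (S ** W ** X ** W ** S)"
    by (intro invertible_mult pd_invertible[OF W] pd_invertible[OF X] S(3))
  from this[folded TT] have invT: "invertible T"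
    by (rule invertible_of_square)
  have Q: "adjoint_mat Q = Q" "T ** Q = mat 1" "Q ** T = mat 1"
    using invT T by (auto simp: Q_def adjoint_matrix_inv matrix_inv_right' matrix_inv_left' psd_hermitian)
  have G: "transport_map W X Y = S ** Q ** S ** W"
    by (simp add: transport_map_def S_def Q_def T_def)
  have Ga: "adjoint_mat (transport_map W X Y) = W ** S ** Q ** S"
    by (simp add: G adjoint_mult S Wh Q matrix_mul_assoc)
  have "transport_map W X Y ** X ** adjoint_mat (transport_map W X Y)
      = S ** Q ** (S ** W ** X ** W ** S) ** Q ** S"
    unfolding Ga unfolding G by (simp add: matrix_mul_assoc)
  also have "\<dots> = S ** (Q ** T) ** (T ** Q) ** S"
    by (simp add: TT[symmetric] matrix_mul_assoc)
  finally show "transport_map W X Y ** X ** adjoint_mat (transport_map W X Y) = Y"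
    by (simp add: Q S)
  have "trace (adjoint_mat (transport_map W X Y) ** W ** X) = trace ((W ** S) ** (Q ** S ** W ** X))"
    by (simp add: Ga matrix_mul_assoc)
  also have "\<dots> = trace (Q ** (S ** W ** X ** W ** S))"
    by (subst trace_mult_commute) (simp add: matrix_mul_assoc)
  also have "\<dots> = trace ((Q ** T) ** T)" by (simp add: TT[symmetric] matrix_mul_assoc)
  finally show "trace (adjoint_mat (transport_map W X Y) ** W ** X) = trace (bures_root W X Y)"
    by (simp only: Q(3) matrix_mul_lid flip: T_def)
  have cS: "sqrt_mat (cnj_mat Y) = cnj_mat S"
    by (simp add: S_def sqrt_cnj_mat Yp)
  have "bures_root (cnj_mat W) (cnj_mat X) (cnj_mat Y) = sqrt_mat (cnj_mat (S ** W ** X ** W ** S))"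
    by (simp only: bures_root_def cS cnj_mat_mult)
  also have "\<dots> = cnj_mat T"
    by (simp only: sqrt_cnj_mat[OF arg]) (simp only: T_def S_def bures_root_def)
  finally show "transport_map (cnj_mat W) (cnj_mat X) (cnj_mat Y) = cnj_mat (transport_map W X Y)"
    by (simp only: transport_map_def cS cnj_matrix_inv[OF invT] cnj_mat_mult flip: T_def S_def)
qed

lemma Re_trace_psd_mult_nonneg:
  fixes C X :: "complex ^ 'n ^ 'n"
  assumes "psd_mat X"
  shows "0 \<le> Re (trace (adjoint_mat C ** C ** X))"
proof -
  have "trace (adjoint_mat C ** C ** X) = trace (C ** X ** adjoint_mat C)"
    using trace_mult_commute[of "adjoint_mat C" "C ** X"] by (simp add: matrix_mul_assoc)
  also have "\<dots> = (\<Sum>i\<in>UNIV. quad_form (C ** X ** adjoint_mat C) (axis i 1))"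
    by (simp add: trace_def quad_form_def matrix_vector_mul_component inner_axis axis_def
        matrix_vector_mult_def if_distrib if_distribR cong: if_cong)
  finally show ?thesis by (auto intro!: sum_nonneg psd_nonneg psd_congruence assms)
qed

section \<open>The discrete Fourier transform\<close>

text \<open>The phase is kept as a real number, not reduced modulo 1, so that it is additive in each
  argument and symmetric in \<open>l\<close> and \<open>t\<close> by plain arithmetic.\<close>

definition phase :: "nat ^ 'd \<Rightarrow> int ^ 'd \<Rightarrow> int ^ 'd \<Rightarrow> real" where
  "phase N l t = (\<Sum>i\<in>UNIV. real_of_int (l $ i * t $ i) / real (N $ i))"

lemma zeta_cis: "zeta N l $ i = cis (2 * pi * (real_of_int (l $ i) / real (N $ i)))"
  unfolding zeta_def vec_lambda_beta cis_conv_exp by (simp add: mult_ac)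

lemma mpow_zeta: "mpow (zeta N l) t = cis (2 * pi * phase N l t)"
proof -
  have prod_cis: "(\<Prod>i\<in>S. cis (f i)) = cis (\<Sum>i\<in>S. f i)" for f and S :: "'d set"
    by (induction S rule: infinite_finite_induct) (auto simp: cis_mult)
  have "zeta N l $ i powi (t $ i) = cis (2 * pi * (real_of_int (l $ i * t $ i) / real (N $ i)))" for i
    by (simp add: zeta_cis cis_power_int mult_ac)
  then show ?thesis
    by (simp add: mpow_def phase_def prod_cis sum_distrib_left)
qed

lemma mpow_zeta_add: "mpow (zeta N l) (t + s) = mpow (zeta N l) t * mpow (zeta N l) s"
  by (simp add: mpow_zeta phase_def cis_mult algebra_simps add_divide_distrib sum.distrib)

lemma mpow_zeta_add_left: "mpow (zeta N (l + k)) t = mpow (zeta N l) t * mpow (zeta N k) t"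
  by (simp add: mpow_zeta phase_def cis_mult algebra_simps add_divide_distrib sum.distrib)

lemma mpow_zeta_minus: "mpow (zeta N l) (- t) = cnj (mpow (zeta N l) t)"
  by (simp add: mpow_zeta phase_def cis_cnj sum_negf)

lemma mpow_zeta_minus_left: "mpow (zeta N (- l)) t = cnj (mpow (zeta N l) t)"
  by (simp add: mpow_zeta phase_def cis_cnj sum_negf)

lemma mpow_zeta_diff: "mpow (zeta N l) (t - s) = mpow (zeta N l) t * cnj (mpow (zeta N l) s)"
  using mpow_zeta_add[of N l t "- s"] by (simp add: mpow_zeta_minus)

text \<open>Self-duality of the torus: orthogonality of characters summed over sites also gives
  orthogonality summed over frequencies.\<close>

lemma mpow_zeta_commute: "mpow (zeta N l) t = mpow (zeta N t) l"
  by (simp add: mpow_zeta phase_def mult.commute)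

lemma mpow_zeta_cnj_mult [simp]: "cnj (mpow (zeta N l) t) * mpow (zeta N l) t = 1"
  "mpow (zeta N l) t * cnj (mpow (zeta N l) t) = 1"
  by (simp_all add: mpow_zeta cis_cnj cis_mult)

lemma mpow_zeta_axis: "mpow (zeta N l) (axis i k) = cis (2 * pi * (real_of_int (l $ i * k) / real (N $ i)))"
proof -
  have "phase N l (axis i k) = (\<Sum>j\<in>UNIV. if j = i then real_of_int (l $ i * k) / real (N $ i) else 0)"
    unfolding phase_def by (intro sum.cong) (auto simp: axis_def)
  then show ?thesis by (simp add: mpow_zeta)
qed

section \<open>Periodic sequences and sums over the index box\<close>

locale torus =
  fixes N :: "nat ^ 'd"
  assumes N_pos: "\<And>i. 0 < N $ i"
begin

definition red :: "int ^ 'd \<Rightarrow> int ^ 'd" where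
  "red t = (\<chi> i. t $ i mod int (N $ i))"

lemma red_in_box: "red t \<in> box_N N"
  by (simp add: red_def box_N_def N_pos)

lemma red_id: "t \<in> box_N N \<Longrightarrow> red t = t"
  by (auto simp: red_def box_N_def vec_eq_iff)

lemma red_add: "red (red t + s) = red (t + s)"
  by (simp add: red_def vec_eq_iff mod_add_left_eq)

lemma red_diff: "red (red t - s) = red (t - s)"
  by (simp add: red_def vec_eq_iff mod_diff_left_eq)

lemma red_minus: "red (- red t) = red (- t)"
  by (simp add: red_def vec_eq_iff mod_minus_eq)

text \<open>\<open>t\<close> and \<open>red t\<close> differ by an integer multiple of the period in
  each coordinate. The hypothesis covers one forward step along one axis; the proof extends it to
  natural multiples, then to negative ones by stepping forward from the shifted point, then to all
  axes together.\<close>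

lemma periodic_red:
  assumes f: "periodic_seq N f"
  shows "f (red t) = f t"
proof -
  have nat_step: "f (t + axis l (int (N $ l) * int k)) = f t" for t l k
  proof (induction k)
    case (Suc k)
    have "axis l (int (N $ l) * int (Suc k)) = axis l (int (N $ l) * int k) + axis l (int (N $ l))"
      by (simp add: axis_def vec_eq_iff algebra_simps)
    then show ?case
      using f Suc unfolding periodic_seq_def by (metis add.assoc)
  qed (simp add: axis_def zero_vec_def[symmetric])
  have int_step: "f (t + axis l (int (N $ l) * k)) = f t" for t l k
  proof (cases "k \<ge> 0")
    case True
    then show ?thesis using nat_step[of t l "nat k"] by simp
  next
    case False
    have "axis l (int (N $ l) * k) + axis l (int (N $ l) * (- k)) = 0"
      by (simp add: axis_def vec_eq_iff)
    then have e: "t + axis l (int (N $ l) * k) + axis l (int (N $ l) * int (nat (- k))) = t"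
      using False by (simp add: add.assoc)
    show ?thesis using nat_step[of "t + axis l (int (N $ l) * k)" l "nat (- k)"] by (simp only: e)
  qed
  have sum_step: "f (t' + (\<Sum>l\<in>L. axis l (int (N $ l) * q l))) = f t'" if "finite L" for L t' q
    using that
  proof induction
    case (insert l L)
    have e: "t' + (\<Sum>l\<in>insert l L. axis l (int (N $ l) * q l))
        = (t' + (\<Sum>l\<in>L. axis l (int (N $ l) * q l))) + axis l (int (N $ l) * q l)"
      using insert by (simp add: algebra_simps)
    show ?case by (simp only: e int_step insert.IH)
  qed simp
  have "t = red t + (\<Sum>l\<in>UNIV. axis l (int (N $ l) * (t $ l div int (N $ l))))"
  proof -
    have "(\<Sum>l\<in>UNIV. axis l (int (N $ l) * (t $ l div int (N $ l)))) $ i = int (N $ i) * (t $ i div int (N $ i))" for i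
    proof -
      have "(\<Sum>l\<in>UNIV. axis l (int (N $ l) * (t $ l div int (N $ l)))) $ i
         = (\<Sum>l\<in>UNIV. if l = i then int (N $ i) * (t $ i div int (N $ i)) else 0)"
        unfolding sum_component by (intro sum.cong) (auto simp: axis_def)
      then show ?thesis by simp
    qed
    then show ?thesis by (simp add: vec_eq_iff red_def)
  qed
  then show ?thesis
    using sum_step[of UNIV "red t" "\<lambda>l. t $ l div int (N $ l)"] by simp
qed

lemma sum_box_shift:
  assumes "periodic_seq N f"
  shows "(\<Sum>t\<in>box_N N. f (t + s)) = (\<Sum>t\<in>box_N N. f t)"
proof (rule sum.reindex_bij_witness[of _ "\<lambda>t. red (t - s)" "\<lambda>t. red (t + s)"])
  fix t assume "t \<in> box_N N"
  then show "red (red (t + s) - s) = t" "red (red (t - s) + s) = t"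
    by (simp_all add: red_add red_diff red_id)
  show "f (red (t + s)) = f (t + s)" by (rule periodic_red[OF assms])
qed (rule red_in_box)+

lemma sum_box_reflect:
  assumes "periodic_seq N f"
  shows "(\<Sum>t\<in>box_N N. f (- t)) = (\<Sum>t\<in>box_N N. f t)"
proof (rule sum.reindex_bij_witness[of _ "\<lambda>t. red (- t)" "\<lambda>t. red (- t)"])
  fix t assume "t \<in> box_N N"
  then show "red (- red (- t)) = t" "red (- red (- t)) = t"
    by (simp_all add: red_minus red_id)
  show "f (red (- t)) = f (- t)" by (rule periodic_red[OF assms])
qed (rule red_in_box)+

lemma box_card: "finite (box_N N)" "card (box_N N) = (\<Prod>i\<in>UNIV. N $ i)"
proof -
  define F where "F = (\<Pi>\<^sub>E i\<in>(UNIV::'d set). {0..<int (N $ i)})"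
  have "bij_betw (\<lambda>t. vec_nth t) (box_N N) F"
    by (rule bij_betwI[where g = "\<lambda>f. \<chi> i. f i"])
      (auto simp: F_def box_N_def PiE_def Pi_def extensional_def)
  moreover have "finite F" "card F = (\<Prod>i\<in>UNIV. N $ i)"
    by (auto simp: F_def card_PiE intro!: finite_PiE)
  ultimately show "finite (box_N N)" "card (box_N N) = (\<Prod>i\<in>UNIV. N $ i)"
    by (metis bij_betw_finite bij_betw_same_card)+
qed

lemma card_pos: "card (box_N N) > 0"
  using N_pos by (simp add: box_card prod_pos)

lemma mpow_zeta_period: "mpow (zeta N l) (axis i (int (N $ i))) = 1"
  using N_pos[of i] cis_multiple_2pi[of "real_of_int (l $ i)"] by (simp add: mpow_zeta_axis mult_ac)

lemma periodic_mpow: "periodic_seq N (mpow (zeta N l))"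
  by (simp add: periodic_seq_def mpow_zeta_add mpow_zeta_period)

lemma periodic_zeta: "periodic_seq N (zeta N)"
proof -
  have "zeta N (l + axis i (int (N $ i))) $ j = zeta N l $ j" for l i j
  proof -
    have "zeta N k $ j = mpow (zeta N k) (axis j 1)" for k
      by (simp only: mpow_zeta_axis zeta_cis mult_1_right)
    then show ?thesis
      by (simp add: mpow_zeta_add_left) (metis mpow_zeta_commute mpow_zeta_period mult.right_neutral)
  qed
  then show ?thesis by (simp add: periodic_seq_def vec_eq_iff)
qed

lemma periodic_comp_zeta: "periodic_seq N (\<lambda>l. F (zeta N l))"
  using periodic_zeta by (simp add: periodic_seq_def)

text \<open>For \<open>l \<noteq> k\<close> the summand is a character \<open>m = l - k\<close>.
  Translating the box by one site along an axis on which \<open>m\<close> is nonzero preserves the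
  sum and also multiplies it by a root of unity different from 1.\<close>

lemma sum_mpow_zeta:
  assumes "l \<in> box_N N" "k \<in> box_N N"
  shows "(\<Sum>t\<in>box_N N. mpow (zeta N l) t * cnj (mpow (zeta N k) t)) = (if l = k then of_nat (card (box_N N)) else 0)"
proof (cases "l = k")
  case False
  then obtain i where i: "l $ i \<noteq> k $ i" by (auto simp: vec_eq_iff)
  define m where "m = l + - k"
  have eq: "mpow (zeta N l) t * cnj (mpow (zeta N k) t) = mpow (zeta N m) t" for t
    by (simp only: m_def mpow_zeta_add_left mpow_zeta_minus_left)
  \<comment> \<open>The value is 1 only if \<open>N $ i\<close> divides
    \<open>l $ i - k $ i\<close>, which is impossible for two distinct numbers in the same residue
    range.\<close>
  have "mpow (zeta N m) (axis i 1) \<noteq> 1"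
  proof
    assume "mpow (zeta N m) (axis i 1) = 1"
    then have "cis (2 * pi * (real_of_int (m $ i) / real (N $ i))) = 1"
      by (simp add: mpow_zeta_axis)
    then have "cos (2 * pi * (real_of_int (m $ i) / real (N $ i))) = 1"
      by (simp add: complex_eq_iff)
    then obtain q :: int where "2 * pi * (real_of_int (m $ i) / real (N $ i)) = of_int q * 2 * pi"
      by (auto simp: cos_one_2pi_int)
    then have "real_of_int (m $ i) = real_of_int (q * int (N $ i))"
      using N_pos[of i] by (simp add: field_simps)
    then have "l $ i - k $ i = q * int (N $ i)" by (simp only: of_int_eq_iff) (simp add: m_def)
    moreover have "\<bar>l $ i - k $ i\<bar> < int (N $ i)"
      using assms by (auto simp: box_N_def abs_less_iff dest!: spec[of _ i])
    ultimately show False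
      using i by (metis abs_mult abs_of_nat diff_eq_eq linorder_not_less mult_eq_0_iff abs_ge_zero
          add_0 mult_le_cancel_right1 zero_less_abs_iff int_one_le_iff_zero_less of_nat_0_le_iff)
  qed
  moreover have "mpow (zeta N m) (axis i 1) * (\<Sum>t\<in>box_N N. mpow (zeta N m) t) = (\<Sum>t\<in>box_N N. mpow (zeta N m) t)"
    using sum_box_shift[OF periodic_mpow[of m], of "axis i 1"]
    by (simp add: mpow_zeta_add sum_distrib_left mult.commute)
  ultimately have "(\<Sum>t\<in>box_N N. mpow (zeta N m) t) = 0" by simp
  then show ?thesis using False by (simp add: eq)
qed simp

lemma sum_mpow_zeta':
  assumes "t \<in> box_N N" "s \<in> box_N N"
  shows "(\<Sum>l\<in>box_N N. mpow (zeta N l) t * cnj (mpow (zeta N l) s)) = (if t = s then of_nat (card (box_N N)) else 0)"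
  using sum_mpow_zeta[OF assms] by (simp add: mpow_zeta_commute[of N _ t] mpow_zeta_commute[of N _ s])

section \<open>Transforms, convolution and inversion\<close>

definition dft :: "(int ^ 'd \<Rightarrow> real ^ 'n) \<Rightarrow> int ^ 'd \<Rightarrow> complex ^ 'n" where
  "dft z l = (\<chi> i. \<Sum>t\<in>box_N N. of_real (z t $ i) * mpow (zeta N l) (- t))"

lemma dft_diff: "dft (\<lambda>t. x t - y t) l = dft x l - dft y l"
  by (simp add: dft_def vec_eq_iff sum_subtractf algebra_simps)

lemma parseval:
  fixes v :: "int ^ 'd \<Rightarrow> real ^ 'n"
  shows "real (card (box_N N)) * (\<Sum>t\<in>box_N N. (norm (v t))\<^sup>2) = (\<Sum>l\<in>box_N N. (norm (dft v l))\<^sup>2)"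
proof -
  have scalar: "of_nat (card (box_N N)) * (\<Sum>t\<in>box_N N. of_real ((f t)\<^sup>2)) =
     (\<Sum>l\<in>box_N N. complex_of_real ((norm (\<Sum>t\<in>box_N N. of_real (f t) * mpow (zeta N l) (- t)))\<^sup>2))"
    for f :: "int ^ 'd \<Rightarrow> real"
  proof -
    have "(\<Sum>l\<in>box_N N. complex_of_real ((norm (\<Sum>t\<in>box_N N. of_real (f t) * mpow (zeta N l) (- t)))\<^sup>2))
       = (\<Sum>l\<in>box_N N. \<Sum>t\<in>box_N N. \<Sum>s\<in>box_N N. of_real (f t * f s) * (mpow (zeta N l) t * cnj (mpow (zeta N l) s)))"
      unfolding complex_norm_square by (simp add: sum_product mpow_zeta_minus mult_ac)
    also have "\<dots> = (\<Sum>t\<in>box_N N. \<Sum>l\<in>box_N N. \<Sum>s\<in>box_N N. of_real (f t * f s) * (mpow (zeta N l) t * cnj (mpow (zeta N l) s)))"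
      by (rule sum.swap)
    also have "\<dots> = (\<Sum>t\<in>box_N N. \<Sum>s\<in>box_N N. \<Sum>l\<in>box_N N. of_real (f t * f s) * (mpow (zeta N l) t * cnj (mpow (zeta N l) s)))"
      by (intro sum.cong refl sum.swap)
    also have "\<dots> = (\<Sum>t\<in>box_N N. \<Sum>s\<in>box_N N. of_real (f t * f s) * (if t = s then of_nat (card (box_N N)) else 0))"
      by (intro sum.cong refl) (simp only: sum_distrib_left[symmetric] sum_mpow_zeta')
    also have "\<dots> = (\<Sum>t\<in>box_N N. of_real ((f t)\<^sup>2) * of_nat (card (box_N N)))"
      using box_card by (simp add: if_distrib[where f="\<lambda>x. _ * x"] power2_eq_square cong: if_cong)
    finally show ?thesis by (simp add: sum_distrib_left mult.commute)
  qed
  have norm2: "(norm u)\<^sup>2 = (\<Sum>i\<in>UNIV. (norm (u $ i))\<^sup>2)" for u :: "('a::real_normed_vector) ^ 'n"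
    by (simp add: norm_vec_def L2_set_def sum_nonneg)
  have "complex_of_real (real (card (box_N N)) * (\<Sum>t\<in>box_N N. (norm (v t))\<^sup>2))
      = (\<Sum>i\<in>UNIV. of_nat (card (box_N N)) * (\<Sum>t\<in>box_N N. of_real ((v t $ i)\<^sup>2)))"
    by (simp add: norm2 sum_distrib_left) (rule sum.swap)
  also have "\<dots> = (\<Sum>l\<in>box_N N. \<Sum>i\<in>UNIV. complex_of_real ((norm (dft v l $ i))\<^sup>2))"
    unfolding scalar by (simp add: dft_def) (rule sum.swap)
  also have "\<dots> = of_real (\<Sum>l\<in>box_N N. (norm (dft v l))\<^sup>2)"
    by (simp add: norm2)
  finally show ?thesis by (simp only: of_real_eq_iff)
qed

lemma periodic_transform_summand:
  assumes "periodic_seq N f"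
  shows "periodic_seq N (\<lambda>t. of_real (f t) * mpow (zeta N l) (- t))"
proof -
  have "mpow (zeta N l) (- (t + axis i (int (N $ i)))) = mpow (zeta N l) (- t)" for t i
    by (simp only: mpow_zeta_minus mpow_zeta_add mpow_zeta_period) simp
  then show ?thesis using assms by (simp add: periodic_seq_def)
qed

text \<open>Both sides see \<open>z\<close> only on the box. Periodicity of \<open>h\<close> lets
  the sum over \<open>t\<close> be shifted by \<open>s\<close>, which splits off the factor
  belonging to \<open>s\<close>.\<close>

lemma dft_circ_conv:
  assumes h: "periodic_seq N h"
  shows "dft (circ_conv N h z) l = transform N h (zeta N l) *v dft z l"
proof -
  have "dft (circ_conv N h z) l $ i = (transform N h (zeta N l) *v dft z l) $ i" for i
  proof -
    have eq: "(\<Sum>t\<in>box_N N. of_real (h (t - s) $ i $ j) * mpow (zeta N l) (- t))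
      = transform N h (zeta N l) $ i $ j * mpow (zeta N l) (- s)" for s j
    proof -
      have "periodic_seq N (\<lambda>t. h t $ i $ j)" using h by (simp add: periodic_seq_def)
      from sum_box_shift[OF periodic_transform_summand[OF this, of l], of "- s"]
      have "(\<Sum>t\<in>box_N N. of_real (h (t - s) $ i $ j) * mpow (zeta N l) (- (t - s)))
        = transform N h (zeta N l) $ i $ j"
        by (simp add: transform_def)
      then have "transform N h (zeta N l) $ i $ j * mpow (zeta N l) (- s)
        = (\<Sum>t\<in>box_N N. of_real (h (t - s) $ i $ j) * (mpow (zeta N l) (- (t - s)) * mpow (zeta N l) (- s)))"
        by (simp add: sum_distrib_right[symmetric] mult.assoc[symmetric])
      then show ?thesis by (simp only: mpow_zeta_add[symmetric]) simp
    qed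
    have "dft (circ_conv N h z) l $ i = (\<Sum>t\<in>box_N N. \<Sum>s\<in>box_N N. \<Sum>j\<in>UNIV.
        of_real (h (t - s) $ i $ j) * mpow (zeta N l) (- t) * of_real (z s $ j))"
      by (simp add: dft_def circ_conv_def matrix_vector_mult_def sum_distrib_left sum_distrib_right mult_ac)
    also have "\<dots> = (\<Sum>s\<in>box_N N. \<Sum>t\<in>box_N N. \<Sum>j\<in>UNIV.
        of_real (h (t - s) $ i $ j) * mpow (zeta N l) (- t) * of_real (z s $ j))"
      by (rule sum.swap)
    also have "\<dots> = (\<Sum>s\<in>box_N N. \<Sum>j\<in>UNIV. \<Sum>t\<in>box_N N.
        of_real (h (t - s) $ i $ j) * mpow (zeta N l) (- t) * of_real (z s $ j))"
      by (intro sum.cong refl sum.swap)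
    also have "\<dots> = (\<Sum>s\<in>box_N N. \<Sum>j\<in>UNIV.
        transform N h (zeta N l) $ i $ j * mpow (zeta N l) (- s) * of_real (z s $ j))"
      by (simp only: sum_distrib_right[symmetric] eq)
    also have "\<dots> = (\<Sum>j\<in>UNIV. \<Sum>s\<in>box_N N.
        transform N h (zeta N l) $ i $ j * mpow (zeta N l) (- s) * of_real (z s $ j))"
      by (rule sum.swap)
    also have "\<dots> = (transform N h (zeta N l) *v dft z l) $ i"
      by (simp add: matrix_vector_mult_def dft_def sum_distrib_left mult_ac)
    finally show ?thesis .
  qed
  then show ?thesis by (simp add: vec_eq_iff)
qed

lemma transform_conjugate: "transform N A (zeta N (- l)) = cnj_mat (transform N A (zeta N l))"
  by (simp add: transform_def cnj_mat_def vec_eq_iff mpow_zeta_minus_left)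

text \<open>Fourier inversion recovers the values on the box, and periodicity recovers the
  rest.\<close>

lemma transform_inject:
  assumes A: "periodic_seq N A" and B: "periodic_seq N B"
    and eq: "\<And>l. l \<in> box_N N \<Longrightarrow> transform N A (zeta N l) = transform N B (zeta N l)"
  shows "A = B"
proof -
  have inv: "(\<Sum>l\<in>box_N N. transform N A (zeta N l) $ i $ j * mpow (zeta N l) t)
      = of_nat (card (box_N N)) * of_real (A t $ i $ j)" if t: "t \<in> box_N N" for A i j t
  proof -
    have "(\<Sum>l\<in>box_N N. transform N A (zeta N l) $ i $ j * mpow (zeta N l) t)
       = (\<Sum>l\<in>box_N N. \<Sum>s\<in>box_N N. of_real (A s $ i $ j) * (mpow (zeta N l) t * cnj (mpow (zeta N l) s)))"
      by (simp add: transform_def sum_distrib_left sum_distrib_right mpow_zeta_minus mult_ac)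
    also have "\<dots> = (\<Sum>s\<in>box_N N. \<Sum>l\<in>box_N N. of_real (A s $ i $ j) * (mpow (zeta N l) t * cnj (mpow (zeta N l) s)))"
      by (rule sum.swap)
    also have "\<dots> = (\<Sum>s\<in>box_N N. of_real (A s $ i $ j) * (if t = s then of_nat (card (box_N N)) else 0))"
      by (intro sum.cong refl) (simp only: sum_distrib_left[symmetric] sum_mpow_zeta' t)
    finally show ?thesis
      using box_card t by (simp add: if_distrib[where f="\<lambda>x. _ * x"] mult.commute cong: if_cong)
  qed
  have "A t = B t" if "t \<in> box_N N" for t
  proof -
    have "of_nat (card (box_N N)) * complex_of_real (A t $ i $ j) = of_nat (card (box_N N)) * of_real (B t $ i $ j)" for i j
      by (simp only: inv[OF that, symmetric] eq cong: sum.cong)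
    then show ?thesis using card_pos by (simp add: vec_eq_iff)
  qed
  then have "A (red t) = B (red t)" for t using red_in_box by blast
  then show ?thesis by (simp add: fun_eq_iff periodic_red A B)
qed

text \<open>\<open>Re\<close> turns the inverse transform into a real sequence, as an impulse
  response must be. For conjugate symmetric \<open>G\<close> it discards nothing, which is the core
  of \<open>transform_idft\<close>.\<close>

definition idft :: "(complex ^ 'd \<Rightarrow> complex ^ 'm ^ 'm) \<Rightarrow> int ^ 'd \<Rightarrow> real ^ 'm ^ 'm" where
  "idft G t = (\<chi> i j. Re ((\<Sum>l\<in>box_N N. G (zeta N l) $ i $ j * mpow (zeta N l) t) / of_nat (card (box_N N))))"

lemma periodic_idft: "periodic_seq N (idft G)"
  using periodic_mpow by (simp add: periodic_seq_def idft_def)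

lemma transform_idft:
  assumes G: "\<And>l. G (zeta N (- l)) = cnj_mat (G (zeta N l))" and k: "k \<in> box_N N"
  shows "transform N (idft G) (zeta N k) = G (zeta N k)"
proof -
  have real: "complex_of_real (idft G t $ i $ j)
      = (\<Sum>l\<in>box_N N. G (zeta N l) $ i $ j * mpow (zeta N l) t) / of_nat (card (box_N N))" for t i j
  proof -
    define f where "f l = G (zeta N l) $ i $ j * mpow (zeta N l) t" for l
    have "f (- l) = cnj (f l)" for l
      by (simp add: f_def G cnj_mat_def mpow_zeta_minus_left)
    moreover have "periodic_seq N f"
      unfolding f_def by (rule periodic_comp_zeta)
    \<comment> \<open>Reflection permutes the frequencies modulo the periods, so conjugate symmetry
      of \<open>f\<close> makes the sum its own conjugate.\<close>
    ultimately have "cnj (\<Sum>l\<in>box_N N. f l) = (\<Sum>l\<in>box_N N. f l)"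
      using sum_box_reflect[of f] by simp
    then have "cnj ((\<Sum>l\<in>box_N N. f l) / of_nat (card (box_N N))) = (\<Sum>l\<in>box_N N. f l) / of_nat (card (box_N N))"
      by (simp only: complex_cnj_divide complex_cnj_of_nat)
    then have "(\<Sum>l\<in>box_N N. f l) / of_nat (card (box_N N)) \<in> \<real>"
      by (simp only: Reals_cnj_iff)
    then show ?thesis by (simp only: idft_def f_def vec_lambda_beta of_real_Re)
  qed
  have "transform N (idft G) (zeta N k) $ i $ j = G (zeta N k) $ i $ j" for i j
  proof -
    have "transform N (idft G) (zeta N k) $ i $ j = (\<Sum>t\<in>box_N N. \<Sum>l\<in>box_N N.
        G (zeta N l) $ i $ j / of_nat (card (box_N N)) * (mpow (zeta N l) t * cnj (mpow (zeta N k) t)))"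
      by (simp add: transform_def real sum_distrib_right sum_divide_distrib mpow_zeta_minus mult.assoc)
    also have "\<dots> = (\<Sum>l\<in>box_N N. \<Sum>t\<in>box_N N.
        G (zeta N l) $ i $ j / of_nat (card (box_N N)) * (mpow (zeta N l) t * cnj (mpow (zeta N k) t)))"
      by (rule sum.swap)
    also have "\<dots> = (\<Sum>l\<in>box_N N. G (zeta N l) $ i $ j / of_nat (card (box_N N)) *
        (if l = k then of_nat (card (box_N N)) else 0))"
      by (intro sum.cong refl) (simp only: sum_distrib_left[symmetric] sum_mpow_zeta k)
    finally show ?thesis
      using box_card(1) k card_pos by (auto simp add: if_distrib[where f="\<lambda>x. _ * x"] cong: if_cong)
  qed
  then show ?thesis by (auto simp add: vec_eq_iff)
qed

end

section \<open>Uniqueness of Gaussian laws\<close>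

lemma measurable_cis [measurable]: "cis \<in> borel_measurable borel"
  by (intro borel_measurable_continuous_onI continuous_on_cis continuous_on_id)

lemma (in finite_measure) integrable_weighted_cis:
  assumes [measurable]: "w \<in> borel_measurable M" "f \<in> borel_measurable M"
    and w: "\<And>x. x \<in> space M \<Longrightarrow> \<bar>w x\<bar> \<le> (C::real)"
  shows "integrable M (\<lambda>x. complex_of_real (w x) * cis (f x))"
proof (rule integrable_const_bound[where B = C])
  show "AE x in M. norm (complex_of_real (w x) * cis (f x)) \<le> C"
    using w by (auto simp: norm_mult)
qed measurable

text \<open>After division by its total mass \<open>c\<close> the weight is a probability density,
  and the hypothesis says that the two reweighted laws of \<open>X\<close> have equal characteristic
  functions. The case \<open>a = 0\<close> shows that \<open>c\<close> is the same for
  \<open>P\<close> and \<open>Q\<close>; if \<open>c = 0\<close>, the weight vanishes almost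
  everywhere.\<close>

lemma weighted_char_unique:
  fixes X :: "'a \<Rightarrow> real" and w :: "'a \<Rightarrow> real"
  assumes P: "prob_space P" and Q: "prob_space Q" and sets: "sets P = sets M" "sets Q = sets M"
    and [measurable]: "X \<in> borel_measurable M" "w \<in> borel_measurable M"
    and w: "\<And>x. 0 \<le> w x" "\<And>x. w x \<le> C"
    and char: "\<And>a. (\<integral>x. of_real (w x) * cis (a * X x) \<partial>P) = (\<integral>x. of_real (w x) * cis (a * X x) \<partial>Q)"
    and A: "A \<in> sets borel"
  shows "(\<integral>x. w x * indicator A (X x) \<partial>P) = (\<integral>x. w x * indicator A (X x) \<partial>Q)"
proof -
  interpret P: prob_space P by fact
  interpret Q: prob_space Q by fact
  note [measurable_cong] = sets
  note [measurable] = A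
  have int: "integrable P w" "integrable Q w"
    using w by (auto intro!: P.integrable_const_bound[where B=C] Q.integrable_const_bound[where B=C])
  define c where "c = (\<integral>x. w x \<partial>P)"
  have "complex_of_real (\<integral>x. w x \<partial>P) = complex_of_real (\<integral>x. w x \<partial>Q)"
    using char[of 0] by simp
  then have c: "c = (\<integral>x. w x \<partial>P)" "c = (\<integral>x. w x \<partial>Q)" by (simp_all add: c_def)
  have c0: "c \<ge> 0" unfolding c_def using w by (simp add: integral_nonneg)
  show ?thesis
  proof (cases "c = 0")
    case True
    have ae: "AE x in P. w x = 0" "AE x in Q. w x = 0"
      using integral_nonneg_eq_0_iff_AE[OF int(1)] integral_nonneg_eq_0_iff_AE[OF int(2)] c True w by auto
    have "(\<integral>x. w x * indicator A (X x) \<partial>P) = (\<integral>x. 0 \<partial>P)"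
      by (rule integral_cong_AE) (use ae in auto)
    moreover have "(\<integral>x. w x * indicator A (X x) \<partial>Q) = (\<integral>x. 0 \<partial>Q)"
      by (rule integral_cong_AE) (use ae in auto)
    ultimately show ?thesis by simp
  next
    case False
    with c0 have cpos: "c > 0" by simp
    define D where "D R = distr (density R (\<lambda>x. ennreal (w x / c))) borel X" for R
    have props: "real_distribution (D R) \<and> (\<forall>a. char (D R) a = (\<integral>x. of_real (w x) * cis (a * X x) \<partial>R) / c)
        \<and> (\<integral>x. indicator A x \<partial>D R) = (\<integral>x. w x * indicator A (X x) \<partial>R) / c"
      if R: "prob_space R" and [measurable_cong]: "sets R = sets M" and c: "c = (\<integral>x. w x \<partial>R)" for R
    proof -
      interpret R: prob_space R by fact
      have int: "integrable R w" using w by (auto intro!: R.integrable_const_bound[where B=C])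
      have "emeasure (density R (\<lambda>x. ennreal (w x / c))) (space R) = (\<integral>\<^sup>+x. ennreal (w x / c) \<partial>R)"
        by (simp add: emeasure_density cong: nn_integral_cong)
      also have "\<dots> = ennreal (\<integral>x. w x / c \<partial>R)"
        using int w cpos by (intro nn_integral_eq_integral) auto
      also have "\<dots> = 1" using c cpos by simp
      finally have "prob_space (density R (\<lambda>x. ennreal (w x / c)))"
        by (intro prob_spaceI) simp
      then have rd: "real_distribution (D R)"
        unfolding D_def by (intro prob_space.real_distribution_distr) auto
      have 1: "char (D R) a = (\<integral>x. of_real (w x) * cis (a * X x) \<partial>R) / c" for a
      proof -
        have "char (D R) a = (\<integral>x. cis (a * X x) \<partial>density R (\<lambda>x. ennreal (w x / c)))"
          unfolding char_def D_def by (subst integral_distr) (auto simp: cis_conv_exp)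
        also have "\<dots> = (\<integral>x. (w x / c) *\<^sub>R cis (a * X x) \<partial>R)"
          using w cpos by (subst integral_density) auto
        also have "\<dots> = (\<integral>x. of_real (w x) * cis (a * X x) / c \<partial>R)"
          by (simp add: scaleR_conv_of_real)
        finally show ?thesis by simp
      qed
      have "(\<integral>x. indicator A x \<partial>D R) = (\<integral>x. (indicator A (X x) :: real) \<partial>density R (\<lambda>x. ennreal (w x / c)))"
        unfolding D_def by (subst integral_distr) auto
      also have "\<dots> = (\<integral>x. w x / c * indicator A (X x) \<partial>R)"
        using w cpos by (subst integral_density) auto
      also have "\<dots> = (\<integral>x. w x * indicator A (X x) \<partial>R) / c" by simp
      finally show ?thesis using rd 1 by simp
    qed
    have "D P = D Q"
      using props[OF P sets(1) c(1)] props[OF Q sets(2) c(2)] char by (intro Levy_uniqueness) auto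
    then show ?thesis
      using props[OF P sets(1) c(1)] props[OF Q sets(2) c(2)] cpos by simp
  qed
qed

text \<open>The coordinates are handled one at a time: multiplying by the bounded nonnegative weights
  \<open>1 + cos L\<close> and \<open>1 + sin L\<close> reduces each step to the one-dimensional uniqueness theorem.\<close>

lemma char_unique_cylinder:
  fixes X :: "'i \<Rightarrow> 'a \<Rightarrow> real" and V :: "('a \<Rightarrow> real) set"
  assumes P: "prob_space P" and Q: "prob_space Q" and sets: "sets P = sets M" "sets Q = sets M"
    and V: "\<And>L. L \<in> V \<Longrightarrow> L \<in> borel_measurable M" "\<And>L K a. L \<in> V \<Longrightarrow> K \<in> V \<Longrightarrow> (\<lambda>x. a * L x + K x) \<in> V"
      "(\<lambda>x. 0) \<in> V"
    and X: "\<And>i. X i \<in> V"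
    and char: "\<And>L. L \<in> V \<Longrightarrow> (\<integral>x. cis (L x) \<partial>P) = (\<integral>x. cis (L x) \<partial>Q)"
    and J: "finite J" and A: "\<And>i. i \<in> J \<Longrightarrow> A i \<in> sets borel"
    and L: "L \<in> V"
  shows "(\<integral>x. of_real (\<Prod>i\<in>J. indicator (A i) (X i x)) * cis (L x) \<partial>P)
       = (\<integral>x. of_real (\<Prod>i\<in>J. indicator (A i) (X i x)) * cis (L x) \<partial>Q)"
  using J A L
\<comment> \<open>The free factor \<open>cis (L x)\<close> carries the induction: adding the index
  \<open>j\<close> calls on the hypothesis for all combinations of \<open>X j\<close> and
  \<open>L\<close>.\<close>
proof (induction J arbitrary: L)
  case empty
  then show ?case using char by simp
next
  case (insert j J)
  interpret P: prob_space P by fact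
  interpret Q: prob_space Q by fact
  note [measurable_cong] = sets
  have [measurable]: "X i \<in> borel_measurable M" for i by (intro V X)
  have [measurable]: "L \<in> borel_measurable M" by (intro V insert)
  have A' [measurable]: "A i \<in> sets borel" if "i \<in> insert j J" for i using insert.prems that by auto
  define W where "W x = (\<Prod>i\<in>J. indicator (A i) (X i x) :: real)" for x
  have [measurable]: "W \<in> borel_measurable M"
    unfolding W_def[abs_def] using A' by (intro borel_measurable_prod) auto
  have W01: "0 \<le> W x" "W x \<le> 1" for x
    unfolding W_def by (auto intro!: prod_nonneg prod_le_1)
  have IH: "(\<integral>x. of_real (W x) * cis (K x) \<partial>P) = (\<integral>x. of_real (W x) * cis (K x) \<partial>Q)" if "K \<in> V" for K
    unfolding W_def using insert.prems that by (intro insert.IH) auto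
  have Vm: "(\<lambda>x. a * X j x + b * L x) \<in> V" for a b
    using V(2)[OF X[of j] V(2)[OF insert.prems(2) V(3), of b], of a] by simp
  \<comment> \<open>The real part is half a sum of two conjugate exponentials, so the integrand is a
    combination of terms covered by \<open>IH\<close>. The choices \<open>u = 1\<close> and
    \<open>u = - \<i>\<close> give the cosine and the sine.\<close>
  have weighted: "(\<integral>x. of_real (W x * (1 + Re (u * cis (b * L x)))) * cis (a * X j x) \<partial>P)
      = (\<integral>x. of_real (W x * (1 + Re (u * cis (b * L x)))) * cis (a * X j x) \<partial>Q)" for a b u
  proof -
    have e: "complex_of_real (W x * (1 + Re (u * cis (b * L x)))) * cis (a * X j x)
      = of_real (W x) * cis (a * X j x + 0 * L x) + (u / 2) * (of_real (W x) * cis (a * X j x + b * L x))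
        + (cnj u / 2) * (of_real (W x) * cis (a * X j x + (- b) * L x))" for x
    proof -
      have "complex_of_real (Re z) = (z + cnj z) / 2" for z by (simp add: complex_add_cnj)
      then have r: "complex_of_real (Re (u * cis (b * L x))) = (u * cis (b * L x) + cnj u * cis (- (b * L x))) / 2"
        by (simp only: complex_cnj_mult cis_cnj)
      show ?thesis
        by (simp only: of_real_mult of_real_add of_real_1 r cis_mult[symmetric] mult_minus_left)
          (simp add: field_simps)
    qed
    have I: "integrable P (\<lambda>x. of_real (W x) * cis (a * X j x + b * L x))"
      "integrable Q (\<lambda>x. of_real (W x) * cis (a * X j x + b * L x))" for a b
      using W01 by (auto intro!: P.integrable_weighted_cis[where C=1] Q.integrable_weighted_cis[where C=1])
    have lin: "(\<integral>x. F x + \<alpha> * G x + \<beta> * H x \<partial>R) = (\<integral>x. F x \<partial>R) + \<alpha> * (\<integral>x. G x \<partial>R) + \<beta> * (\<integral>x. H x \<partial>R)"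
      if "integrable R F" "integrable R G" "integrable R H"
      for R :: "'a measure" and F G H :: "'a \<Rightarrow> complex" and \<alpha> \<beta>
      using that by simp
    show ?thesis
      by (simp only: e lin[OF I(1) I(1) I(1)] lin[OF I(2) I(2) I(2)] IH[OF Vm])
  qed
  have ind: "(\<integral>x. W x * (1 + Re (u * cis (b * L x))) * indicator (A j) (X j x) \<partial>P)
     = (\<integral>x. W x * (1 + Re (u * cis (b * L x))) * indicator (A j) (X j x) \<partial>Q)" if u: "norm u = 1" for u b
  proof (rule weighted_char_unique[OF P Q sets, where C = 2])
    have "\<bar>Re (u * cis (b * L x))\<bar> \<le> 1" for x
      using abs_Re_le_cmod[of "u * cis (b * L x)"] u by (simp add: norm_mult)
    then have 1: "0 \<le> 1 + Re (u * cis (b * L x))" "1 + Re (u * cis (b * L x)) \<le> 2" for x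
      by (simp_all add: abs_le_iff) (smt (verit, best))+
    show "0 \<le> W x * (1 + Re (u * cis (b * L x)))" "W x * (1 + Re (u * cis (b * L x))) \<le> 2" for x
      using mult_nonneg_nonneg[OF W01(1) 1(1)] mult_mono[OF W01(2) 1(2) _ 1(1), of x] by auto
    show "A j \<in> sets borel" by simp
  qed (use weighted in auto)
  define U where "U x = W x * indicator (A j) (X j x)" for x
  have [measurable]: "U \<in> borel_measurable M" unfolding U_def[abs_def] by measurable
  have U01: "\<bar>U x\<bar> \<le> 1" for x
    unfolding U_def using W01[of x] by (auto simp: indicator_def)
  have IU: "integrable P U" "integrable Q U"
    using U01 by (auto intro!: P.integrable_const_bound[where B=1] Q.integrable_const_bound[where B=1])
  \<comment> \<open>At \<open>b = 0\<close> the weight is constant. This integral is subtracted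
    below, to isolate the cosine and sine from the 1 that kept the weights nonnegative.\<close>
  have U0: "(\<integral>x. U x \<partial>P) = (\<integral>x. U x \<partial>Q)"
  proof -
    have "W x * (1 + Re (1 * cis (0 * L x))) * indicator (A j) (X j x) = 2 * U x" for x
      by (simp add: U_def)
    then have "(\<integral>x. 2 * U x \<partial>P) = (\<integral>x. 2 * U x \<partial>Q)"
      using ind[of 1 0] by (simp only: norm_one simp_thms)
    then show ?thesis by simp
  qed
  have IUc: "integrable P (\<lambda>x. U x * Re (u * cis (L x)))" "integrable Q (\<lambda>x. U x * Re (u * cis (L x)))"
    if u: "norm u = 1" for u
  proof -
    have "\<bar>U x * Re (u * cis (L x))\<bar> \<le> 1" for x
      using mult_mono[OF U01 abs_Re_le_cmod[of "u * cis (L x)"], of x] u by (simp add: abs_mult norm_mult)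
    then show "integrable P (\<lambda>x. U x * Re (u * cis (L x)))" "integrable Q (\<lambda>x. U x * Re (u * cis (L x)))"
      by (auto intro!: P.integrable_const_bound[where B=1] Q.integrable_const_bound[where B=1])
  qed
  have UR: "(\<integral>x. U x * Re (u * cis (L x)) \<partial>P) = (\<integral>x. U x * Re (u * cis (L x)) \<partial>Q)" if u: "norm u = 1" for u
  proof -
    have "(\<integral>x. U x + U x * Re (u * cis (L x)) \<partial>P) = (\<integral>x. U x + U x * Re (u * cis (L x)) \<partial>Q)"
      using ind[OF u, of 1] by (simp add: U_def algebra_simps)
    then show ?thesis using U0 IU IUc[OF u] by simp
  qed
  have split: "(\<integral>x. of_real (U x) * cis (L x) \<partial>R) = of_real (\<integral>x. U x * Re (1 * cis (L x)) \<partial>R)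
      + \<i> * of_real (\<integral>x. U x * Re (- \<i> * cis (L x)) \<partial>R)"
    if "integrable R (\<lambda>x. U x * Re (1 * cis (L x)))" "integrable R (\<lambda>x. U x * Re (- \<i> * cis (L x)))" for R
  proof -
    have "of_real (U x) * cis (L x) = of_real (U x * Re (1 * cis (L x))) + \<i> * of_real (U x * Re (- \<i> * cis (L x)))" for x
      by (simp add: complex_eq_iff)
    then show ?thesis using that by (simp del: of_real_mult mult_1_left)
  qed
  have "(\<integral>x. of_real (U x) * cis (L x) \<partial>P) = (\<integral>x. of_real (U x) * cis (L x) \<partial>Q)"
    using UR[of 1] UR[of "- \<i>"] split[OF IUc(1)[of 1] IUc(1)[of "- \<i>"]] split[OF IUc(2)[of 1] IUc(2)[of "- \<i>"]]
    by simp
  moreover have "(\<Prod>i\<in>insert j J. indicator (A i) (X i x)) = U x" for x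
    using insert.hyps by (simp add: U_def W_def mult.commute)
  ultimately show ?case by simp
qed

text \<open>A law on the path space is determined by its values on cylinders over scalar
  coordinates, and those are controlled by characteristic functions of finite linear
  combinations.\<close>

lemma linear_law_unique:
  fixes P Q :: "(int ^ 'd \<Rightarrow> real ^ 'n) measure"
  assumes P: "field_law P" and Q: "field_law Q"
    and char: "\<And>T c. finite T \<Longrightarrow> (\<integral>z. cis (\<Sum>t\<in>T. c t \<bullet> z t) \<partial>P) = (\<integral>z. cis (\<Sum>t\<in>T. c t \<bullet> z t) \<partial>Q)"
  shows "P = Q"
proof -
  have prob: "prob_space P" "prob_space Q" and sets: "sets P = sets path_space" "sets Q = sets path_space"
    using P Q by (auto simp: field_law_def)
  interpret P: prob_space P by fact
  interpret Q: prob_space Q by fact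
  define coord :: "(int ^ 'd) \<times> 'n \<Rightarrow> (int ^ 'd \<Rightarrow> real ^ 'n) \<Rightarrow> real" where
    "coord p z = z (fst p) $ snd p" for p z
  define V :: "((int ^ 'd \<Rightarrow> real ^ 'n) \<Rightarrow> real) set" where
    "V = {L. \<exists>T c. finite T \<and> L = (\<lambda>z. \<Sum>t\<in>T. c t \<bullet> z t)}"
  have [measurable]: "(\<lambda>z. z t) \<in> borel_measurable (path_space :: (int ^ 'd \<Rightarrow> real ^ 'n) measure)" for t
    by (rule measurable_component_singleton) simp
  have V_meas: "L \<in> borel_measurable path_space" if "L \<in> V" for L
    using that by (auto simp: V_def)
  have V_lin: "(\<lambda>z. a * L z + K z) \<in> V" if "L \<in> V" "K \<in> V" for L K a
  proof -
    from that(1) obtain T c where T: "finite T" "L = (\<lambda>z. \<Sum>t\<in>T. c t \<bullet> z t)"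
      unfolding V_def by blast
    from that(2) obtain T' c' where T': "finite T'" "K = (\<lambda>z. \<Sum>t\<in>T'. c' t \<bullet> z t)"
      unfolding V_def by blast
    define e where "e t = (if t \<in> T then a *\<^sub>R c t else 0) + (if t \<in> T' then c' t else 0)" for t
    have "(\<Sum>t\<in>T \<union> T'. e t \<bullet> z t) = a * L z + K z" for z
    proof -
      have "(\<Sum>t\<in>T \<union> T'. e t \<bullet> z t) = (\<Sum>t\<in>T \<union> T'. (if t \<in> T then a * (c t \<bullet> z t) else 0))
          + (\<Sum>t\<in>T \<union> T'. (if t \<in> T' then c' t \<bullet> z t else 0))"
        unfolding sum.distrib[symmetric] by (intro sum.cong) (auto simp: e_def inner_add_left)
      also have "(\<Sum>t\<in>T \<union> T'. (if t \<in> T then a * (c t \<bullet> z t) else 0)) = (\<Sum>t\<in>T. a * (c t \<bullet> z t))"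
        using T T' by (intro sum.mono_neutral_cong_right) auto
      also have "(\<Sum>t\<in>T \<union> T'. (if t \<in> T' then c' t \<bullet> z t else 0)) = (\<Sum>t\<in>T'. c' t \<bullet> z t)"
        using T T' by (intro sum.mono_neutral_cong_right) auto
      finally show ?thesis by (simp add: T T' sum_distrib_left)
    qed
    then show ?thesis unfolding V_def using T T' by (intro CollectI exI[of _ "T \<union> T'"] exI[of _ e]) auto
  qed
  have V_zero: "(\<lambda>z. 0) \<in> V" unfolding V_def by (intro CollectI exI[of _ "{}"]) auto
  have V_coord: "coord p \<in> V" for p
    unfolding V_def coord_def[abs_def]
    by (intro CollectI exI[of _ "{fst p}"] exI[of _ "\<lambda>_. axis (snd p) 1"]) (auto simp: inner_axis inner_commute[of "axis _ _"])
  have V_char: "(\<integral>z. cis (L z) \<partial>P) = (\<integral>z. cis (L z) \<partial>Q)" if "L \<in> V" for L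
    using that char by (auto simp: V_def)
  \<comment> \<open>The product over sites of vector spaces is rewritten as a product of lines over
    pairs of site and component; \<open>\<phi>\<close> and \<open>\<psi>\<close> translate back and
    forth, and cylinders in \<open>B\<close> have scalar Borel sides.\<close>
  define B :: "((int ^ 'd) \<times> 'n \<Rightarrow> real) measure" where "B = PiM UNIV (\<lambda>_. borel)"
  define \<phi> :: "(int ^ 'd \<Rightarrow> real ^ 'n) \<Rightarrow> (int ^ 'd) \<times> 'n \<Rightarrow> real" where "\<phi> z p = coord p z" for z p
  define \<psi> :: "((int ^ 'd) \<times> 'n \<Rightarrow> real) \<Rightarrow> int ^ 'd \<Rightarrow> real ^ 'n" where "\<psi> y t = (\<chi> i. y (t, i))" for y t
  have \<phi>: "\<phi> \<in> measurable path_space B"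
    unfolding B_def by (rule measurable_PiM_single') (auto simp: \<phi>_def intro!: V_meas V_coord)
  have \<psi>: "\<psi> \<in> measurable B path_space"
  proof (rule measurable_PiM_single')
    fix t
    have "(\<lambda>y. y (t, i)) \<in> borel_measurable B" for i
      unfolding B_def by (rule measurable_component_singleton) simp
    then show "(\<lambda>y. \<psi> y t) \<in> borel_measurable B"
      by (intro borel_measurable_vec) (simp add: \<psi>_def)
  qed auto
  have \<phi>P: "\<phi> \<in> measurable P B" "\<phi> \<in> measurable Q B"
    using \<phi> sets by (auto cong: measurable_cong_sets)
  have "distr P B \<phi> = distr Q B \<phi>"
  proof (rule measure_eqI_PiM_infinite[where I = UNIV and M = "\<lambda>_. borel"])
    show "sets (distr P B \<phi>) = sets (PiM UNIV (\<lambda>_. borel))" "sets (distr Q B \<phi>) = sets (PiM UNIV (\<lambda>_. borel))"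
      by (auto simp: B_def)
    show "finite_measure (distr P B \<phi>)"
      using P.prob_space_distr[OF \<phi>P(1)] by (simp add: prob_space_def)
    fix A :: "(int ^ 'd) \<times> 'n \<Rightarrow> real set" and J
    assume J: "finite J" and A: "\<And>i. i \<in> J \<Longrightarrow> A i \<in> sets (borel :: real measure)"
    define E where "E = prod_emb UNIV (\<lambda>_. borel) J (Pi\<^sub>E J A)"
    have E: "E \<in> sets B" unfolding E_def B_def using J A by (intro sets_PiM_I) auto
    have in_E: "indicator E (\<phi> z) = (\<Prod>i\<in>J. indicator (A i) (coord i z) :: real)" for z
    proof -
      have "\<phi> z \<in> E \<longleftrightarrow> (\<forall>i\<in>J. coord i z \<in> A i)"
        by (auto simp: E_def prod_emb_def \<phi>_def PiE_iff extensional_def restrict_def space_PiM)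
      then show ?thesis
        using J by (auto simp: indicator_def prod_zero_iff)
    qed
    have meas: "emeasure (distr R B \<phi>) E = ennreal (\<integral>z. (\<Prod>i\<in>J. indicator (A i) (coord i z)) \<partial>R)"
      if R: "prob_space R" and m: "\<phi> \<in> measurable R B" for R
    proof -
      interpret D: prob_space "distr R B \<phi>" by (rule prob_space.prob_space_distr[OF R m])
      have "measure (distr R B \<phi>) E = (\<integral>y. indicator E y \<partial>distr R B \<phi>)"
        using E by simp
      also have "\<dots> = (\<integral>z. indicator E (\<phi> z) \<partial>R)"
        using E by (intro integral_distr m) auto
      finally show ?thesis by (simp add: D.emeasure_eq_measure in_E)
    qed
    \<comment> \<open>With the zero functional for \<open>L\<close> the exponential factor is 1, and
      what remains is the probability of the cylinder.\<close>
    have "(\<integral>z. of_real (\<Prod>i\<in>J. indicator (A i) (coord i z)) * cis 0 \<partial>P)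
        = (\<integral>z. of_real (\<Prod>i\<in>J. indicator (A i) (coord i z)) * cis 0 \<partial>Q)"
      by (rule char_unique_cylinder[OF prob sets V_meas V_lin V_zero V_coord V_char J A V_zero])
    then have "(\<integral>z. (\<Prod>i\<in>J. indicator (A i) (coord i z) :: real) \<partial>P) = (\<integral>z. (\<Prod>i\<in>J. indicator (A i) (coord i z)) \<partial>Q)"
      by (simp only: cis_zero mult_1_right integral_complex_of_real of_real_eq_iff)
    then show "emeasure (distr P B \<phi>) (prod_emb UNIV (\<lambda>_. borel) J (Pi\<^sub>E J A))
        = emeasure (distr Q B \<phi>) (prod_emb UNIV (\<lambda>_. borel) J (Pi\<^sub>E J A))"
      unfolding E_def[symmetric] by (simp only: meas prob \<phi>P)
  qed
  then have "distr (distr P B \<phi>) path_space \<psi> = distr (distr Q B \<phi>) path_space \<psi>" by simp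
  moreover have "distr (distr R B \<phi>) path_space \<psi> = R" if m: "\<phi> \<in> measurable R B" and s: "sets R = sets path_space" for R
  proof -
    have "\<psi> \<circ> \<phi> = (\<lambda>z. z)" by (simp add: \<psi>_def \<phi>_def coord_def fun_eq_iff vec_eq_iff)
    then show ?thesis
      by (simp only: distr_distr[OF \<psi> m] distr_id2[OF s[symmetric]])
  qed
  ultimately show ?thesis using \<phi>P sets by simp
qed

section \<open>Centred normal variables\<close>

lemma (in prob_space) normal_rv_integrable:
  assumes "normal_rv M X"
  shows "X \<in> borel_measurable M" "integrable M (\<lambda>\<omega>. (X \<omega>)\<^sup>2)"
proof -
  from assms obtain \<mu> where "(X \<in> borel_measurable M \<and> (AE \<omega> in M. X \<omega> = \<mu>)) \<or>
     (\<exists>\<sigma>>0. distributed M lborel X (\<lambda>x. ennreal (normal_density \<mu> \<sigma> x)))"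
    unfolding normal_rv_def by blast
  then have "X \<in> borel_measurable M \<and> integrable M (\<lambda>\<omega>. (X \<omega>)\<^sup>2)"
  proof (elim disjE conjE exE)
    assume [measurable]: "X \<in> borel_measurable M" and "AE \<omega> in M. X \<omega> = \<mu>"
    then have "integrable M (\<lambda>\<omega>. (X \<omega>)\<^sup>2)"
      by (intro integrable_const_bound[where B="\<mu>\<^sup>2"]) auto
    then show ?thesis by simp
  next
    fix \<sigma> :: real assume \<sigma>: "\<sigma> > 0" and D: "distributed M lborel X (\<lambda>x. ennreal (normal_density \<mu> \<sigma> x))"
    have [measurable]: "X \<in> borel_measurable M" using distributed_measurable[OF D] by simp
    have "integrable M (\<lambda>\<omega>. (X \<omega> - \<mu>) ^ k)" for k
      using integrable_normal_moment[OF \<sigma>, of \<mu> k] distributed_integrable[OF D, of "\<lambda>x. (x - \<mu>) ^ k"] by simp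
    from this[of 2] this[of 1] have "integrable M (\<lambda>\<omega>. (X \<omega> - \<mu>)\<^sup>2 + (2 * \<mu> * (X \<omega> - \<mu>) + \<mu>\<^sup>2))"
      by (intro Bochner_Integration.integrable_add integrable_mult_right) auto
    moreover have "(X \<omega> - \<mu>)\<^sup>2 + (2 * \<mu> * (X \<omega> - \<mu>) + \<mu>\<^sup>2) = (X \<omega>)\<^sup>2" for \<omega>
      by (simp add: power2_eq_square algebra_simps)
    ultimately show ?thesis by simp
  qed
  then show "X \<in> borel_measurable M" "integrable M (\<lambda>\<omega>. (X \<omega>)\<^sup>2)" by auto
qed

text \<open>The variance separates point masses from nondegenerate normals and determines the
  characteristic function at 1. The latter is left as an integral, since it is only ever compared
  between two variables of equal variance.\<close>

lemma (in prob_space) centered_normal_rv_cases: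
  assumes X: "normal_rv M X" and mean: "expectation X = 0"
  obtains "expectation (\<lambda>\<omega>. (X \<omega>)\<^sup>2) = 0" "expectation (\<lambda>\<omega>. cis (X \<omega>)) = 1"
  | "expectation (\<lambda>\<omega>. (X \<omega>)\<^sup>2) > 0"
    "expectation (\<lambda>\<omega>. cis (X \<omega>)) = (\<integral>x. normal_density 0 (sqrt (expectation (\<lambda>\<omega>. (X \<omega>)\<^sup>2))) x *\<^sub>R cis x \<partial>lborel)"
proof -
  note [measurable] = normal_rv_integrable(1)[OF X]
  from X obtain \<mu> where "(AE \<omega> in M. X \<omega> = \<mu>) \<or>
     (\<exists>\<sigma>>0. distributed M lborel X (\<lambda>x. ennreal (normal_density \<mu> \<sigma> x)))"
    unfolding normal_rv_def by blast
  then show thesis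
  proof (elim disjE conjE exE)
    assume ae: "AE \<omega> in M. X \<omega> = \<mu>"
    have "expectation X = expectation (\<lambda>_. \<mu>)" by (rule integral_cong_AE) (use ae in auto)
    then have "\<mu> = 0" using mean prob_space by simp
    with ae have ae0: "AE \<omega> in M. X \<omega> = 0" by simp
    have "expectation (\<lambda>\<omega>. (X \<omega>)\<^sup>2) = expectation (\<lambda>_. 0)"
      by (rule integral_cong_AE) (use ae0 in auto)
    moreover have "expectation (\<lambda>\<omega>. cis (X \<omega>)) = expectation (\<lambda>_. 1)"
      by (rule integral_cong_AE) (use ae0 in auto)
    ultimately show thesis using prob_space by (intro that(1)) auto
  next
    fix \<sigma> :: real assume \<sigma>: "\<sigma> > 0" and D: "distributed M lborel X (\<lambda>x. ennreal (normal_density \<mu> \<sigma> x))"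
    have \<mu>: "\<mu> = 0" using normal_distributed_expectation[OF \<sigma> D] mean by simp
    have var: "expectation (\<lambda>\<omega>. (X \<omega>)\<^sup>2) = \<sigma>\<^sup>2"
      using normal_distributed_variance[OF \<sigma> D] mean by simp
    have "expectation (\<lambda>\<omega>. cis (X \<omega>)) = (\<integral>x. cis x \<partial>distr M lborel X)"
      by (subst integral_distr) auto
    also have "\<dots> = (\<integral>x. cis x \<partial>density lborel (\<lambda>x. ennreal (normal_density \<mu> \<sigma> x)))"
      by (simp add: distributed_distr_eq_density[OF D])
    also have "\<dots> = (\<integral>x. normal_density \<mu> \<sigma> x *\<^sub>R cis x \<partial>lborel)"
      by (subst integral_density) auto
    finally show thesis using \<mu> var \<sigma> by (intro that(2)) auto
  qed
qed

lemma centered_normal_rv_char_eq: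
  assumes P: "prob_space P" and Q: "prob_space Q" and "normal_rv P X" "normal_rv Q Y"
    and "(\<integral>x. X x \<partial>P) = 0" "(\<integral>x. Y x \<partial>Q) = 0"
    and var: "(\<integral>x. (X x)\<^sup>2 \<partial>P) = (\<integral>x. (Y x)\<^sup>2 \<partial>Q)"
  shows "(\<integral>x. cis (X x) \<partial>P) = (\<integral>x. cis (Y x) \<partial>Q)"
  by (rule prob_space.centered_normal_rv_cases[OF P assms(3,5)];
      rule prob_space.centered_normal_rv_cases[OF Q assms(4,6)]) (use var in auto)

section \<open>Gaussian periodic laws\<close>

lemma (in prob_space) normal_rv_distr:
  assumes F: "F \<in> measurable M M'" and X: "X \<in> borel_measurable M'"
    and n: "normal_rv M (\<lambda>\<omega>. X (F \<omega>))"
  shows "normal_rv (distr M M' F) X"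
proof -
  from n obtain \<mu> where "(AE \<omega> in M. X (F \<omega>) = \<mu>) \<or>
     (\<exists>\<sigma>>0. distributed M lborel (\<lambda>\<omega>. X (F \<omega>)) (\<lambda>x. ennreal (normal_density \<mu> \<sigma> x)))"
    unfolding normal_rv_def by blast
  then show ?thesis
  proof (elim disjE exE conjE)
    assume ae: "AE \<omega> in M. X (F \<omega>) = \<mu>"
    have "{x \<in> space M'. X x = \<mu>} \<in> sets M'" using X by measurable
    then have "AE \<omega> in distr M M' F. X \<omega> = \<mu>" using ae by (subst AE_distr_iff[OF F]) auto
    then show ?thesis using X unfolding normal_rv_def by auto
  next
    fix \<sigma> :: real
    assume \<sigma>: "\<sigma> > 0" and D: "distributed M lborel (\<lambda>\<omega>. X (F \<omega>)) (\<lambda>x. ennreal (normal_density \<mu> \<sigma> x))"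
    have "distr (distr M M' F) lborel X = distr M lborel (\<lambda>\<omega>. X (F \<omega>))"
      using X F by (subst distr_distr) (auto simp: comp_def)
    then have "distributed (distr M M' F) lborel X (\<lambda>x. ennreal (normal_density \<mu> \<sigma> x))"
      using D X by (simp add: distributed_def)
    then show ?thesis using \<sigma> unfolding normal_rv_def by auto
  qed
qed

lemma measurable_path_coord [measurable]: "(\<lambda>z. z t) \<in> borel_measurable (path_space :: (int ^ 'd \<Rightarrow> real ^ 'n) measure)"
  by (rule measurable_component_singleton) simp

lemma measurable_path_shift: "(\<lambda>z t. z (t + s)) \<in> measurable path_space (path_space :: (int ^ 'd \<Rightarrow> real ^ 'n) measure)"
  by (rule measurable_PiM_single') auto

locale gp_law = torus N + prob_space P for N :: "nat ^ 'd" and P :: "(int ^ 'd \<Rightarrow> real ^ 'n) measure" +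
  assumes gp: "gaussian_periodic_law N P"
begin

lemma sets_P [measurable_cong]: "sets P = sets path_space"
  using gp by (simp add: gaussian_periodic_law_def field_law_def)

lemma gaussian: "finite T \<Longrightarrow> normal_rv P (\<lambda>z. \<Sum>t\<in>T. c t \<bullet> z t)"
  using gp by (simp add: gaussian_periodic_law_def gaussian_law_def)

lemma coord_integrable: "integrable P (\<lambda>z. z t)" and coord_mean: "(\<integral>z. z t \<partial>P) = 0"
  using gp by (auto simp: gaussian_periodic_law_def zero_mean_law_def)

text \<open>Countably many sites and finitely many axes: the exceptional null sets merge into one,
  and from here on periodicity is available path by path.\<close>

lemma AE_periodic: "AE z in P. periodic_seq N z"
  using gp unfolding gaussian_periodic_law_def periodic_law_def periodic_seq_def
  by (simp add: AE_all_countable AE_finite_all)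

lemma coord_mult_integrable: "integrable P (\<lambda>z. z t $ i * z s $ j)"
proof -
  have sq: "integrable P (\<lambda>z. (z t $ i)\<^sup>2)" for t i
    using normal_rv_integrable(2)[OF gaussian[of "{t}" "\<lambda>_. axis i 1"]]
    by (simp add: inner_axis' )
  show ?thesis
  proof (rule Bochner_Integration.integrable_bound)
    show "integrable P (\<lambda>z. (z t $ i)\<^sup>2 + (z s $ j)\<^sup>2)" using sq by simp
    show "AE z in P. norm (z t $ i * z s $ j) \<le> norm ((z t $ i)\<^sup>2 + (z s $ j)\<^sup>2)"
    proof (rule AE_I2)
      fix z :: "int ^ 'd \<Rightarrow> real ^ 'n"
      have "0 \<le> (\<bar>z t $ i\<bar> - \<bar>z s $ j\<bar>)\<^sup>2" by simp
      then have "2 * (\<bar>z t $ i\<bar> * \<bar>z s $ j\<bar>) \<le> (z t $ i)\<^sup>2 + (z s $ j)\<^sup>2"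
        by (simp add: power2_diff)
      moreover have "0 \<le> \<bar>z t $ i\<bar> * \<bar>z s $ j\<bar>" by simp
      ultimately show "norm (z t $ i * z s $ j) \<le> norm ((z t $ i)\<^sup>2 + (z s $ j)\<^sup>2)"
        unfolding real_norm_def abs_mult by linarith
    qed
  qed (auto intro!: borel_measurable_times measurable_coord simp: measurable_cong_sets[OF sets_P refl])
qed

lemma covariance: "(\<integral>z. z t $ i * z s $ j \<partial>P) = cov_field P (t - s) $ i $ j"
proof -
  have "cov_at P s (t - s) = cov_at P 0 (t - s)"
    using gp by (intro cov_at_shift) (auto simp: gaussian_periodic_law_def)
  then have "cov_at P s (t - s) $ i $ j = cov_field P (t - s) $ i $ j" by (simp add: cov_field_def)
  then show ?thesis by (simp add: cov_at_def)
qed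

lemma linear_mean: "finite T \<Longrightarrow> (\<integral>z. (\<Sum>t\<in>T. c t \<bullet> z t) \<partial>P) = 0"
  using coord_integrable coord_mean by (simp add: integral_inner_right)

lemma linear_variance:
  assumes "finite T"
  shows "(\<integral>z. (\<Sum>t\<in>T. c t \<bullet> z t)\<^sup>2 \<partial>P) =
    (\<Sum>t\<in>T. \<Sum>s\<in>T. \<Sum>i\<in>UNIV. \<Sum>j\<in>UNIV. c t $ i * c s $ j * cov_field P (t - s) $ i $ j)"
proof -
  have "(\<Sum>t\<in>T. c t \<bullet> z t)\<^sup>2 = (\<Sum>t\<in>T. \<Sum>s\<in>T. \<Sum>i\<in>UNIV. \<Sum>j\<in>UNIV. c t $ i * c s $ j * (z t $ i * z s $ j))"
    for z :: "int ^ 'd \<Rightarrow> real ^ 'n"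
    by (simp add: power2_eq_square sum_product inner_vec_def mult_ac)
  then show ?thesis
    using coord_mult_integrable by (simp add: covariance)
qed

lemma periodic_cov: "periodic_seq N (cov_field P)"
proof -
  have "cov_field P (t + axis l (int (N $ l))) $ i $ j = cov_field P t $ i $ j" for t l i j
  proof -
    have "(\<integral>z. z (t + axis l (int (N $ l))) $ i * z 0 $ j \<partial>P) = (\<integral>z. z t $ i * z 0 $ j \<partial>P)"
      by (rule integral_cong_AE)
        (use AE_periodic in \<open>auto intro!: borel_measurable_times measurable_coord
          simp: measurable_cong_sets[OF sets_P refl] periodic_seq_def elim!: eventually_mono\<close>)
    then show ?thesis by (simp add: cov_field_def cov_at_def)
  qed
  then show ?thesis by (simp add: periodic_seq_def vec_eq_iff)
qed

text \<open>For fixed \<open>s\<close> the sum over \<open>t\<close> runs over a full period of a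
  function of \<open>t - s\<close>, hence equals the spectral density whatever \<open>s\<close> is;
  summing over \<open>s\<close> gives the factor \<open>card (box_N N)\<close>.\<close>

lemma dft_second_moment:
  "integrable P (\<lambda>z. dft z l $ j * cnj (dft z l $ i))"
  "(\<integral>z. dft z l $ j * cnj (dft z l $ i) \<partial>P) = of_nat (card (box_N N)) * psd_density N P (zeta N l) $ j $ i"
proof -
  have e: "dft z l $ j * cnj (dft z l $ i) = (\<Sum>t\<in>box_N N. \<Sum>s\<in>box_N N.
      mpow (zeta N l) (- (t - s)) * of_real (z t $ j * z s $ i))" for z :: "int ^ 'd \<Rightarrow> real ^ 'n"
    unfolding dft_def vec_lambda_beta cnj_sum sum_product
    by (intro sum.cong refl) (simp add: mpow_zeta_minus mpow_zeta_diff del: minus_diff_eq)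
  have int: "integrable P (\<lambda>z. complex_of_real (z t $ j * z s $ i))" for t s
    by (intro integrable_of_real coord_mult_integrable)
  show "integrable P (\<lambda>z. dft z l $ j * cnj (dft z l $ i))"
    unfolding e by (intro Bochner_Integration.integrable_sum integrable_mult_right int)
  have "(\<integral>z. dft z l $ j * cnj (dft z l $ i) \<partial>P) = (\<Sum>t\<in>box_N N. \<Sum>s\<in>box_N N.
      mpow (zeta N l) (- (t - s)) * (\<integral>z. complex_of_real (z t $ j * z s $ i) \<partial>P))"
    unfolding e using int
    by (simp only: Bochner_Integration.integral_sum Bochner_Integration.integrable_sum integrable_mult_right
        integral_mult_right_zero)
  also have "\<dots> = (\<Sum>t\<in>box_N N. \<Sum>s\<in>box_N N.
      of_real (cov_field P (t - s) $ j $ i) * mpow (zeta N l) (- (t - s)))"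
    by (simp only: integral_complex_of_real covariance mult.commute)
  also have "\<dots> = (\<Sum>s\<in>box_N N. \<Sum>t\<in>box_N N.
      of_real (cov_field P (t - s) $ j $ i) * mpow (zeta N l) (- (t - s)))"
    by (rule sum.swap)
  also have "\<dots> = (\<Sum>s\<in>box_N N. psd_density N P (zeta N l) $ j $ i)"
  proof (rule sum.cong[OF refl])
    fix s
    have "periodic_seq N (\<lambda>t. cov_field P t $ j $ i)" using periodic_cov by (simp add: periodic_seq_def)
    from sum_box_shift[OF periodic_transform_summand[OF this, of l], of "- s"]
    show "(\<Sum>t\<in>box_N N. of_real (cov_field P (t - s) $ j $ i) * mpow (zeta N l) (- (t - s)))
        = psd_density N P (zeta N l) $ j $ i"
      by (simp add: psd_density_def transform_def)
  qed
  finally show "(\<integral>z. dft z l $ j * cnj (dft z l $ i) \<partial>P) = of_nat (card (box_N N)) * psd_density N P (zeta N l) $ j $ i"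
    by simp
qed

lemma quad_form_dft:
  "integrable P (\<lambda>z. Re (quad_form A (dft z l)))"
  "(\<integral>z. Re (quad_form A (dft z l)) \<partial>P) = card (box_N N) * Re (trace (A ** psd_density N P (zeta N l)))"
proof -
  have e: "quad_form A (dft z l) = (\<Sum>i\<in>UNIV. \<Sum>j\<in>UNIV. A $ i $ j * (dft z l $ j * cnj (dft z l $ i)))" for z
    by (simp add: quad_form_def matrix_vector_mult_def sum_distrib_left mult_ac)
  have int: "integrable P (\<lambda>z. quad_form A (dft z l))"
    unfolding e by (intro Bochner_Integration.integrable_sum integrable_mult_right dft_second_moment)
  then show "integrable P (\<lambda>z. Re (quad_form A (dft z l)))" by (rule integrable_Re)
  have "(\<integral>z. quad_form A (dft z l) \<partial>P) = (\<Sum>i\<in>UNIV. \<Sum>j\<in>UNIV. A $ i $ j * (\<integral>z. dft z l $ j * cnj (dft z l $ i) \<partial>P))"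
    unfolding e
    by (simp only: Bochner_Integration.integral_sum Bochner_Integration.integrable_sum integrable_mult_right
        integral_mult_right_zero dft_second_moment(1))
  also have "\<dots> = of_nat (card (box_N N)) * trace (A ** psd_density N P (zeta N l))"
    by (simp add: dft_second_moment(2) trace_def matrix_matrix_mult_def sum_distrib_left mult_ac)
  finally show "(\<integral>z. Re (quad_form A (dft z l)) \<partial>P) = card (box_N N) * Re (trace (A ** psd_density N P (zeta N l)))"
    using int by simp
qed

text \<open>One factor \<open>card (box_N N)\<close> comes from averaging over sites, which
  stationarity allows, and the other from Parseval.\<close>

lemma norm_sq_dft:
  "(\<integral>z. (norm (z t))\<^sup>2 \<partial>P) = (\<Sum>l\<in>box_N N. \<integral>z. (norm (dft z l))\<^sup>2 \<partial>P) / (card (box_N N))\<^sup>2"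
proof -
  have n: "(norm u)\<^sup>2 = (\<Sum>i\<in>UNIV. u $ i * u $ i)" for u :: "real ^ 'n"
    by (simp add: power2_norm_eq_inner inner_vec_def)
  have int: "integrable P (\<lambda>z. (norm (z t))\<^sup>2)" for t
    unfolding n by (intro Bochner_Integration.integrable_sum coord_mult_integrable)
  have const: "(\<integral>z. (norm (z s))\<^sup>2 \<partial>P) = (\<integral>z. (norm (z t))\<^sup>2 \<partial>P)" for s
    unfolding n using coord_mult_integrable by (simp add: covariance)
  have qf: "(norm v)\<^sup>2 = Re (quad_form (mat 1) v)" for v :: "complex ^ 'n"
    by (simp add: quad_form_cip cip_self)
  have int': "integrable P (\<lambda>z. (norm (dft z l))\<^sup>2)" for l
    unfolding qf by (rule quad_form_dft)
  have "card (box_N N) * (card (box_N N) * (\<integral>z. (norm (z t))\<^sup>2 \<partial>P))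
      = card (box_N N) * (\<Sum>s\<in>box_N N. \<integral>z. (norm (z s))\<^sup>2 \<partial>P)"
    by (subst sum.cong[OF refl const]) simp_all
  also have "\<dots> = (\<integral>z. card (box_N N) * (\<Sum>s\<in>box_N N. (norm (z s))\<^sup>2) \<partial>P)"
    using int by simp
  also have "\<dots> = (\<Sum>l\<in>box_N N. \<integral>z. (norm (dft z l))\<^sup>2 \<partial>P)"
    using int' by (simp add: parseval)
  finally show ?thesis using card_pos by (simp add: field_simps power2_eq_square)
qed

text \<open>Finite sums keep linear functionals of \<open>F z\<close> among those of
  \<open>z\<close>, hence normal. Compatibility with shifts is asked on periodic paths only, because
  a circular convolution sums over a fixed box and commutes with shifts only there; almost every
  path is periodic.\<close>

lemma gp_pushforward:
  fixes F :: "(int ^ 'd \<Rightarrow> real ^ 'n) \<Rightarrow> int ^ 'd \<Rightarrow> real ^ 'k"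
  assumes lin: "\<And>z t. F z t = (\<Sum>s\<in>S t. K t s *v z s)" and fin: "\<And>t. finite (S t)"
    and shift: "\<And>z s. periodic_seq N z \<Longrightarrow> F (\<lambda>t. z (t + s)) = (\<lambda>t. F z (t + s))"
  shows "F \<in> measurable P path_space" "gp_law N (distr P path_space F)"
proof -
  have Fm: "F \<in> measurable path_space path_space"
  proof (rule measurable_PiM_single')
    have "(\<lambda>z. K t s *v z s) \<in> borel_measurable path_space" for t s
      by (rule measurable_compose[OF measurable_path_coord])
        (intro borel_measurable_continuous_onI linear_continuous_on matrix_vector_mul_bounded_linear)
    then show "(\<lambda>z. F z t) \<in> borel_measurable path_space" for t
      unfolding lin by (intro borel_measurable_sum)
  qed auto
  then show FP [measurable]: "F \<in> measurable P path_space" by (simp cong: measurable_cong_sets add: sets_P)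
  let ?Q = "distr P path_space F"
  have prob: "prob_space ?Q" by (rule prob_space_distr[OF FP])
  have "field_law ?Q" using prob by (simp add: field_law_def)
  moreover have "gaussian_law ?Q"
    unfolding gaussian_law_def
  proof (intro allI impI normal_rv_distr[OF FP])
    fix T :: "(int ^ 'd) set" and c :: "int ^ 'd \<Rightarrow> real ^ 'k" assume T: "finite T"
    show "(\<lambda>z. \<Sum>t\<in>T. c t \<bullet> z t) \<in> borel_measurable path_space" by measurable
    define U where "U = (\<Union>t\<in>T. S t)"
    \<comment> \<open>The coefficients of all output sites, collected by input site; the case split
      is due to the supports \<open>S t\<close> differing with \<open>t\<close>.\<close>
    define e where "e s = (\<Sum>t\<in>T. if s \<in> S t then c t v* K t s else 0)" for s
    have "(\<Sum>t\<in>T. c t \<bullet> F z t) = (\<Sum>s\<in>U. e s \<bullet> z s)" for z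
    proof -
      have "(\<Sum>t\<in>T. c t \<bullet> F z t) = (\<Sum>t\<in>T. \<Sum>s\<in>S t. (c t v* K t s) \<bullet> z s)"
        by (simp add: lin inner_sum_right dot_lmul_matrix)
      also have "\<dots> = (\<Sum>t\<in>T. \<Sum>s\<in>U. (if s \<in> S t then c t v* K t s else 0) \<bullet> z s)"
        using T fin by (intro sum.cong refl sum.mono_neutral_cong_left) (auto simp: U_def)
      also have "\<dots> = (\<Sum>s\<in>U. \<Sum>t\<in>T. (if s \<in> S t then c t v* K t s else 0) \<bullet> z s)"
        by (rule sum.swap)
      finally show ?thesis by (simp add: e_def inner_sum_left)
    qed
    moreover have "finite U" using T fin by (simp add: U_def)
    ultimately show "normal_rv P (\<lambda>z. \<Sum>t\<in>T. c t \<bullet> F z t)" by (simp add: gaussian)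
  qed
  moreover have "zero_mean_law ?Q"
  proof -
    have K: "integrable P (\<lambda>z. K t s *v z s) \<and> (\<integral>z. K t s *v z s \<partial>P) = 0" for t s
      using integrable_bounded_linear[OF matrix_vector_mul_bounded_linear coord_integrable, of "K t s" s]
        integral_bounded_linear[OF matrix_vector_mul_bounded_linear coord_integrable, of "K t s" s]
      by (simp add: coord_mean)
    then have "integrable P (\<lambda>z. F z t)" "(\<integral>z. F z t \<partial>P) = 0" for t
      unfolding lin by auto
    then show ?thesis
      unfolding zero_mean_law_def by (auto simp: integrable_distr_eq integral_distr)
  qed
  moreover have "stationary_law ?Q"
    unfolding stationary_law_def
  proof
    fix s
    have sm: "(\<lambda>z t. z (t + s)) \<in> measurable P path_space"
      by (subst measurable_cong_sets[OF sets_P refl]) (rule measurable_path_shift)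
    have "distr ?Q path_space (\<lambda>z t. z (t + s)) = distr P path_space (\<lambda>z t. F z (t + s))"
      by (subst distr_distr[OF measurable_path_shift FP]) (simp add: comp_def)
    also have "\<dots> = distr P path_space (\<lambda>z. F (\<lambda>t. z (t + s)))"
    proof (rule distr_cong_AE)
      show "AE z in P. (\<lambda>t. F z (t + s)) = F (\<lambda>t. z (t + s))"
        using AE_periodic by eventually_elim (simp add: shift)
      show "(\<lambda>z. F (\<lambda>t. z (t + s))) \<in> measurable P path_space"
        by (rule measurable_compose[OF sm Fm])
      show "(\<lambda>z t. F z (t + s)) \<in> measurable P path_space"
        by (rule measurable_compose[OF FP measurable_path_shift])
    qed auto
    also have "\<dots> = distr (distr P path_space (\<lambda>z t. z (t + s))) path_space F"
      by (subst distr_distr[OF Fm sm]) (simp add: comp_def)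
    also have "\<dots> = ?Q"
      using gp by (simp add: gaussian_periodic_law_def stationary_law_def)
    finally show "distr ?Q path_space (\<lambda>z t. z (t + s)) = ?Q" .
  qed
  moreover have "periodic_law N ?Q"
    unfolding periodic_law_def
  proof (intro allI)
    fix t l
    have "{z \<in> space path_space. z (t + axis l (int (N $ l))) = z t} \<in> sets (path_space :: (int ^ 'd \<Rightarrow> real ^ 'k) measure)"
      by measurable
    moreover have "AE z in P. F z (t + axis l (int (N $ l))) = F z t"
      using AE_periodic
    proof eventually_elim
      fix z :: "int ^ 'd \<Rightarrow> real ^ 'n" assume z: "periodic_seq N z"
      \<comment> \<open>A periodic path is fixed by the shift through one period, so
        \<open>shift\<close> at this vector is periodicity of \<open>F z\<close>.\<close>
      then have "(\<lambda>t. z (t + axis l (int (N $ l)))) = z" by (simp add: periodic_seq_def)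
      then show "F z (t + axis l (int (N $ l))) = F z t"
        using fun_cong[OF shift[OF z, of "axis l (int (N $ l))"], of t] by simp
    qed
    ultimately show "AE z in ?Q. z (t + axis l (int (N $ l))) = z t"
      by (subst AE_distr_iff[OF FP])
  qed
  ultimately have "gaussian_periodic_law N ?Q" by (simp add: gaussian_periodic_law_def)
  with prob show "gp_law N ?Q" by (intro gp_law.intro gp_law_axioms.intro torus_axioms)
qed

end

section \<open>Laws determined by covariance or spectral density\<close>

lemma gp_law_unique:
  assumes P: "gp_law N P" and Q: "gp_law N Q" and cov: "cov_field P = cov_field Q"
  shows "P = Q"
proof -
  interpret P: gp_law N P by fact
  interpret Q: gp_law N Q by fact
  show ?thesis
  proof (rule linear_law_unique)
    show "field_law P" "field_law Q" using P.gp Q.gp by (auto simp: gaussian_periodic_law_def)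
    fix T :: "(int ^ 'a) set" and c :: "int ^ 'a \<Rightarrow> real ^ 'b" assume T: "finite T"
    show "(\<integral>z. cis (\<Sum>t\<in>T. c t \<bullet> z t) \<partial>P) = (\<integral>z. cis (\<Sum>t\<in>T. c t \<bullet> z t) \<partial>Q)"
      by (rule centered_normal_rv_char_eq)
        (simp_all add: P.prob_space_axioms Q.prob_space_axioms P.gaussian Q.gaussian T
          P.linear_mean Q.linear_mean P.linear_variance Q.linear_variance cov)
  qed
qed

lemma gp_law_unique_density:
  assumes P: "gp_law N P" and Q: "gp_law N Q"
    and dens: "\<And>l. l \<in> box_N N \<Longrightarrow> psd_density N P (zeta N l) = psd_density N Q (zeta N l)"
  shows "P = Q"
proof -
  interpret P: gp_law N P by fact
  interpret Q: gp_law N Q by fact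
  have "cov_field P = cov_field Q"
    using dens by (intro P.transform_inject P.periodic_cov Q.periodic_cov) (simp add: psd_density_def)
  with P Q show ?thesis by (rule gp_law_unique)
qed

section \<open>The optimal cost\<close>

lemma matrix_diff_ldistrib: "A ** (B - C) = A ** B - A ** (C :: complex ^ 'n ^ 'm)"
  by (simp add: matrix_matrix_mult_def vec_eq_iff algebra_simps sum_subtractf)

lemma matrix_diff_rdistrib: "(B - C) ** A = B ** A - C ** (A :: complex ^ 'n ^ 'm)"
  by (simp add: matrix_matrix_mult_def vec_eq_iff algebra_simps sum_subtractf)

lemma matrix_add_rdistrib: "(B + C) ** A = B ** A + C ** (A :: complex ^ 'n ^ 'm)"
  by (simp add: matrix_matrix_mult_def vec_eq_iff algebra_simps sum.distrib)

lemma scaleR_matrix_mult: "(r *\<^sub>R A) ** B = r *\<^sub>R (A ** (B :: complex ^ 'n ^ 'm))"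
  "A ** (r *\<^sub>R B) = r *\<^sub>R (A ** B)"
  by (simp_all add: matrix_matrix_mult_def vec_eq_iff scaleR_sum_right)

lemma trace_sum: "trace (\<Sum>a\<in>S. f a) = (\<Sum>a\<in>S. trace (f a :: complex ^ 'n ^ 'n))"
  by (induction S rule: infinite_finite_induct) (auto simp: trace_add trace_def[of 0])

lemma norm_sq_quad_form: "(norm (C *v v))\<^sup>2 = Re (quad_form (adjoint_mat C ** C) v)"
  by (simp add: quad_form_cip matrix_vector_mul_assoc[symmetric] cip_adjoint'[symmetric] cip_self)

lemma quad_form_pullback: "quad_form A (C *v v) = quad_form (adjoint_mat C ** A ** C) v"
  using quad_form_congruence[of "adjoint_mat C" A v] by simp

text \<open>Taking the adjoint of \<open>X - Y\<close> for \<open>A\<close> turns the trace of the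
  difference into its squared Frobenius norm. Real parts of traces are all that expectations of
  quadratic forms deliver.\<close>

lemma matrix_eq_by_trace:
  fixes X Y :: "complex ^ 'n ^ 'n"
  assumes "\<And>A. Re (trace (A ** X)) = Re (trace (A ** Y))"
  shows "X = Y"
proof -
  have "(norm (X - Y))\<^sup>2 = 0"
    unfolding norm_matrix_sq using assms[of "adjoint_mat (X - Y)"]
    by (simp add: matrix_diff_ldistrib trace_sub)
  then show ?thesis by simp
qed

lemma Im_trace_product_hermitian:
  assumes "adjoint_mat A = A" "adjoint_mat B = B"
  shows "Im (trace (A ** B)) = 0"
proof -
  have "cnj (trace (A ** B)) = trace (A ** B)"
    using trace_adjoint[of "A ** B"] trace_mult_commute[of A B] by (simp add: adjoint_mult assms)
  then show ?thesis by (simp add: complex_eq_iff)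
qed

lemma scaleR_matvec: "(r *\<^sub>R A) *v v = complex_of_real r *s (A *v v)"
  by (simp add: vec_eq_iff matrix_vector_mult_def) (simp add: scaleR_conv_of_real sum_distrib_left mult_ac)

text \<open>This is the expected cost of the coupling \<open>y = G x\<close>, for which
  \<open>x - y = (1 - G) x\<close>. The covariance condition converts the term quadratic in
  \<open>G\<close>, and the two mixed traces are conjugate to each other.\<close>

lemma linear_coupling_trace:
  fixes W X Y G :: "complex ^ 'n ^ 'n"
  assumes W: "adjoint_mat W = W" and X: "adjoint_mat X = X" and G: "G ** X ** adjoint_mat G = Y"
  shows "Re (trace (adjoint_mat (mat 1 - G) ** W ** (mat 1 - G) ** X))
    = Re (trace (W ** X)) + Re (trace (W ** Y)) - 2 * Re (trace (adjoint_mat G ** W ** X))"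
proof -
  have "trace (adjoint_mat G ** W ** G ** X) = trace (adjoint_mat G ** (W ** G ** X))"
    by (simp add: matrix_mul_assoc)
  also have "\<dots> = trace (W ** (G ** X ** adjoint_mat G))"
    by (subst trace_mult_commute) (simp add: matrix_mul_assoc)
  finally have 1: "trace (adjoint_mat G ** W ** G ** X) = trace (W ** Y)" by (simp only: G)
  have "cnj (trace (W ** G ** X)) = trace (X ** (adjoint_mat G ** W))"
    by (simp add: trace_adjoint[symmetric] adjoint_mult W X)
  also have "\<dots> = trace (adjoint_mat G ** W ** X)" by (subst trace_mult_commute) simp
  finally have "Re (cnj (trace (W ** G ** X))) = Re (trace (adjoint_mat G ** W ** X))" by (simp only:)
  then have 2: "Re (trace (W ** G ** X)) = Re (trace (adjoint_mat G ** W ** X))" by simp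
  have "adjoint_mat (mat 1 - G) ** W ** (mat 1 - G) ** X
      = W ** X - W ** G ** X - (adjoint_mat G ** W ** X - adjoint_mat G ** W ** G ** X)"
    by (simp add: adjoint_diff matrix_diff_ldistrib matrix_diff_rdistrib)
  then show ?thesis by (simp add: trace_sub 1 2)
qed

text \<open>The cost for the identity weight is nonnegative. In \<open>INF_cost\<close> this bounds
  the error of perturbing the weight, uniformly in the filter.\<close>

lemma linear_coupling_trace_bound:
  fixes X Y G :: "complex ^ 'n ^ 'n"
  assumes X: "psd_mat X" and G: "G ** X ** adjoint_mat G = Y"
  shows "2 * Re (trace (adjoint_mat G ** X)) \<le> Re (trace X) + Re (trace Y)"
  using linear_coupling_trace[OF adjoint_one psd_hermitian[OF X] G]
    Re_trace_psd_mult_nonneg[OF X, of "mat 1 - G"]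
  by (simp only: matrix_mul_lid matrix_mul_rid)

lemma gp_lawI:
  assumes "\<And>i. 0 < N $ i" "gaussian_periodic_law N P"
  shows "gp_law N P"
  using assms by (intro gp_law.intro gp_law_axioms.intro torus.intro)
    (auto simp: gaussian_periodic_law_def field_law_def)

section \<open>Frequency form of the cost, both bounds and the infimum\<close>

context torus
begin

lemma measurable_quad_form_dft:
  "(\<lambda>z. Re (quad_form A (dft z l))) \<in> borel_measurable (path_space :: (int ^ 'd \<Rightarrow> real ^ 'n) measure)"
proof -
  note [measurable] = measurable_coord
  have m: "(\<lambda>z. dft z l $ i) \<in> borel_measurable (path_space :: (int ^ 'd \<Rightarrow> real ^ 'n) measure)" for i
    unfolding dft_def vec_lambda_beta by measurable
  have "(\<lambda>z. cnj (dft z l $ i)) \<in> borel_measurable (path_space :: (int ^ 'd \<Rightarrow> real ^ 'n) measure)" for i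
    by (rule measurable_compose[OF m]) (intro borel_measurable_continuous_onI continuous_intros)
  then show ?thesis
    unfolding quad_form_def matrix_vector_mult_def vec_lambda_beta
    by (intro measurable_compose[OF _ borel_measurable_Re] borel_measurable_sum borel_measurable_times
        borel_measurable_const m)
qed

lemma circ_conv_shift:
  assumes h: "periodic_seq N h" and w: "periodic_seq N w"
  shows "circ_conv N h (\<lambda>t. w (t + s)) t = circ_conv N h w (t + s)"
proof -
  have "h (t + s - (u + axis l (int (N $ l)))) = h (t + s - u)" for u l
    using h unfolding periodic_seq_def by (metis diff_diff_eq diff_add_cancel)
  then have "periodic_seq N (\<lambda>u. h (t + s - u) *v w u)"
    using w by (simp add: periodic_seq_def)
  from sum_box_shift[OF this, of s] show ?thesis
    by (simp add: circ_conv_def algebra_simps)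
qed

text \<open>The filtered difference is itself a Gaussian periodic field, the pushforward of the
  coupling under \<open>F\<close>, so \<open>norm_sq_dft\<close> applies to it; the filter becomes
  multiplication at each frequency.\<close>

lemma cost_dft:
  fixes P :: "(int ^ 'd \<Rightarrow> real ^ ('m::finite + 'm)) measure"
  assumes P: "gp_law N P" and h: "periodic_seq N h"
  defines "W \<equiv> \<lambda>l. adjoint_mat (transform N h (zeta N l)) ** transform N h (zeta N l)"
  shows "integrable P (\<lambda>z. Re (quad_form (W l) (dft (x_part z) l - dft (y_part z) l)))"
    and "cost N h t P = (\<Sum>l\<in>box_N N. \<integral>z. Re (quad_form (W l) (dft (x_part z) l - dft (y_part z) l)) \<partial>P)
      / (card (box_N N))\<^sup>2"
proof -
  interpret P: gp_law N P by fact
  define F where "F z = circ_conv N h (\<lambda>s. x_part z s - y_part z s)" for z :: "int ^ 'd \<Rightarrow> real ^ ('m + 'm)"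
  \<comment> \<open>The block matrix \<open>[I, -I]\<close>, which writes the difference of the two
    parts as one linear map of the joint field.\<close>
  define D :: "real ^ ('m + 'm) ^ 'm" where
    "D = (\<chi> i k. case k of Inl j \<Rightarrow> if i = j then 1 else 0 | Inr j \<Rightarrow> if i = j then - 1 else 0)"
  have D: "D *v z s = x_part z s - y_part z s" for z s
    by (simp add: vec_eq_iff matrix_vector_mult_def D_def x_part_def y_part_def UNIV_Plus_UNIV[symmetric]
        sum.Plus if_distrib[where f="\<lambda>x. x * _"] del: UNIV_Plus_UNIV cong: if_cong)
  have lin: "F z t = (\<Sum>s\<in>box_N N. (h (t - s) ** D) *v z s)" for z t
    by (simp add: F_def circ_conv_def matrix_vector_mul_assoc[symmetric] D)
  have shift: "F (\<lambda>t. z (t + s)) = (\<lambda>t. F z (t + s))" if "periodic_seq N z" for z s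
  proof -
    have "periodic_seq N (\<lambda>s. x_part z s - y_part z s)"
      using that by (simp add: periodic_seq_def x_part_def y_part_def)
    from circ_conv_shift[OF h this, of s] show ?thesis
      by (simp add: F_def x_part_def y_part_def fun_eq_iff)
  qed
  note push = P.gp_pushforward[where F = F and S = "\<lambda>_. box_N N", OF lin box_card(1) shift]
  interpret Q: gp_law N "distr P path_space F" by (rule push(2))
  have sq: "(norm (dft (F z) l))\<^sup>2 = Re (quad_form (W l) (dft (x_part z) l - dft (y_part z) l))" for z l
    by (simp add: F_def dft_circ_conv[OF h] dft_diff norm_sq_quad_form W_def)
  have qf: "(norm v)\<^sup>2 = Re (quad_form (mat 1) v)" for v :: "complex ^ 'm"
    by (simp add: quad_form_cip cip_self)
  have m: "(\<lambda>z. (norm (dft z l))\<^sup>2) \<in> borel_measurable (path_space :: (int ^ 'd \<Rightarrow> real ^ 'm) measure)" for l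
    unfolding qf by (rule measurable_quad_form_dft)
  show "integrable P (\<lambda>z. Re (quad_form (W l) (dft (x_part z) l - dft (y_part z) l)))"
    using Q.quad_form_dft(1)[of "mat 1" l] unfolding qf[symmetric] sq[symmetric]
    by (subst (asm) integrable_distr_eq[OF push(1) m])
  have "cost N h t P = (\<integral>z. (norm (z t))\<^sup>2 \<partial>distr P path_space F)"
    unfolding cost_def F_def[symmetric] by (subst integral_distr[OF push(1)]) auto
  also have "\<dots> = (\<Sum>l\<in>box_N N. \<integral>z. (norm (dft z l))\<^sup>2 \<partial>distr P path_space F) / (card (box_N N))\<^sup>2"
    by (rule Q.norm_sq_dft)
  also have "\<dots> = (\<Sum>l\<in>box_N N. \<integral>z. (norm (dft (F z) l))\<^sup>2 \<partial>P) / (card (box_N N))\<^sup>2"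
    by (simp only: integral_distr[OF push(1) m])
  finally show "cost N h t P = (\<Sum>l\<in>box_N N. \<integral>z. Re (quad_form (W l) (dft (x_part z) l - dft (y_part z) l)) \<partial>P)
      / (card (box_N N))\<^sup>2"
    by (simp only: sq)
qed

lemma cost_lower_bound:
  fixes px py :: "(int ^ 'd \<Rightarrow> real ^ 'm) measure"
  assumes px: "gp_law N px" and py: "gp_law N py" and h: "periodic_seq N h"
    and X: "\<And>l. l \<in> box_N N \<Longrightarrow> pd_mat (psd_density N px (zeta N l))"
    and Y: "\<And>l. l \<in> box_N N \<Longrightarrow> pd_mat (psd_density N py (zeta N l))"
    and P: "P \<in> couplings N px py"
  defines "W \<equiv> \<lambda>l. adjoint_mat (transform N h (zeta N l)) ** transform N h (zeta N l)"
    and "X \<equiv> \<lambda>l. psd_density N px (zeta N l)" and "Y \<equiv> \<lambda>l. psd_density N py (zeta N l)"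
  shows "(\<Sum>l\<in>box_N N. Re (trace (W l ** X l)) + Re (trace (W l ** Y l)) - 2 * Re (trace (bures_root (W l) (X l) (Y l))))
      / card (box_N N) \<le> cost N h t P"
proof -
  interpret px: gp_law N px by fact
  interpret py: gp_law N py by fact
  have gp: "gp_law N P" and mx: "distr P path_space x_part = px" and my: "distr P path_space y_part = py"
    using P N_pos by (auto simp: couplings_def intro: gp_lawI)
  interpret P: gp_law N P by fact
  have parts: "x_part \<in> measurable P path_space" "y_part \<in> measurable P path_space"
    using measurable_parts by (simp_all cong: measurable_cong_sets add: P.sets_P)
  have qx: "integrable P (\<lambda>z. Re (quad_form A (dft (x_part z) l)))"
    "(\<integral>z. Re (quad_form A (dft (x_part z) l)) \<partial>P) = card (box_N N) * Re (trace (A ** X l))" for A l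
    using px.quad_form_dft[of A l]
    unfolding mx[symmetric] integrable_distr_eq[OF parts(1) measurable_quad_form_dft]
      integral_distr[OF parts(1) measurable_quad_form_dft] by (simp_all add: X_def mx)
  have qy: "integrable P (\<lambda>z. Re (quad_form A (dft (y_part z) l)))"
    "(\<integral>z. Re (quad_form A (dft (y_part z) l)) \<partial>P) = card (box_N N) * Re (trace (A ** Y l))" for A l
    using py.quad_form_dft[of A l]
    unfolding my[symmetric] integrable_distr_eq[OF parts(2) measurable_quad_form_dft]
      integral_distr[OF parts(2) measurable_quad_form_dft] by (simp_all add: Y_def my)
  have freq: "card (box_N N) * (Re (trace (W l ** X l)) + Re (trace (W l ** Y l)) - 2 * Re (trace (bures_root (W l) (X l) (Y l))))
      \<le> (\<integral>z. Re (quad_form (W l) (dft (x_part z) l - dft (y_part z) l)) \<partial>P)" if l: "l \<in> box_N N" for l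
  proof -
    have "psd_mat (W l)" by (simp add: W_def psd_gram)
    then obtain A B where cert: "\<And>x y. Re (quad_form (W l) x) + Re (quad_form (W l) y) - Re (quad_form A x) - Re (quad_form B y)
        \<le> Re (quad_form (W l) (x - y))"
      and tr: "trace (A ** X l) = trace (bures_root (W l) (X l) (Y l))" "trace (B ** Y l) = trace (bures_root (W l) (X l) (Y l))"
      using transport_dual_certificate[of "W l" "X l" "Y l"] assms(4,5)[OF l] unfolding X_def Y_def by metis
    have "card (box_N N) * (Re (trace (W l ** X l)) + Re (trace (W l ** Y l)) - 2 * Re (trace (bures_root (W l) (X l) (Y l))))
      = (\<integral>z. Re (quad_form (W l) (dft (x_part z) l)) + Re (quad_form (W l) (dft (y_part z) l))
          - Re (quad_form A (dft (x_part z) l)) - Re (quad_form B (dft (y_part z) l)) \<partial>P)"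
      using qx qy by (simp add: tr algebra_simps)
    also have "\<dots> \<le> (\<integral>z. Re (quad_form (W l) (dft (x_part z) l - dft (y_part z) l)) \<partial>P)"
      using cost_dft(1)[OF gp h, of l] cert qx(1) qy(1) unfolding W_def
      by (intro integral_mono Bochner_Integration.integrable_add Bochner_Integration.integrable_diff) auto
    finally show ?thesis .
  qed
  have "card (box_N N) * (\<Sum>l\<in>box_N N. Re (trace (W l ** X l)) + Re (trace (W l ** Y l)) - 2 * Re (trace (bures_root (W l) (X l) (Y l))))
    \<le> (\<Sum>l\<in>box_N N. \<integral>z. Re (quad_form (W l) (dft (x_part z) l - dft (y_part z) l)) \<partial>P)"
    unfolding sum_distrib_left by (intro sum_mono freq)
  then have "card (box_N N) * (\<Sum>l\<in>box_N N. Re (trace (W l ** X l)) + Re (trace (W l ** Y l)) - 2 * Re (trace (bures_root (W l) (X l) (Y l))))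
    \<le> (card (box_N N))\<^sup>2 * cost N h t P"
    using cost_dft(2)[OF gp h, of t] card_pos by (simp add: W_def)
  then show ?thesis
    using card_pos by (simp add: field_simps power2_eq_square)
qed

lemma filter_coupling:
  fixes px py :: "(int ^ 'd \<Rightarrow> real ^ 'm) measure"
  assumes px: "gp_law N px" and py: "gp_law N py" and h: "periodic_seq N h" and g: "periodic_seq N g"
  defines "W \<equiv> \<lambda>l. adjoint_mat (transform N h (zeta N l)) ** transform N h (zeta N l)"
    and "X \<equiv> \<lambda>l. psd_density N px (zeta N l)" and "Y \<equiv> \<lambda>l. psd_density N py (zeta N l)"
    and "G \<equiv> \<lambda>l. transform N g (zeta N l)"
  assumes X: "\<And>l. l \<in> box_N N \<Longrightarrow> psd_mat (X l)"
    and cov: "\<And>l. l \<in> box_N N \<Longrightarrow> G l ** X l ** adjoint_mat (G l) = Y l"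
  obtains P where "P \<in> couplings N px py"
    "cost N h t P = (\<Sum>l\<in>box_N N. Re (trace (W l ** X l)) + Re (trace (W l ** Y l))
      - 2 * Re (trace (adjoint_mat (G l) ** W l ** X l))) / card (box_N N)"
proof -
  interpret px: gp_law N px by fact
  interpret py: gp_law N py by fact
  define F :: "(int ^ 'd \<Rightarrow> real ^ 'm) \<Rightarrow> int ^ 'd \<Rightarrow> real ^ ('m + 'm)" where
    "F z t = (\<chi> k. case k of Inl i \<Rightarrow> z t $ i | Inr i \<Rightarrow> circ_conv N g z t $ i)" for z t
  \<comment> \<open>The kernel of \<open>F\<close>: identity at \<open>s = t\<close> in the first
    block, the filter on the box in the second. The site \<open>t\<close> may lie outside the box,
    hence \<open>insert t (box_N N)\<close> as the support.\<close>
  define K :: "int ^ 'd \<Rightarrow> int ^ 'd \<Rightarrow> real ^ 'm ^ ('m + 'm)" where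
    "K t s = (\<chi> k j. case k of Inl i \<Rightarrow> (if s = t then if i = j then 1 else 0 else 0)
       | Inr i \<Rightarrow> (if s \<in> box_N N then g (t - s) $ i $ j else 0))" for t s
  have lin: "F z t = (\<Sum>s\<in>insert t (box_N N). K t s *v z s)" for z t
  proof -
    have "F z t $ k = (\<Sum>s\<in>insert t (box_N N). K t s *v z s) $ k" for k
    proof (cases k)
      case (Inl i)
      have "(\<Sum>s\<in>insert t (box_N N). K t s *v z s) $ k
          = (\<Sum>s\<in>insert t (box_N N). if s = t then z t $ i else 0)"
        unfolding sum_component
        by (intro sum.cong) (auto simp: Inl K_def matrix_vector_mult_def if_distrib[where f="\<lambda>x. x * _"] cong: if_cong)
      then show ?thesis using box_card(1) by (simp add: Inl F_def)
    next
      case (Inr i)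
      have "(\<Sum>s\<in>insert t (box_N N). K t s *v z s) $ k
          = (\<Sum>s\<in>insert t (box_N N). if s \<in> box_N N then (g (t - s) *v z s) $ i else 0)"
        unfolding sum_component
        by (intro sum.cong) (auto simp: Inr K_def matrix_vector_mult_def)
      also have "\<dots> = (\<Sum>s\<in>box_N N. (g (t - s) *v z s) $ i)"
        using box_card(1) by (intro sum.mono_neutral_cong_right) auto
      finally show ?thesis by (simp add: Inr F_def circ_conv_def sum_component)
    qed
    then show ?thesis by (simp add: vec_eq_iff)
  qed
  have gshift: "circ_conv N g (\<lambda>t. z (t + s)) = (\<lambda>t. circ_conv N g z (t + s))" if "periodic_seq N z" for z :: "int ^ 'd \<Rightarrow> real ^ 'm" and s
    by (simp add: fun_eq_iff circ_conv_shift[OF g that])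
  have shift: "F (\<lambda>t. z (t + s)) = (\<lambda>t. F z (t + s))" if "periodic_seq N z" for z s
    by (simp add: F_def fun_eq_iff gshift[OF that] split: sum.split)
  note push = px.gp_pushforward[where F = F and S = "\<lambda>t. insert t (box_N N)", OF lin finite.insertI[OF box_card(1)] shift]
  define P where "P = distr px path_space F"
  have gpP: "gp_law N P" unfolding P_def by (rule push(2))
  interpret P: gp_law N P by (rule gpP)
  have xF: "x_part (F z) = z" and yF: "y_part (F z) = circ_conv N g z" for z
    by (auto simp: fun_eq_iff vec_eq_iff x_part_def y_part_def F_def)
  have comp: "x_part \<circ> F = (\<lambda>z. z)" "y_part \<circ> F = circ_conv N g"
    by (simp_all add: fun_eq_iff xF yF)
  have "distr P path_space x_part = distr px path_space (\<lambda>z. z)"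
    unfolding P_def by (simp only: distr_distr[OF measurable_parts(1) push(1)] comp)
  also have "\<dots> = px" by (rule distr_id2) (simp add: px.sets_P)
  finally have mx: "distr P path_space x_part = px" .
  note push_g = px.gp_pushforward[where F = "circ_conv N g" and S = "\<lambda>_. box_N N", OF circ_conv_def box_card(1)]
  note push_g = push_g[OF gshift]
  define Q where "Q = distr px path_space (circ_conv N g)"
  have gpQ: "gp_law N Q" unfolding Q_def by (rule push_g(2))
  interpret Q: gp_law N Q by (rule gpQ)
  \<comment> \<open>The second marginal must agree as a law. Quadratic forms of the transform
    identify its spectral density with that of \<open>py\<close>, and uniqueness of Gaussian
    periodic laws does the rest.\<close>
  have "Q = py"
  proof (rule gp_law_unique_density[OF gpQ py])
    fix l assume l: "l \<in> box_N N"
    show "psd_density N Q (zeta N l) = psd_density N py (zeta N l)"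
    proof (rule matrix_eq_by_trace)
      fix A :: "complex ^ 'm ^ 'm"
      have "card (box_N N) * Re (trace (A ** psd_density N Q (zeta N l))) = (\<integral>z. Re (quad_form A (dft z l)) \<partial>Q)"
        by (simp add: Q.quad_form_dft)
      also have "\<dots> = (\<integral>z. Re (quad_form A (dft (circ_conv N g z) l)) \<partial>px)"
        unfolding Q_def by (rule integral_distr[OF push_g(1) measurable_quad_form_dft])
      also have "\<dots> = (\<integral>z. Re (quad_form (adjoint_mat (G l) ** A ** G l) (dft z l)) \<partial>px)"
        by (simp only: dft_circ_conv[OF g] quad_form_pullback G_def)
      also have "\<dots> = card (box_N N) * Re (trace (adjoint_mat (G l) ** (A ** G l ** X l)))"
        by (simp add: px.quad_form_dft X_def matrix_mul_assoc)
      also have "trace (adjoint_mat (G l) ** (A ** G l ** X l)) = trace (A ** (G l ** X l ** adjoint_mat (G l)))"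
        by (subst trace_mult_commute) (simp add: matrix_mul_assoc)
      also have "\<dots> = trace (A ** Y l)" by (simp only: cov[OF l])
      finally show "Re (trace (A ** psd_density N Q (zeta N l))) = Re (trace (A ** psd_density N py (zeta N l)))"
        using card_pos by (simp add: Y_def)
    qed
  qed
  moreover have "distr P path_space y_part = Q"
    unfolding P_def Q_def by (simp only: distr_distr[OF measurable_parts(2) push(1)] comp)
  ultimately have "P \<in> couplings N px py"
    using P.gp mx by (simp add: couplings_def)
  moreover have "cost N h t P = (\<Sum>l\<in>box_N N. Re (trace (W l ** X l)) + Re (trace (W l ** Y l))
      - 2 * Re (trace (adjoint_mat (G l) ** W l ** X l))) / card (box_N N)"
  proof -
    have freq: "(\<integral>z. Re (quad_form (W l) (dft (x_part z) l - dft (y_part z) l)) \<partial>P)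
      = card (box_N N) * (Re (trace (W l ** X l)) + Re (trace (W l ** Y l))
         - 2 * Re (trace (adjoint_mat (G l) ** W l ** X l)))" if l: "l \<in> box_N N" for l
    proof -
      have Wh: "adjoint_mat (W l) = W l" by (simp add: W_def adjoint_mult)
      have "(\<integral>z. Re (quad_form (W l) (dft (x_part z) l - dft (y_part z) l)) \<partial>P)
        = (\<integral>z. Re (quad_form (W l) (dft (x_part (F z)) l - dft (y_part (F z)) l)) \<partial>px)"
      proof -
        have "(\<lambda>z. Re (quad_form (W l) (dft (x_part z) l - dft (y_part z) l))) \<in> borel_measurable P"
          using cost_dft(1)[OF gpP h, of l] unfolding W_def by (rule borel_measurable_integrable)
        then have "(\<lambda>z. Re (quad_form (W l) (dft (x_part z) l - dft (y_part z) l))) \<in> borel_measurable path_space"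
          by (simp cong: measurable_cong_sets add: P.sets_P)
        from integral_distr[OF push(1) this] show ?thesis by (simp only: P_def)
      qed
      also have "\<dots> = (\<integral>z. Re (quad_form (adjoint_mat (mat 1 - G l) ** W l ** (mat 1 - G l)) (dft z l)) \<partial>px)"
        by (simp only: xF yF dft_circ_conv[OF g] quad_form_pullback[symmetric] G_def matrix_vector_mult_diff_rdistrib
            matrix_vector_mul_lid)
      also have "\<dots> = card (box_N N) * Re (trace (adjoint_mat (mat 1 - G l) ** W l ** (mat 1 - G l) ** X l))"
        by (simp add: px.quad_form_dft X_def)
      finally show ?thesis
        by (simp only: linear_coupling_trace[OF Wh psd_hermitian[OF X[OF l]] cov[OF l]])
    qed
    have "cost N h t P = (\<Sum>l\<in>box_N N. \<integral>z. Re (quad_form (W l) (dft (x_part z) l - dft (y_part z) l)) \<partial>P)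
      / (card (box_N N))\<^sup>2"
      unfolding W_def by (rule cost_dft(2)[OF gpP h])
    also have "\<dots> = (\<Sum>l\<in>box_N N. card (box_N N) * (Re (trace (W l ** X l)) + Re (trace (W l ** Y l))
         - 2 * Re (trace (adjoint_mat (G l) ** W l ** X l)))) / (card (box_N N))\<^sup>2"
      by (simp only: freq cong: sum.cong)
    finally show ?thesis
      using card_pos by (simp add: sum_distrib_left[symmetric] power2_eq_square)
  qed
  ultimately show thesis by (rule that)
qed

lemma INF_cost:
  fixes px py :: "(int ^ 'd \<Rightarrow> real ^ 'm) measure"
  assumes px: "gp_law N px" and py: "gp_law N py" and h: "periodic_seq N h"
    and Xpd: "\<And>l. l \<in> box_N N \<Longrightarrow> pd_mat (psd_density N px (zeta N l))"
    and Ypd: "\<And>l. l \<in> box_N N \<Longrightarrow> pd_mat (psd_density N py (zeta N l))"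
  defines "W \<equiv> \<lambda>l. adjoint_mat (transform N h (zeta N l)) ** transform N h (zeta N l)"
    and "X \<equiv> \<lambda>l. psd_density N px (zeta N l)" and "Y \<equiv> \<lambda>l. psd_density N py (zeta N l)"
  shows "couplings N px py \<noteq> {}"
    and "(INF P\<in>couplings N px py. cost N h t P) =
    (\<Sum>l\<in>box_N N. Re (trace (W l ** X l)) + Re (trace (W l ** Y l)) - 2 * Re (trace (bures_root (W l) (X l) (Y l))))
      / card (box_N N)" (is "?I = ?V")
proof -
  \<comment> \<open>Conjugate symmetry compares \<open>l\<close> with \<open>-l\<close>, which
    usually leaves the box, so definiteness is extended to all frequencies by periodicity.\<close>
  have red: "zeta N (red l) = zeta N l" for l by (rule periodic_red[OF periodic_zeta])
  have Xl: "pd_mat (psd_density N px (zeta N l))" and Yl: "pd_mat (psd_density N py (zeta N l))" for l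
    using Xpd[OF red_in_box, of l] Ypd[OF red_in_box, of l] by (simp_all only: red)
  have X: "pd_mat (X l)" and Y: "pd_mat (Y l)" for l by (simp_all add: X_def Y_def Xl Yl)
  have W: "psd_mat (W l)" for l by (simp add: W_def psd_gram)
  define eps where "eps k = 1 / real (Suc k)" for k
  define We where "We k l = W l + eps k *\<^sub>R mat 1" for k l
  have We: "pd_mat (We k l)" for k l
  proof -
    have "quad_form (We k l) v = quad_form (W l) v + of_real (eps k) * cip v v" for v
      by (simp add: We_def quad_form_cip matrix_vector_mult_add_rdistrib cip_add_right scaleR_matvec cip_scale_right)
    then have "Re (quad_form (We k l) v) = Re (quad_form (W l) v) + eps k * (norm v)\<^sup>2" for v
      by (simp add: cip_self)
    moreover have "0 < eps k" by (simp add: eps_def)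
    ultimately show ?thesis
      using psd_nonneg[OF W] psd_hermitian[OF W]
      by (auto simp: pd_mat_def We_def adjoint_add adjoint_scaleR intro!: add_nonneg_pos)
  qed
  \<comment> \<open>Bounds the cost, under the original weight \<open>W\<close>, of the coupling
    that is optimal for \<open>We k\<close>; the last summand pays for the change of weight.\<close>
  define u where "u k = (\<Sum>l\<in>box_N N. Re (trace (W l ** X l)) + Re (trace (W l ** Y l))
      - 2 * Re (trace (bures_root (We k l) (X l) (Y l))) + eps k * (Re (trace (X l)) + Re (trace (Y l)))) / card (box_N N)" for k
  have approx: "\<exists>P\<in>couplings N px py. cost N h t P \<le> u k" for k
  proof -
    define G :: "complex ^ 'd \<Rightarrow> complex ^ 'm ^ 'm" where
      "G w = transport_map (adjoint_mat (transform N h w) ** transform N h w + eps k *\<^sub>R mat 1)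
        (psd_density N px w) (psd_density N py w)" for w
    have G: "G (zeta N l) = transport_map (We k l) (X l) (Y l)" for l
      by (simp add: G_def We_def W_def X_def Y_def)
    have "G (zeta N (- l)) = cnj_mat (G (zeta N l))" for l
    proof -
      have "We k (- l) = cnj_mat (We k l)"
        by (simp add: We_def W_def transform_conjugate)
          (simp add: vec_eq_iff cnj_mat_def adjoint_mat_def matrix_matrix_mult_def mat_def)
      moreover have "X (- l) = cnj_mat (X l)" "Y (- l) = cnj_mat (Y l)"
        by (simp_all add: X_def Y_def psd_density_def transform_conjugate)
      ultimately show ?thesis by (simp only: G transport_map_cnj[OF We X Y])
    qed
    note T = transform_idft[of G, OF this]
    have cov: "transform N (idft G) (zeta N l) ** psd_density N px (zeta N l) ** adjoint_mat (transform N (idft G) (zeta N l))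
        = psd_density N py (zeta N l)" if "l \<in> box_N N" for l
      using transport_map_covariance[OF We X Y, of k l l l] by (simp only: T[OF that] G X_def Y_def)
    obtain P where P: "P \<in> couplings N px py"
      "cost N h t P = (\<Sum>l\<in>box_N N. Re (trace (W l ** X l)) + Re (trace (W l ** Y l))
        - 2 * Re (trace (adjoint_mat (transform N (idft G) (zeta N l)) ** W l ** X l))) / card (box_N N)"
      unfolding W_def X_def Y_def
      by (rule filter_coupling[OF px py h periodic_idft pd_imp_psd[OF Xl] cov])
    have "Re (trace (W l ** X l)) + Re (trace (W l ** Y l))
        - 2 * Re (trace (adjoint_mat (transform N (idft G) (zeta N l)) ** W l ** X l))
      \<le> Re (trace (W l ** X l)) + Re (trace (W l ** Y l))
      - 2 * Re (trace (bures_root (We k l) (X l) (Y l))) + eps k * (Re (trace (X l)) + Re (trace (Y l)))"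
      if l: "l \<in> box_N N" for l
    proof -
      define A where "A = transport_map (We k l) (X l) (Y l)"
      have "adjoint_mat A ** We k l ** X l = adjoint_mat A ** W l ** X l + eps k *\<^sub>R (adjoint_mat A ** X l)"
        by (simp add: We_def matrix_add_ldistrib matrix_add_rdistrib scaleR_matrix_mult)
      then have "trace (bures_root (We k l) (X l) (Y l))
          = trace (adjoint_mat A ** W l ** X l) + eps k *\<^sub>R trace (adjoint_mat A ** X l)"
        using transport_map_trace[OF We X Y, of k l l l] by (simp only: A_def trace_add trace_scaleR)
      then have "Re (trace (bures_root (We k l) (X l) (Y l)))
        = Re (trace (adjoint_mat A ** W l ** X l)) + eps k * Re (trace (adjoint_mat A ** X l))"
        by simp
      \<comment> \<open>The root for \<open>We k\<close> exceeds the correlation term under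
        \<open>W\<close> by \<open>eps k\<close> times this trace, which is bounded by marginal
        quantities alone.\<close>
      moreover have "eps k * (2 * Re (trace (adjoint_mat A ** X l))) \<le> eps k * (Re (trace (X l)) + Re (trace (Y l)))"
        using transport_map_covariance[OF We X Y, of k l l l] unfolding A_def
        by (intro mult_left_mono linear_coupling_trace_bound pd_imp_psd X) (auto simp: eps_def)
      ultimately show ?thesis
        by (simp add: T[OF l] G A_def[symmetric])
    qed
    then have "cost N h t P \<le> u k"
      unfolding P(2) u_def by (intro divide_right_mono sum_mono) auto
    with P(1) show ?thesis by blast
  qed
  have "(\<lambda>k. trace (bures_root (We k l) (X l) (Y l))) \<longlonglongrightarrow> trace (bures_root (W l) (X l) (Y l))" for l
  proof -
    have "(\<lambda>k. We k l) \<longlonglongrightarrow> W l + 0 *\<^sub>R mat 1"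
      unfolding We_def eps_def by (intro tendsto_intros LIMSEQ_inverse_real_of_nat[unfolded inverse_eq_divide])
    then have "(\<lambda>k. We k l) \<longlonglongrightarrow> W l" by simp
    then have "(\<lambda>k. bures_root (We k l) (X l) (Y l)) \<longlonglongrightarrow> bures_root (W l) (X l) (Y l)"
      unfolding bures_root_def
      by (intro tendsto_sqrt_mat psd_bures_arg pd_imp_psd X Y tendsto_matrix_mult tendsto_const
          psd_hermitian[OF pd_imp_psd[OF We]])
    then show ?thesis unfolding trace_def by (intro tendsto_intros)
  qed
  moreover have "eps \<longlonglongrightarrow> 0"
    unfolding eps_def[abs_def] using LIMSEQ_inverse_real_of_nat by (simp add: inverse_eq_divide)
  ultimately have "u \<longlonglongrightarrow> (\<Sum>l\<in>box_N N. Re (trace (W l ** X l)) + Re (trace (W l ** Y l))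
      - 2 * Re (trace (bures_root (W l) (X l) (Y l))) + 0 * (Re (trace (X l)) + Re (trace (Y l)))) / card (box_N N)"
    unfolding u_def[abs_def] using card_pos by (intro tendsto_intros) auto
  then have u: "u \<longlonglongrightarrow> ?V" by simp
  have lower: "?V \<le> cost N h t P" if "P \<in> couplings N px py" for P
    unfolding W_def X_def Y_def by (rule cost_lower_bound[OF px py h Xpd Ypd that])
  have "?I \<le> u k" for k
  proof -
    obtain P where P: "P \<in> couplings N px py" "cost N h t P \<le> u k" using approx by blast
    \<comment> \<open>A real infimum can be compared with a member of the set only if the set is
      bounded below; the lower bound supplies this too.\<close>
    have "bdd_below (cost N h t ` couplings N px py)" using lower by (intro bdd_belowI2)
    then show ?thesis using P by (intro cINF_lower2)
  qed
  with u have "?I \<le> ?V" by (intro LIMSEQ_le_const) auto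
  moreover have "?V \<le> ?I" using approx lower by (intro cINF_greatest) auto
  ultimately show "?I = ?V" by simp
  show "couplings N px py \<noteq> {}" using approx by blast
qed

end

theorem proposition4:
  fixes N :: "nat ^ 'd"
    and px py :: "(int ^ 'd \<Rightarrow> real ^ 'm) measure"
    and h :: "int ^ 'd \<Rightarrow> real ^ 'm ^ 'm"
    and H \<Omega> \<Phi>x \<Phi>y :: "complex ^ 'd \<Rightarrow> complex ^ 'm ^ 'm"
    and t :: "int ^ 'd"
  assumes "\<And>i. 0 < N $ i"
    and "gaussian_periodic_law N px"
    and "gaussian_periodic_law N py"
    and "\<Phi>x = psd_density N px"
    and "\<Phi>y = psd_density N py"
    and "\<And>l. l \<in> box_N N \<Longrightarrow> pd_mat (\<Phi>x (zeta N l))"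
    and "\<And>l. l \<in> box_N N \<Longrightarrow> pd_mat (\<Phi>y (zeta N l))"
    and "periodic_seq N h"
    and "H = transform N h"
    and "\<Omega> = (\<lambda>w. adjoint_mat (H w) ** H w)"
  shows "complex_of_real ((d_Omega N h t px py)\<^sup>2) =
      1 / of_nat (\<Prod>i\<in>UNIV. N $ i) *
      trace (\<Sum>l\<in>box_N N.
        \<Omega> (zeta N l) ** \<Phi>x (zeta N l) + \<Omega> (zeta N l) ** \<Phi>y (zeta N l)
        - 2 *\<^sub>R sqrt_mat (sqrt_mat (\<Phi>y (zeta N l)) ** \<Omega> (zeta N l) ** \<Phi>x (zeta N l)
                          ** \<Omega> (zeta N l) ** sqrt_mat (\<Phi>y (zeta N l))))
    \<and> d_Omega N h t px py = weighted_hellinger N \<Omega> \<Phi>x \<Phi>y"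
proof -
  interpret torus N using assms(1) by (rule torus.intro)
  note dens = assms(4,5)
  define f where "f l = Re (trace (\<Omega> (zeta N l) ** \<Phi>x (zeta N l))) + Re (trace (\<Omega> (zeta N l) ** \<Phi>y (zeta N l)))
      - 2 * Re (trace (bures_root (\<Omega> (zeta N l)) (\<Phi>x (zeta N l)) (\<Phi>y (zeta N l))))" for l
  define V where "V = (\<Sum>l\<in>box_N N. f l) / card (box_N N)"
  have inf: "(INF P\<in>couplings N px py. cost N h t P) = V"
    using INF_cost(2)[OF gp_lawI[OF assms(1,2)] gp_lawI[OF assms(1,3)] assms(8) assms(6)[unfolded dens] assms(7)[unfolded dens], of t]
    by (simp add: V_def f_def assms(9,10) dens)
  \<comment> \<open>\<open>d_Omega\<close> is a square root, so squaring it returns \<open>V\<close>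
    only for \<open>V \<ge> 0\<close>; this follows from nonnegative costs on a nonempty set of
    couplings.\<close>
  have "0 \<le> (INF P\<in>couplings N px py. cost N h t P)" if "couplings N px py \<noteq> {}"
    using that by (intro cINF_greatest) (simp_all add: cost_def)
  moreover have "couplings N px py \<noteq> {}"
    using INF_cost(1)[OF gp_lawI[OF assms(1,2)] gp_lawI[OF assms(1,3)] assms(8) assms(6)[unfolded dens] assms(7)[unfolded dens]]
    by simp
  ultimately have V0: "0 \<le> V" using inf by simp
  have d: "d_Omega N h t px py = sqrt V" by (simp add: d_Omega_def inf)
  \<comment> \<open>The claim is an equation of complex numbers. Products of two Hermitian matrices
    have real trace, so each summand is the real number \<open>f l\<close>.\<close>
  have freq: "trace (\<Omega> (zeta N l) ** \<Phi>x (zeta N l) + \<Omega> (zeta N l) ** \<Phi>y (zeta N l)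
        - 2 *\<^sub>R sqrt_mat (sqrt_mat (\<Phi>y (zeta N l)) ** \<Omega> (zeta N l) ** \<Phi>x (zeta N l)
                          ** \<Omega> (zeta N l) ** sqrt_mat (\<Phi>y (zeta N l)))) = of_real (f l)"
    if l: "l \<in> box_N N" for l
  proof -
    have W: "adjoint_mat (\<Omega> (zeta N l)) = \<Omega> (zeta N l)" by (simp add: assms(10) adjoint_mult)
    note X = pd_imp_psd[OF assms(6)[OF l]] and Y = pd_imp_psd[OF assms(7)[OF l]]
    have T: "adjoint_mat (bures_root (\<Omega> (zeta N l)) (\<Phi>x (zeta N l)) (\<Phi>y (zeta N l)))
        = bures_root (\<Omega> (zeta N l)) (\<Phi>x (zeta N l)) (\<Phi>y (zeta N l))"
      unfolding bures_root_def by (intro psd_hermitian psd_sqrt_mat psd_bures_arg X Y W)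
    show ?thesis
      unfolding bures_root_def[symmetric] f_def
      using Im_trace_product_hermitian[OF T adjoint_one] Im_trace_product_hermitian[OF W psd_hermitian[OF X]]
        Im_trace_product_hermitian[OF W psd_hermitian[OF Y]]
      by (simp add: trace_add trace_sub trace_scaleR complex_eq_iff)
  qed
  have rhs: "1 / of_nat (\<Prod>i\<in>UNIV. N $ i) *
      trace (\<Sum>l\<in>box_N N.
        \<Omega> (zeta N l) ** \<Phi>x (zeta N l) + \<Omega> (zeta N l) ** \<Phi>y (zeta N l)
        - 2 *\<^sub>R sqrt_mat (sqrt_mat (\<Phi>y (zeta N l)) ** \<Omega> (zeta N l) ** \<Phi>x (zeta N l)
                          ** \<Omega> (zeta N l) ** sqrt_mat (\<Phi>y (zeta N l)))) = complex_of_real V"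
    by (simp add: trace_sum freq V_def box_card(2)[symmetric] del: of_nat_prod)
  show ?thesis
    unfolding weighted_hellinger_def Let_def rhs using V0 d by simp
qed

end
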